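(* Let $X$ be a compact metric space with bounded local complexity. Consider a random dynamical system $S:\Omega\times X\to\Omega\times X$, $S(\omega,x)=(\theta\omega,T_\omega x)$, preserving a probability measure $\nu=\mathbb{P}\otimes\mu_\omega$, for which the correlation dimensions $D_2^{\mathrm{an}}$ and $D_2^{\mathrm{qu}}$ are well defined, and for which $\omega\mapsto\mu_\omega$ is Lipschitz. Assume that $S$ is Lipschitz, that $S$ mixes stretched exponentially along the fibers, and that the base map $\theta$ has stretched exponential $4$-mixing. Then, for $\mathbb{P}$-almost every $\omega$, for $\mu_\omega^{\otimes 2}$-almost every $(x,y)$, $$\frac{-\log \min_{0\le i,j<n} d(T_\omega^i x,T_\omega^j y)}{\log n}\xrightarrow[n\to\infty]{}\max\left\{\frac{2}{D_2^{\mathrm{an}}},\frac{1}{D_2^{\mathrm{qu}}}\right\}.$$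
   Context: Random dynamical system: $\Omega$ is a compact metric space with a probability measure $\mathbb{P}$, and $\theta:\Omega\to\Omega$ is invertible and preserves $\mathbb{P}$. $(X,d)$ is a metric space and, for each $\omega\in\Omega$, $T_\omega:X\to X$ is measurable, such that the skew product $S(\omega,x)=(\theta\omega,T_\omega x)$ is measurable and preserves a probability measure $\nu$ on $\Omega\times X$ whose marginal on $\Omega$ is $\mathbb{P}$. Write $T_\omega^n=T_{\theta^{n-1}\omega}\circ\dots\circ T_\omega$. The measure $\nu$ is disintegrated above $\mathbb{P}$ into probability measures $\mu_\omega$ on $X$ depending measurably on $\omega$: $\int f\,d\nu=\int(\int f(\omega,x)\,d\mu_\omega(x))\,d\mathbb{P}(\omega)$, written $\nu=\mathbb{P}\otimes\mu_\omega$; one has $(T_\omega)_*\mu_\omega=\mu_{\theta\omega}$ for $\mathbb{P}$-a.e. $\omega$. Let $\mu=\int\mu_\omega\,d\mathbb{P}(\omega)$ be the marginal of $\nu$ on $X$. $S$ Lipschitz refers to a standard product metric on $\Omega\times X$. Lipschitz norm: $\|f\|_{\mathrm{Lip}}=\|f\|_\infty+\mathrm{Lip}(f)$, where $\mathrm{Lip}(f)$ is the best Lipschitz constant of $f$. Bounded local complexity: a compact metric space $X$ has bounded local complexity if there is a constant $C_0$ such that, for every small enough $r>0$, there are $k(r)<\infty$ and points $x^{(r)}_1,\dots,x^{(r)}_{k(r)}\in X$ such that the balls $B(x^{(r)}_p,r)$, $1\le p\le k(r)$, cover $X$ and any point of $X$ belongs to at most $C_0$ of the balls $B(x^{(r)}_p,4r)$.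 Correlation dimensions: let $$\underline{D}_2^{\mathrm{an}},\ \overline{D}_2^{\mathrm{an}}=\liminf_{r\to0},\ \limsup_{r\to 0}\ \frac{\log\int\mu(B(x,r))\,d\mu(x)}{\log r},$$ $$\underline{D}_2^{\mathrm{qu}},\ \overline{D}_2^{\mathrm{qu}}=\liminf_{r\to0},\ \limsup_{r\to 0}\ \frac{\log\int\int\mu_\omega(B(x,r))\,d\mu_\omega(x)\,d\mathbb{P}(\omega)}{\log r}.$$ $D_2^{\mathrm{an}}$ (resp. $D_2^{\mathrm{qu}}$) is well defined if the corresponding liminf and limsup coincide, and then denotes the common value. $\omega\mapsto\mu_\omega$ is Lipschitz: there is $C_1>0$ such that $|\int f\,d\mu_\omega-\int f\,d\mu_{\omega'}|\le C_1\|f\|_{\mathrm{Lip}}\,d(\omega,\omega')$ for every Lipschitz $f:X\to\mathbb{R}$ and all $\omega,\omega'\in\Omega$. Stretched exponential $4$-mixing of $\theta$: there are $c_2,C_2>0$ such that for all Lipschitz $f_1,f_2,g_1,g_2:\Omega\to\mathbb{R}$, all $n\in\mathbb{N}$ and all nonnegative integers $a\le b\le c$ with $b-a\ge n$, $$\left|\int f_1\cdot f_2\circ\theta^a\cdot g_1\circ\theta^b\cdot g_2\circ\theta^c\,d\mathbb{P}-\left(\int f_1\cdot f_2\circ\theta^a\,d\mathbb{P}\right)\left(\int g_1\cdot g_2\circ\theta^{c-b}\,d\mathbb{P}\right)\right|\le C_2e^{-n^{c_2}}\|f_1\|_{\mathrm{Lip}}\|f_2\|_{\mathrm{Lip}}\|g_1\|_{\mathrm{Lip}}\|g_2\|_{\mathrm{Lip}}.$$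 Stretched exponential mixing along the fibers: there are $c_3,C_3>0$ such that for all Lipschitz $f,g:X\to\mathbb{R}$, all $n\in\mathbb{N}$ and all $\omega\in\Omega$, $$\left|\int f\cdot g\circ T_\omega^n\,d\mu_\omega-\left(\int f\,d\mu_\omega\right)\left(\int g\,d\mu_{\theta^n\omega}\right)\right|\le C_3e^{-n^{c_3}}\|f\|_{\mathrm{Lip}}\|g\|_{\mathrm{Lip}}.$$ Conventions: $-\log 0=+\infty$, and $1/0=2/0=+\infty$. *)

theory Defs
  imports "HOL-Probability.Probability"
begin

section \<open>Random dynamical systems\<close>

definition skew_product :: "('w \<Rightarrow> 'w) \<Rightarrow> ('w \<Rightarrow> 'x \<Rightarrow> 'x) \<Rightarrow> 'w \<times> 'x \<Rightarrow> 'w \<times> 'x" where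
  "skew_product \<theta> T = (\<lambda>(\<omega>, x). (\<theta> \<omega>, T \<omega> x))"

primrec fiber_iter :: "('w \<Rightarrow> 'w) \<Rightarrow> ('w \<Rightarrow> 'x \<Rightarrow> 'x) \<Rightarrow> nat \<Rightarrow> 'w \<Rightarrow> 'x \<Rightarrow> 'x" where
  "fiber_iter \<theta> T 0 \<omega> = id"
| "fiber_iter \<theta> T (Suc n) \<omega> = T ((\<theta> ^^ n) \<omega>) \<circ> fiber_iter \<theta> T n \<omega>"

text \<open>Both \<open>\<Omega>\<close> and \<open>X\<close> are the universes of types of class \<^class>\<open>metric_space\<close>.\<close>

locale random_dynamical_system = base: prob_space P + total: prob_space \<nu>
  for P :: "'w::metric_space measure" and \<nu> :: "('w \<times> 'x::metric_space) measure" +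
  fixes \<theta> :: "'w \<Rightarrow> 'w" and T :: "'w \<Rightarrow> 'x \<Rightarrow> 'x"
  assumes compact_base: "compact (UNIV :: 'w set)"
    and sets_base: "sets P = sets borel"
    and base_bij: "bij \<theta>"
    and base_measurable: "\<theta> \<in> borel \<rightarrow>\<^sub>M borel"
    and base_invariant: "distr P P \<theta> = P"
    and fiber_measurable: "\<And>\<omega>. T \<omega> \<in> borel \<rightarrow>\<^sub>M borel"
    and sets_total: "sets \<nu> = sets (borel \<Otimes>\<^sub>M borel)"
    and skew_measurable: "skew_product \<theta> T \<in> borel \<Otimes>\<^sub>M borel \<rightarrow>\<^sub>M borel \<Otimes>\<^sub>M borel"
    and skew_invariant: "distr \<nu> \<nu> (skew_product \<theta> T) = \<nu>"
    and marginal_base: "distr \<nu> P fst = P"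

text \<open>\<open>\<nu> = P \<otimes> \<mu>\<^sub>\<omega>\<close>. Measurability into \<^const>\<open>prob_algebra\<close> includes that
  every \<open>\<mu>\<^sub>\<omega>\<close> is a Borel probability measure.\<close>

definition disintegration ::
  "'w::metric_space measure \<Rightarrow> ('w \<times> 'x::metric_space) measure \<Rightarrow> ('w \<Rightarrow> 'x measure) \<Rightarrow> bool" where
  "disintegration P \<nu> \<mu> \<longleftrightarrow>
     \<mu> \<in> P \<rightarrow>\<^sub>M prob_algebra borel \<and>
     (\<forall>f :: 'w \<times> 'x \<Rightarrow> ennreal. f \<in> borel \<Otimes>\<^sub>M borel \<rightarrow>\<^sub>M borel \<longrightarrow>
        (\<integral>\<^sup>+ z. f z \<partial>\<nu>) = (\<integral>\<^sup>+ \<omega>. (\<integral>\<^sup>+ x. f (\<omega>, x) \<partial>\<mu> \<omega>) \<partial>P))"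

definition fiber_marginal :: "('w \<times> 'x::metric_space) measure \<Rightarrow> 'x measure" where
  "fiber_marginal \<nu> = distr \<nu> borel snd"

section \<open>Lipschitz functions and mixing\<close>

definition is_lipschitz :: "('a::metric_space \<Rightarrow> 'b::metric_space) \<Rightarrow> bool" where
  "is_lipschitz f \<longleftrightarrow> (\<exists>L. L-lipschitz_on UNIV f)"

text \<open>Only used for Lipschitz functions on compact spaces, where both the supremum and the
  infimum are those of nonempty bounded sets.\<close>

definition lip_norm :: "('a::metric_space \<Rightarrow> real) \<Rightarrow> real" where
  "lip_norm f = (SUP x. \<bar>f x\<bar>) + Inf {L. L-lipschitz_on UNIV f}"

definition lipschitz_measures :: "('w::metric_space \<Rightarrow> 'x::metric_space measure) \<Rightarrow> bool" where
  "lipschitz_measures \<mu> \<longleftrightarrow>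
     (\<exists>C>0. \<forall>f. is_lipschitz f \<longrightarrow> (\<forall>\<omega> \<omega>'.
        \<bar>(\<integral>x. f x \<partial>\<mu> \<omega>) - (\<integral>x. f x \<partial>\<mu> \<omega>')\<bar> \<le> C * lip_norm f * dist \<omega> \<omega>'))"

definition stretched_exp_4_mixing :: "'w::metric_space measure \<Rightarrow> ('w \<Rightarrow> 'w) \<Rightarrow> bool" where
  "stretched_exp_4_mixing P \<theta> \<longleftrightarrow>
     (\<exists>c2>0. \<exists>C2>0. \<forall>f1 f2 g1 g2 :: 'w \<Rightarrow> real.
        is_lipschitz f1 \<and> is_lipschitz f2 \<and> is_lipschitz g1 \<and> is_lipschitz g2 \<longrightarrow>
        (\<forall>n a b c :: nat. a \<le> b \<and> b \<le> c \<and> b - a \<ge> n \<longrightarrow>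
           \<bar>(\<integral>\<omega>. f1 \<omega> * f2 ((\<theta> ^^ a) \<omega>) * g1 ((\<theta> ^^ b) \<omega>) * g2 ((\<theta> ^^ c) \<omega>) \<partial>P)
             - (\<integral>\<omega>. f1 \<omega> * f2 ((\<theta> ^^ a) \<omega>) \<partial>P) * (\<integral>\<omega>. g1 \<omega> * g2 ((\<theta> ^^ (c - b)) \<omega>) \<partial>P)\<bar>
           \<le> C2 * exp (- (real n powr c2)) * lip_norm f1 * lip_norm f2 * lip_norm g1 * lip_norm g2))"

definition stretched_exp_fiber_mixing ::
  "('w \<Rightarrow> 'w) \<Rightarrow> ('w \<Rightarrow> 'x \<Rightarrow> 'x) \<Rightarrow> ('w \<Rightarrow> 'x::metric_space measure) \<Rightarrow> bool" where
  "stretched_exp_fiber_mixing \<theta> T \<mu> \<longleftrightarrow>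
     (\<exists>c3>0. \<exists>C3>0. \<forall>f g :: 'x \<Rightarrow> real. is_lipschitz f \<and> is_lipschitz g \<longrightarrow>
        (\<forall>(n::nat) \<omega>.
           \<bar>(\<integral>x. f x * g (fiber_iter \<theta> T n \<omega> x) \<partial>\<mu> \<omega>)
             - (\<integral>x. f x \<partial>\<mu> \<omega>) * (\<integral>x. g x \<partial>\<mu> ((\<theta> ^^ n) \<omega>))\<bar>
           \<le> C3 * exp (- (real n powr c3)) * lip_norm f * lip_norm g))"

section \<open>Local complexity and correlation dimensions\<close>

text \<open>The multiplicity bound counts indices, so repeated centres count separately.\<close>

definition bounded_local_complexity :: "'x::metric_space set \<Rightarrow> bool" where
  "bounded_local_complexity X \<longleftrightarrow>
     (\<exists>C0::nat. \<exists>r0>0. \<forall>r. 0 < r \<and> r < r0 \<longrightarrow>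
        (\<exists>(k::nat) (c :: nat \<Rightarrow> 'x). c ` {1..k} \<subseteq> X \<and>
           X \<subseteq> (\<Union>p\<in>{1..k}. ball (c p) r) \<and>
           (\<forall>x\<in>X. card {p \<in> {1..k}. x \<in> ball (c p) (4 * r)} \<le> C0)))"

text \<open>Logarithm on the nonnegative reals, with \<open>log 0 = -\<infinity>\<close>.\<close>

definition elog :: "real \<Rightarrow> ereal" where
  "elog t = (if t = 0 then -\<infinity> else ereal (ln t))"

definition correlation :: "'x::metric_space measure \<Rightarrow> real \<Rightarrow> real" where
  "correlation M r = (\<integral>x. measure M (ball x r) \<partial>M)"

definition quenched_correlation ::
  "'w measure \<Rightarrow> ('w \<Rightarrow> 'x::metric_space measure) \<Rightarrow> real \<Rightarrow> real" where
  "quenched_correlation P \<mu> r = (\<integral>\<omega>. correlation (\<mu> \<omega>) r \<partial>P)"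

definition lower_D2_an :: "('w \<times> 'x::metric_space) measure \<Rightarrow> ereal" where
  "lower_D2_an \<nu> = Liminf (at_right 0) (\<lambda>r. elog (correlation (fiber_marginal \<nu>) r) / ereal (ln r))"

definition upper_D2_an :: "('w \<times> 'x::metric_space) measure \<Rightarrow> ereal" where
  "upper_D2_an \<nu> = Limsup (at_right 0) (\<lambda>r. elog (correlation (fiber_marginal \<nu>) r) / ereal (ln r))"

definition lower_D2_qu :: "'w measure \<Rightarrow> ('w \<Rightarrow> 'x::metric_space measure) \<Rightarrow> ereal" where
  "lower_D2_qu P \<mu> = Liminf (at_right 0) (\<lambda>r. elog (quenched_correlation P \<mu> r) / ereal (ln r))"

definition upper_D2_qu :: "'w measure \<Rightarrow> ('w \<Rightarrow> 'x::metric_space measure) \<Rightarrow> ereal" where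
  "upper_D2_qu P \<mu> = Limsup (at_right 0) (\<lambda>r. elog (quenched_correlation P \<mu> r) / ereal (ln r))"

section \<open>Minimal distance between two orbits\<close>

text \<open>Only meaningful for \<open>n \<ge> 1\<close>.\<close>

definition min_orbit_dist ::
  "('w \<Rightarrow> 'w) \<Rightarrow> ('w \<Rightarrow> 'x \<Rightarrow> 'x::metric_space) \<Rightarrow> 'w \<Rightarrow> nat \<Rightarrow> 'x \<Rightarrow> 'x \<Rightarrow> real" where
  "min_orbit_dist \<theta> T \<omega> n x y =
     Min {dist (fiber_iter \<theta> T i \<omega> x) (fiber_iter \<theta> T j \<omega> y) | i j. i < n \<and> j < n}"

end

theory Submission
  imports Defs "HOL-Real_Asymp.Real_Asymp"
begin

text \<open>
  Choose \<open>x\<close> and \<open>y\<close> independently in the same fiber \<open>\<omega>\<close>, and count the pairs of times \<open>i, j < n\<close>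
  at which the two orbits are within distance \<open>r\<close>. For \<open>i = j\<close> both points have law
  \<open>\<mu> ((\<theta> ^^ i) \<omega>)\<close>, so on average over \<open>\<omega>\<close> such a pair is counted with probability about
  \<open>r powr D2_qu\<close>. For \<open>i\<close> and \<open>j\<close> far apart, mixing of \<open>\<theta>\<close> makes the two fibers nearly independent,
  so the points look like independent samples of the marginal of \<open>\<nu>\<close>, and the probability is about
  \<open>r powr D2_an\<close>. The expected count is therefore about \<open>n * r powr D2_qu + n\<^sup>2 * r powr D2_an\<close>, and
  with \<open>r = n powr (- s)\<close> it tends to zero when \<open>s\<close> exceeds both \<open>1 / D2_qu\<close> and \<open>2 / D2_an\<close>, and
  to infinity when \<open>s\<close> is below one of them.

  If the expected count tends to zero, Markov's inequality applies (\<open>prob_close_le\<close>). A pair of times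
  closer than a gap \<open>g\<close> of order \<open>n powr \<epsilon>\<close> contributes no more than a pair \<open>i = j\<close>, so that the strip
  around the diagonal costs only a factor of order \<open>g\<close>.

  If it tends to infinity, a second moment shows that the count is positive. Two restricted
  counts are used: equal times (\<open>prob_same_time_far_le\<close>), and an early time for \<open>x\<close> against a late
  time for \<open>y\<close> (\<open>prob_early_late_far_le\<close>). All times are multiples of \<open>g\<close>, so distinct ones are
  decorrelated. The delicate part of the second variance comes from quadruples that share one time; it
  is governed by the integral of \<open>\<mu>(B(x, r))\<^sup>2\<close> for the marginal \<open>\<mu>\<close>, which is at most a constant
  times the power 3/2 of the integral of \<open>\<mu>(B(x, r))\<close> (\<open>overlap_half\<close>).

  Mixing is only available for Lipschitz functions and for products of a function of \<open>x\<close> with a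
  function of \<open>y\<close>. The indicator of \<open>dist x y < r\<close> is therefore replaced by a sum of products
  \<open>\<phi> p x * \<phi> p y\<close> of bump functions supported near the balls of a cover. Bounded local complexity
  makes this sum comparable to the indicator and keeps the number of bumps polynomial in \<open>1 / r\<close>
  (\<open>bump_families_exist\<close>). All mixing errors are then a power of \<open>n\<close> times a stretched exponential in
  \<open>n powr \<epsilon>\<close>, which is negligible.

  The resulting probabilities decay polynomially in \<open>n\<close>, hence are summable along \<open>n = 2 ^ l\<close>. The
  Borel-Cantelli lemma and the monotonicity of the minimal distance in \<open>n\<close> (\<open>log_rate_limit\<close>) give
  the limit.
\<close>


section \<open>Measurability of the distance and Lipschitz norms\<close>

text \<open>The type \<open>'x\<close> carries no second countability, so an open set of the product need not be visibly in
  the product sigma-algebra. Compactness supplies finite nets at all scales, and with them the set is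
  a countable union of rectangles.\<close>
lemma compact_dist_less_measurable:
  assumes "compact (UNIV :: 'x::metric_space set)"
  shows "{z :: 'x \<times> 'x. dist (fst z) (snd z) < r} \<in> sets (borel \<Otimes>\<^sub>M borel)"
proof -
  have "\<exists>D::'x set. finite D \<and> UNIV \<subseteq> (\<Union>z\<in>D. ball z (1 / real (Suc n)))" for n
  proof -
    obtain D :: "'x set" where "D \<subseteq> UNIV" "finite D" "UNIV \<subseteq> (\<Union>z\<in>D. ball z (1 / real (Suc n)))"
      by (rule compactE_image[OF assms, of UNIV "\<lambda>z. ball z (1 / real (Suc n))"]) auto
    then show ?thesis by blast
  qed
  then obtain D :: "nat \<Rightarrow> 'x set" where D: "\<And>n. finite (D n)"
      "\<And>n. UNIV \<subseteq> (\<Union>z\<in>D n. ball z (1 / real (Suc n)))"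
    by metis
  have "{z :: 'x \<times> 'x. dist (fst z) (snd z) < r} =
      (\<Union>n. \<Union>z\<in>D n. ball z (1 / real (Suc n)) \<times> ball z (r - 1 / real (Suc n)))" (is "?L = ?R")
  proof (intro subset_antisym subsetI)
    fix p assume "p \<in> ?L"
    then have pos: "r - dist (fst p) (snd p) > 0" by simp
    then obtain n where n: "1 / real (Suc n) < (r - dist (fst p) (snd p)) / 2"
      using nat_approx_posE[of "(r - dist (fst p) (snd p)) / 2"] by fastforce
    obtain z where z: "z \<in> D n" "dist z (fst p) < 1 / real (Suc n)"
      using D(2)[of n] by force
    have "dist z (snd p) < r - 1 / real (Suc n)"
      using dist_triangle[of z "snd p" "fst p"] z(2) n by argo
    then show "p \<in> ?R" using z by (cases p) auto
  next
    fix p assume "p \<in> ?R"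
    then obtain n z where "dist z (fst p) < 1 / real (Suc n)" "dist z (snd p) < r - 1 / real (Suc n)"
      by (cases p) auto
    then have "dist (fst p) (snd p) < r"
      using dist_triangle[of "fst p" "snd p" z] by (simp add: dist_commute)
    then show "p \<in> ?L" by simp
  qed
  also have "\<dots> \<in> sets (borel \<Otimes>\<^sub>M borel)"
    using D(1) by (intro sets.countable_UN sets.finite_UN pair_measureI) auto
  finally show ?thesis .
qed

lemma compact_dist_measurable:
  assumes "compact (UNIV :: 'x::metric_space set)"
  shows "(\<lambda>z :: 'x \<times> 'x. dist (fst z) (snd z)) \<in> borel_measurable (borel \<Otimes>\<^sub>M borel)"
  unfolding borel_measurable_iff_less
  using compact_dist_less_measurable[OF assms] by (auto simp: space_pair_measure)

lemma lip_norm_le: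
  fixes f :: "'a::metric_space \<Rightarrow> real"
  assumes "L-lipschitz_on UNIV f" "\<And>x. \<bar>f x\<bar> \<le> c"
  shows "lip_norm f \<le> c + L"
proof -
  have "(SUP x. \<bar>f x\<bar>) \<le> c" by (rule cSUP_least) (use assms in auto)
  moreover have "Inf {L. L-lipschitz_on UNIV f} \<le> L"
    by (rule cInf_lower) (use assms in \<open>auto intro!: bdd_belowI[of _ 0] simp: lipschitz_on_def\<close>)
  ultimately show ?thesis by (simp add: lip_norm_def)
qed

lemma lip_norm_nonneg:
  fixes f :: "'a::metric_space \<Rightarrow> real"
  assumes "is_lipschitz f" "\<And>x. \<bar>f x\<bar> \<le> c"
  shows "0 \<le> lip_norm f"
proof -
  have "\<bar>f undefined\<bar> \<le> (SUP x. \<bar>f x\<bar>)"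
    by (rule cSUP_upper) (use assms in \<open>auto intro!: bdd_aboveI[of _ c]\<close>)
  moreover have "0 \<le> Inf {L. L-lipschitz_on UNIV f}"
    by (rule cInf_greatest) (use assms in \<open>auto simp: is_lipschitz_def lipschitz_on_def\<close>)
  ultimately show ?thesis by (simp add: lip_norm_def)
qed

lemma lipschitz_unit_mult:
  fixes f g :: "'a::metric_space \<Rightarrow> real"
  assumes f: "L-lipschitz_on UNIV f" "\<And>x. f x \<in> {0..1}"
    and g: "K-lipschitz_on UNIV g" "\<And>x. g x \<in> {0..1}"
  shows "(L + K)-lipschitz_on UNIV (\<lambda>x. f x * g x)"
proof (rule lipschitz_onI)
  fix x y :: 'a
  have "\<bar>f x * g x - f y * g y\<bar> = \<bar>(f x - f y) * g x + f y * (g x - g y)\<bar>"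
    by (simp add: algebra_simps)
  also have "\<dots> \<le> \<bar>f x - f y\<bar> * \<bar>g x\<bar> + \<bar>f y\<bar> * \<bar>g x - g y\<bar>"
    by (metis abs_mult abs_triangle_ineq)
  also have "\<dots> \<le> (L * dist x y) * 1 + 1 * (K * dist x y)"
    using lipschitz_onD[OF f(1), of x y] lipschitz_onD[OF g(1), of x y] f(2)[of y] g(2)[of x]
    by (intro add_mono mult_mono) (auto simp: dist_real_def)
  finally show "dist (f x * g x) (f y * g y) \<le> (L + K) * dist x y"
    by (simp add: dist_real_def algebra_simps)
qed (use f g in \<open>auto simp: lipschitz_on_def\<close>)

section \<open>Bump functions on a space of bounded local complexity\<close>

text \<open>A substitute for the indicator of \<open>dist x y < r\<close> that splits into products. Points closer than \<open>r\<close>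
  have a common bump equal to 1 at both, and two points seen by a common bump are closer than \<open>8 * r\<close>,
  so the sum of all \<open>\<phi> p x * \<phi> p y\<close> lies between the indicators at scales \<open>r\<close> and \<open>8 * r\<close> up to the
  factor \<open>C0\<close>.\<close>
locale bump_family =
  fixes I :: "nat set" and \<phi> :: "nat \<Rightarrow> 'x::metric_space \<Rightarrow> real" and C0 :: nat and L r :: real
  assumes finite_index: "finite I"
    and unit: "\<And>p x. \<phi> p x \<in> {0..1}"
    and lip: "\<And>p. L-lipschitz_on UNIV (\<phi> p)"
    and multiplicity: "\<And>x. card {p\<in>I. \<phi> p x \<noteq> 0} \<le> C0"
    and covers: "\<And>x y. dist x y < r \<Longrightarrow> \<exists>p\<in>I. \<phi> p x = 1 \<and> \<phi> p y = 1"
    and support_small: "\<And>p x y. \<phi> p x \<noteq> 0 \<Longrightarrow> \<phi> p y \<noteq> 0 \<Longrightarrow> dist x y < 8 * r"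

text \<open>A tent truncated to the value 1 on the ball of radius \<open>2 * r\<close> and to 0 outside the ball of radius
  \<open>4 * r\<close>. The first radius is twice that of the covering balls, so that it contains both of two
  \<open>r\<close>-close points; the second is the one at which multiplicities are bounded.\<close>
definition bump :: "'x::metric_space \<Rightarrow> real \<Rightarrow> 'x \<Rightarrow> real" where
  "bump c r x = max 0 (min 1 (2 - dist x c / (2 * r)))"

lemma bump_lipschitz:
  assumes "r > 0" shows "(1 / (2 * r))-lipschitz_on UNIV (bump c r)"
proof (rule lipschitz_onI)
  fix x y :: 'a
  have 1: "\<bar>max 0 (min 1 (2 - a)) - max 0 (min 1 (2 - b))\<bar> \<le> \<bar>a - b\<bar>" for a b :: real by auto
  have "\<bar>dist x c / (2 * r) - dist y c / (2 * r)\<bar> = \<bar>dist x c - dist y c\<bar> / (2 * r)"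
    using assms by (simp add: diff_divide_distrib[symmetric] abs_divide)
  also have "\<dots> \<le> dist x y / (2 * r)"
    using abs_dist_diff_le[of x c y] assms by (intro divide_right_mono) (auto simp: dist_commute)
  finally show "dist (bump c r x) (bump c r y) \<le> 1 / (2 * r) * dist x y"
    using 1[of "dist x c / (2 * r)" "dist y c / (2 * r)"]
    by (simp add: bump_def dist_real_def)
qed (use assms in simp)

lemma bump_nonzero: "r > 0 \<Longrightarrow> bump c r x \<noteq> 0 \<longleftrightarrow> dist x c < 4 * r"
  by (auto simp: bump_def field_simps max_def min_def)

lemma bump_one: "r > 0 \<Longrightarrow> dist x c \<le> 2 * r \<Longrightarrow> bump c r x = 1"
  by (auto simp: bump_def field_simps max_def min_def)

lemma bump_family_of_cover:
  fixes c :: "nat \<Rightarrow> 'x::metric_space"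
  assumes r: "r > 0" and cov: "UNIV \<subseteq> (\<Union>p\<in>{1..k}. ball (c p) r)"
    and mul: "\<And>x. card {p \<in> {1..k}. x \<in> ball (c p) (4 * r)} \<le> C0"
  shows "bump_family {1..k} (\<lambda>p. bump (c p) r) C0 (1 / (2 * r)) r"
proof
  fix x y :: 'x
  show "card {p \<in> {1..k}. bump (c p) r x \<noteq> 0} \<le> C0"
    using mul[of x] r by (simp add: bump_nonzero dist_commute)
  assume d: "dist x y < r"
  obtain p where p: "p \<in> {1..k}" "dist (c p) x < r" using cov by force
  have "dist y (c p) \<le> 2 * r" using dist_triangle[of y "c p" x] d p by (simp add: dist_commute)
  with p r show "\<exists>p\<in>{1..k}. bump (c p) r x = 1 \<and> bump (c p) r y = 1"
    by (intro bexI[of _ p]) (auto intro!: bump_one simp: dist_commute)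
next
  fix p and x y :: 'x
  assume "bump (c p) r x \<noteq> 0" "bump (c p) r y \<noteq> 0"
  then show "dist x y < 8 * r" using r dist_triangle2[of x y "c p"] by (simp add: bump_nonzero)
qed (use r bump_lipschitz in \<open>auto simp: bump_def\<close>)

text \<open>The number of bumps grows at most polynomially: a ball of the cover at scale \<open>r' \<le> 4 * r\<close> contains
  at most \<open>C0\<close> centres of the cover at scale \<open>r\<close>, because its own centre is within \<open>4 * r\<close> of each of
  them. Passing from \<open>4 * r\<close> to \<open>r\<close> thus multiplies the number of balls by at most \<open>C0\<close>, which gives the
  exponent \<open>log 4 C0\<close>.\<close>
lemma bump_families_exist:
  assumes "bounded_local_complexity (UNIV :: 'x::metric_space set)"
  obtains C0 :: nat and D \<kappa> r0 :: real where "r0 > 0" "\<kappa> > 0"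
    "\<And>r. 0 < r \<Longrightarrow> r < r0 \<Longrightarrow> \<exists>I (\<phi> :: nat \<Rightarrow> 'x \<Rightarrow> real).
        bump_family I \<phi> C0 (1 / (2 * r)) r \<and> real (card I) \<le> \<kappa> * r powr (- D)"
proof -
  from assms obtain C :: nat and r0 where r0: "r0 > 0" and
    all: "\<forall>r. 0 < r \<and> r < r0 \<longrightarrow> (\<exists>k (c :: nat \<Rightarrow> 'x). c ` {1..k} \<subseteq> UNIV \<and>
      UNIV \<subseteq> (\<Union>p\<in>{1..k}. ball (c p) r) \<and>
      (\<forall>x\<in>UNIV. card {p \<in> {1..k}. x \<in> ball (c p) (4 * r)} \<le> C))"
    unfolding bounded_local_complexity_def by (elim exE conjE) (rule that)
  define C0 where "C0 = max C 1"
  define good where "good r kc \<longleftrightarrow> UNIV \<subseteq> (\<Union>p\<in>{1..fst kc}. ball (snd kc p) r) \<and>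
      (\<forall>x. card {p \<in> {1..fst kc}. x \<in> ball (snd kc p) (4 * r)} \<le> C0)"
    for r and kc :: "nat \<times> (nat \<Rightarrow> 'x)"
  have "\<forall>r\<in>{0<..<r0}. \<exists>kc. good r kc"
  proof
    fix r assume "r \<in> {0<..<r0}"
    then have r: "0 < r \<and> r < r0" by simp
    from all[rule_format, OF r] obtain k and c :: "nat \<Rightarrow> 'x"
      where kc: "UNIV \<subseteq> (\<Union>p\<in>{1..k}. ball (c p) r)"
        "\<And>x. card {p \<in> {1..k}. x \<in> ball (c p) (4 * r)} \<le> C"
      by (elim exE conjE) (rule that, assumption, erule bspec, simp)
    then have "good r (k, c)"
      unfolding good_def C0_def fst_conv snd_conv
      by (intro conjI allI order_trans[OF kc(2)]) simp_all
    then show "\<exists>kc. good r kc" ..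
  qed
  from bchoice[OF this] obtain F where "\<forall>r\<in>{0<..<r0}. good r (F r)" ..
  then have F: "good r (F r)" if "0 < r" "r < r0" for r using that by simp
  define k c where "k r = fst (F r)" and "c r = snd (F r)" for r
  have cov: "UNIV \<subseteq> (\<Union>p\<in>{1..k r}. ball (c r p) r)"
    and mul: "\<And>x. card {p \<in> {1..k r}. x \<in> ball (c r p) (4 * r)} \<le> C0"
    if "0 < r" "r < r0" for r
    using F[OF that] unfolding good_def k_def c_def by blast+
  have step: "k r \<le> C0 * k r'" if r: "0 < r" "r < r0" "0 < r'" "r' < r0" "r' \<le> 4 * r" for r r'
  proof -
    have "{1..k r} \<subseteq> (\<Union>q\<in>{1..k r'}. {p \<in> {1..k r}. c r' q \<in> ball (c r p) (4 * r)})"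
    proof
      fix p assume p: "p \<in> {1..k r}"
      obtain q where q: "q \<in> {1..k r'}" "dist (c r' q) (c r p) < r'"
        using cov[OF r(3,4)] by force
      with p r(5) show "p \<in> (\<Union>q\<in>{1..k r'}. {p \<in> {1..k r}. c r' q \<in> ball (c r p) (4 * r)})"
        by (force simp: dist_commute)
    qed
    from card_mono[OF _ this] have "k r \<le> card (\<Union>q\<in>{1..k r'}. {p \<in> {1..k r}. c r' q \<in> ball (c r p) (4 * r)})"
      by simp
    also have "\<dots> \<le> (\<Sum>q\<in>{1..k r'}. card {p \<in> {1..k r}. c r' q \<in> ball (c r p) (4 * r)})"
      by (rule card_UN_le) simp
    also have "\<dots> \<le> (\<Sum>q\<in>{1..k r'}. C0)" by (rule sum_mono) (use mul r in auto)
    finally show ?thesis by (simp add: mult.commute)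
  qed
  define K where "K = k (r0 / 2)"
  have C1: "C0 \<ge> 1" by (simp add: C0_def)
  \<comment> \<open>Scales in \<open>[r0 / 8, r0)\<close> are all compared with the single scale \<open>r0 / 2\<close>.\<close>
  have bound: "k r \<le> C0 ^ (l + 1) * K" if "r0 / 8 \<le> 4 ^ l * r" "0 < r" "r < r0" for l r
    using that
  proof (induction l arbitrary: r)
    case 0
    then show ?case using step[of r "r0 / 2"] by (auto simp: K_def)
  next
    case (Suc l)
    show ?case
    proof (cases "4 * r < r0")
      case True
      have "k r \<le> C0 * k (4 * r)" using step[of r "4 * r"] Suc True by simp
      also have "k (4 * r) \<le> C0 ^ (l + 1) * K" using Suc.IH[of "4 * r"] Suc.prems True
        by (simp add: mult.assoc)
      finally show ?thesis by (simp add: mult.assoc)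
    next
      case False
      then have "k r \<le> C0 * K" using step[of r "r0 / 2"] Suc by (auto simp: K_def)
      also have "\<dots> \<le> C0 ^ (Suc l + 1) * K"
        using C1 power_increasing[of 1 "Suc l + 1" C0] by (intro mult_right_mono) auto
      finally show ?thesis .
    qed
  qed
  define D where "D = log 4 (real C0)"
  have D: "D \<ge> 0" using C1 by (simp add: D_def)
  have C0D: "real C0 = 4 powr D" using C1 by (simp add: D_def)
  define \<kappa> where "\<kappa> = real C0 ^ 2 * r0 powr D * (real K + 1)"
  have main: "real (k r) \<le> \<kappa> * r powr (- D)" if r: "0 < r" "r < r0" for r
  proof -
    define l where "l = nat \<lceil>log 4 (r0 / r)\<rceil>"
    have lpos: "log 4 (r0 / r) > 0" using r by simp
    have l1: "log 4 (r0 / r) \<le> real l" and l2: "real l < log 4 (r0 / r) + 1"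
      using lpos unfolding l_def by linarith+
    have "r0 / r = 4 powr (log 4 (r0 / r))" using r r0 by simp
    also have "\<dots> \<le> 4 powr (real l)" using l1 by simp
    finally have "r0 \<le> 4 ^ l * r" using r by (simp add: powr_realpow field_simps)
    then have "k r \<le> C0 ^ (l + 1) * K" using r r0 by (intro bound) auto
    then have "real (k r) \<le> real (C0 ^ (l + 1) * K)" by linarith
    then have 1: "real (k r) \<le> real C0 ^ (l + 1) * real K" by simp
    have "real C0 ^ l = (4 powr real l) powr D"
      using C1 by (simp add: C0D powr_realpow[symmetric] powr_powr mult.commute)
    also have "\<dots> \<le> (4 powr (log 4 (r0 / r) + 1)) powr D"
      using l2 D by (intro powr_mono2) auto
    also have "4 powr (log 4 (r0 / r) + 1) = 4 * (r0 / r)" using r r0 by (simp add: powr_add)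
    also have "(4 * (r0 / r)) powr D = 4 powr D * (r0 / r) powr D" by (rule powr_mult)
    also have "\<dots> = real C0 * (r0 powr D * r powr (- D))"
      using r r0 C0D by (simp add: powr_divide powr_minus divide_simps)
    finally have 2: "real C0 ^ (l + 1) \<le> real C0 ^ 2 * r0 powr D * r powr (- D)"
      using C1 by (simp add: power2_eq_square mult.assoc)
    have "real (k r) \<le> real C0 ^ 2 * r0 powr D * r powr (- D) * (real K + 1)"
      using 1 2 by (smt (verit) mult_mono of_nat_0_le_iff zero_le_power)
    then show ?thesis by (simp add: \<kappa>_def algebra_simps)
  qed
  have "\<kappa> > 0" using C1 r0 by (auto simp: \<kappa>_def intro!: mult_pos_pos)
  show ?thesis
  proof (rule that[OF r0 \<open>\<kappa> > 0\<close>])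
    fix r assume r: "0 < r" "r < r0"
    show "\<exists>I (\<phi> :: nat \<Rightarrow> 'x \<Rightarrow> real).
        bump_family I \<phi> C0 (1 / (2 * r)) r \<and> real (card I) \<le> \<kappa> * r powr (- D)"
      using bump_family_of_cover[OF r(1) cov[OF r] mul[OF r]] main[OF r]
      by (intro exI[of _ "{1..k r}"] exI[of _ "\<lambda>p. bump (c r p) r"]) simp
  qed
qed

lemma correlation_eq:
  fixes M :: "'x::metric_space measure"
  assumes "compact (UNIV :: 'x set)" and M: "prob_space M" "sets M = sets borel"
  shows "correlation M s = measure (M \<Otimes>\<^sub>M M) {z. dist (fst z) (snd z) < s}"
proof -
  interpret prob_space M by fact
  note M(2)[measurable_cong]
  interpret MM: pair_prob_space M M ..
  let ?S = "{z :: 'x \<times> 'x. dist (fst z) (snd z) < s}"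
  have [measurable]: "?S \<in> sets (M \<Otimes>\<^sub>M M)"
    using compact_dist_less_measurable[OF assms(1), of s] sets_pair_measure_cong[OF M(2) M(2)] by simp
  have ind: "integrable (M \<Otimes>\<^sub>M M) (indicator ?S :: _ \<Rightarrow> real)"
    by (rule MM.integrable_const_bound[of _ 1]) (auto simp: indicator_def)
  have "(\<integral>z. (indicator ?S z :: real) \<partial>(M \<Otimes>\<^sub>M M)) = (\<integral>x. (\<integral>y. indicator ?S (x, y) \<partial>M) \<partial>M)"
    using MM.integral_fst'[OF ind] by simp
  also have "\<dots> = (\<integral>x. (\<integral>y. indicator (ball x s) y \<partial>M) \<partial>M)"
    by (intro Bochner_Integration.integral_cong refl) (auto simp: indicator_def)
  finally show ?thesis using sets_eq_imp_space_eq[OF M(2)] by (simp add: correlation_def)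
qed

context bump_family
begin

definition kernel :: "'x \<Rightarrow> 'x \<Rightarrow> real" where
  "kernel x y = (\<Sum>p\<in>I. \<phi> p x * \<phi> p y)"

lemma nonneg: "0 \<le> \<phi> p x" and le_one: "\<phi> p x \<le> 1"
  using unit[of p x] by auto

lemma bump_measurable [measurable]: "\<phi> p \<in> borel_measurable borel"
  by (intro borel_measurable_continuous_onI lipschitz_on_continuous_on[OF lip])

lemma kernel_nonneg: "0 \<le> kernel x y"
  unfolding kernel_def by (intro sum_nonneg mult_nonneg_nonneg nonneg)

lemma kernel_ge_one: "dist x y < r \<Longrightarrow> 1 \<le> kernel x y"
proof -
  assume "dist x y < r"
  then obtain p where p: "p \<in> I" "\<phi> p x = 1" "\<phi> p y = 1" using covers by blast
  have "\<phi> p x * \<phi> p y \<le> kernel x y" unfolding kernel_def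
    using p finite_index member_le_sum[of p I "\<lambda>p. \<phi> p x * \<phi> p y"] by (simp add: nonneg)
  with p show ?thesis by simp
qed

lemma kernel_le: "kernel x y \<le> real C0 * (indicator {z. dist (fst z) (snd z) < 8 * r} (x, y) :: real)"
proof (cases "dist x y < 8 * r")
  case True
  have "kernel x y = (\<Sum>p\<in>{p\<in>I. \<phi> p x \<noteq> 0}. \<phi> p x * \<phi> p y)"
    unfolding kernel_def using finite_index by (intro sum.mono_neutral_right) auto
  also have "\<dots> \<le> (\<Sum>p\<in>{p\<in>I. \<phi> p x \<noteq> 0}. 1)"
    by (intro sum_mono mult_le_one nonneg le_one)
  also have "\<dots> \<le> real C0" using multiplicity[of x] by simp
  finally show ?thesis using True by simp
next
  case False
  then have "kernel x y = 0" unfolding kernel_def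
    using support_small by (intro sum.neutral) fastforce
  then show ?thesis by simp
qed

lemma kernel_le_multiplicity: "kernel x y \<le> C0"
  using kernel_le[of x y] by (cases "dist x y < 8 * r") auto

text \<open>Cauchy-Schwarz, in which only the at most \<open>C0\<close> nonzero terms count.\<close>
lemma square_sum_le:
  assumes "\<And>p. p \<in> I \<Longrightarrow> 0 \<le> w p"
  shows "(\<Sum>p\<in>I. w p * \<phi> p x)\<^sup>2 \<le> C0 * (\<Sum>p\<in>I. (w p)\<^sup>2 * \<phi> p x)"
proof -
  let ?J = "{p\<in>I. \<phi> p x \<noteq> 0}"
  have "(\<Sum>p\<in>I. w p * \<phi> p x) = (\<Sum>p\<in>?J. 1 * (w p * \<phi> p x))"
    using finite_index by (simp, intro sum.mono_neutral_right) auto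
  then have "(\<Sum>p\<in>I. w p * \<phi> p x)\<^sup>2 \<le> (\<Sum>p\<in>?J. 1\<^sup>2) * (\<Sum>p\<in>?J. (w p * \<phi> p x)\<^sup>2)"
    using Cauchy_Schwarz_ineq_sum[of "\<lambda>_. 1" "\<lambda>p. w p * \<phi> p x" ?J] by simp
  also have "\<dots> \<le> C0 * (\<Sum>p\<in>I. (w p)\<^sup>2 * \<phi> p x)"
  proof (intro mult_mono)
    have "(\<Sum>p\<in>?J. (w p * \<phi> p x)\<^sup>2) \<le> (\<Sum>p\<in>I. (w p * \<phi> p x)\<^sup>2)"
      using finite_index by (intro sum_mono2) auto
    also have "\<dots> \<le> (\<Sum>p\<in>I. (w p)\<^sup>2 * \<phi> p x)"
      using nonneg le_one
      by (intro sum_mono) (simp add: power_mult_distrib power2_eq_square[of "\<phi> _ x"] mult_left_le mult_left_mono)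
    finally show "(\<Sum>p\<in>?J. (w p * \<phi> p x)\<^sup>2) \<le> (\<Sum>p\<in>I. (w p)\<^sup>2 * \<phi> p x)" .
  qed (use multiplicity[of x] in \<open>auto intro: sum_nonneg\<close>)
  finally show ?thesis .
qed

lemma sum_bump_le: "(\<Sum>p\<in>I. \<phi> p x) \<le> C0"
proof -
  have "(\<Sum>p\<in>I. \<phi> p x) = (\<Sum>p\<in>{p\<in>I. \<phi> p x \<noteq> 0}. \<phi> p x)"
    using finite_index by (intro sum.mono_neutral_right) auto
  also have "\<dots> \<le> (\<Sum>p\<in>{p\<in>I. \<phi> p x \<noteq> 0}. 1)" by (intro sum_mono le_one)
  also have "\<dots> \<le> real C0" using multiplicity[of x] by simp
  finally show ?thesis .
qed

text \<open>Integrate the two-sided comparison of the kernel with indicators against \<open>M \<Otimes>\<^sub>M M\<close>.\<close>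
lemma correlation_bounds:
  fixes M :: "'x measure"
  assumes "compact (UNIV :: 'x set)" and M: "prob_space M" "sets M = sets borel"
  shows "correlation M r \<le> (\<Sum>p\<in>I. (\<integral>x. \<phi> p x \<partial>M)\<^sup>2)"
    and "(\<Sum>p\<in>I. (\<integral>x. \<phi> p x \<partial>M)\<^sup>2) \<le> C0 * correlation M (8 * r)"
proof -
  interpret prob_space M by fact
  note M(2)[measurable_cong]
  interpret MM: pair_prob_space M M ..
  let ?S = "\<lambda>s. {z :: 'x \<times> 'x. dist (fst z) (snd z) < s}"
  have [measurable]: "?S s \<in> sets (M \<Otimes>\<^sub>M M)" for s
    using compact_dist_less_measurable[OF assms(1), of s] sets_pair_measure_cong[OF M(2) M(2)] by simp
  have corr: "correlation M s = (\<integral>z. indicator (?S s) z \<partial>(M \<Otimes>\<^sub>M M))" for s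
    using correlation_eq[OF assms, of s] by simp
  have ind: "integrable (M \<Otimes>\<^sub>M M) (indicator (?S s) :: _ \<Rightarrow> real)" for s
    by (rule MM.integrable_const_bound[of _ 1]) (auto simp: indicator_def)
  have meas: "(\<lambda>z. kernel (fst z) (snd z)) \<in> borel_measurable (M \<Otimes>\<^sub>M M)"
    unfolding kernel_def by measurable
  have int: "integrable (M \<Otimes>\<^sub>M M) (\<lambda>z. kernel (fst z) (snd z))"
    by (rule MM.integrable_const_bound[of _ C0])
       (use meas in \<open>auto simp: kernel_nonneg kernel_le_multiplicity\<close>)
  have intp: "integrable M (\<phi> p)" for p
    by (rule integrable_const_bound[of _ 1]) (auto simp: nonneg le_one)
  have "(\<integral>z. kernel (fst z) (snd z) \<partial>(M \<Otimes>\<^sub>M M)) = (\<integral>x. (\<integral>y. kernel x y \<partial>M) \<partial>M)"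
    using MM.integral_fst'[OF int] by simp
  also have "\<dots> = (\<integral>x. (\<Sum>p\<in>I. \<phi> p x * (\<integral>y. \<phi> p y \<partial>M)) \<partial>M)"
    unfolding kernel_def using intp by (simp add: Bochner_Integration.integral_sum)
  also have "\<dots> = (\<Sum>p\<in>I. (\<integral>x. \<phi> p x \<partial>M)\<^sup>2)"
    using intp by (simp add: Bochner_Integration.integral_sum power2_eq_square)
  finally have k: "(\<integral>z. kernel (fst z) (snd z) \<partial>(M \<Otimes>\<^sub>M M)) = (\<Sum>p\<in>I. (\<integral>x. \<phi> p x \<partial>M)\<^sup>2)" .
  show "correlation M r \<le> (\<Sum>p\<in>I. (\<integral>x. \<phi> p x \<partial>M)\<^sup>2)"
    unfolding corr k[symmetric]
    by (intro integral_mono ind int) (auto simp: indicator_def kernel_nonneg kernel_ge_one)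
  show "(\<Sum>p\<in>I. (\<integral>x. \<phi> p x \<partial>M)\<^sup>2) \<le> C0 * correlation M (8 * r)"
    unfolding corr k[symmetric] integral_mult_right_zero[symmetric]
    by (intro integral_mono integrable_mult_right ind int)
       (use kernel_le in \<open>auto simp: case_prod_beta\<close>)
qed

end


section \<open>Integration over fibers and equivariance\<close>

locale fibered_rds = random_dynamical_system P \<nu> \<theta> T
  for P :: "'w::metric_space measure" and \<nu> :: "('w \<times> 'x::metric_space) measure" and \<theta> T +
  fixes \<mu> :: "'w \<Rightarrow> 'x measure"
  assumes compact_fiber: "compact (UNIV :: 'x set)"
    and disint: "disintegration P \<nu> \<mu>"
    and continuous_base: "continuous_on UNIV \<theta>"
begin

abbreviation BB :: "('w \<times> 'x) measure" where "BB \<equiv> borel \<Otimes>\<^sub>M borel"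
abbreviation BBB :: "('w \<times> 'x \<times> 'x) measure" where "BBB \<equiv> borel \<Otimes>\<^sub>M (borel \<Otimes>\<^sub>M borel)"

declare sets_base [measurable_cong] sets_total [measurable_cong]

lemma space_base [simp]: "space P = UNIV"
  using sets_eq_imp_space_eq[OF sets_base] by simp

lemma kernel_prob: "\<mu> \<in> borel \<rightarrow>\<^sub>M prob_algebra borel"
  using disint measurable_cong_sets[OF sets_base refl] unfolding disintegration_def by blast

lemma kernel_subprob [measurable]: "\<mu> \<in> borel \<rightarrow>\<^sub>M subprob_algebra borel"
  by (rule measurable_prob_algebraD[OF kernel_prob])

lemma prob_fiber: "prob_space (\<mu> \<omega>)" and sets_fiber [measurable_cong]: "sets (\<mu> \<omega>) = sets borel"
  using measurable_space[OF kernel_prob, of \<omega>] by (auto simp: space_prob_algebra)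

lemma space_fiber [simp]: "space (\<mu> \<omega>) = UNIV"
  using sets_eq_imp_space_eq[OF sets_fiber] by simp

lemma integrable_fiber:
  fixes f :: "'x \<Rightarrow> real"
  assumes "f \<in> borel_measurable borel" "\<And>x. \<bar>f x\<bar> \<le> B"
  shows "integrable (\<mu> \<omega>) f"
proof -
  interpret prob_space "\<mu> \<omega>" by (rule prob_fiber)
  show ?thesis by (rule integrable_const_bound[of _ B]) (use assms in auto)
qed

lemma integrable_base:
  fixes f :: "'w \<Rightarrow> real"
  assumes "f \<in> borel_measurable borel" "\<And>x. \<bar>f x\<bar> \<le> B"
  shows "integrable P f"
  by (rule base.integrable_const_bound[of _ B]) (use assms in auto)

text \<open>The conditional expectation of a function on \<open>\<Omega> \<times> X\<close> given the base point.\<close>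
definition fiber_int :: "('w \<times> 'x \<Rightarrow> real) \<Rightarrow> 'w \<Rightarrow> real" where
  "fiber_int f \<omega> = (\<integral>x. f (\<omega>, x) \<partial>\<mu> \<omega>)"

definition fiber_kernel :: "'w \<Rightarrow> ('w \<times> 'x) measure" where
  "fiber_kernel \<omega> = distr (\<mu> \<omega>) BB (Pair \<omega>)"

lemma fiber_kernel_measurable [measurable]: "fiber_kernel \<in> borel \<rightarrow>\<^sub>M subprob_algebra BB"
  unfolding fiber_kernel_def
  by (rule measurable_distr2[OF _ kernel_subprob]) simp

lemma prob_space_fiber_kernel: "prob_space (fiber_kernel \<omega>)"
  unfolding fiber_kernel_def by (rule prob_space.prob_space_distr[OF prob_fiber]) simp

lemma fiber_kernel_integral:
  fixes f :: "'w \<times> 'x \<Rightarrow> real"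
  assumes "f \<in> borel_measurable BB"
  shows "(\<integral>z. f z \<partial>fiber_kernel \<omega>) = fiber_int f \<omega>"
  unfolding fiber_kernel_def fiber_int_def by (rule integral_distr) (use assms in auto)

lemma fiber_int_measurable [measurable]:
  assumes [measurable]: "f \<in> borel_measurable BB"
  shows "fiber_int f \<in> borel_measurable borel"
proof -
  have "(\<lambda>\<omega>. \<integral>z. f z \<partial>fiber_kernel \<omega>) \<in> borel_measurable borel"
    by (rule measurable_compose[OF fiber_kernel_measurable integral_measurable_subprob_algebra]) fact
  then show ?thesis by (simp add: fiber_kernel_integral[OF assms])
qed

lemma fiber_int_bound:
  assumes "f \<in> borel_measurable BB" "\<And>z. \<bar>f z\<bar> \<le> B"
  shows "\<bar>fiber_int f \<omega>\<bar> \<le> B"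
proof -
  interpret prob_space "\<mu> \<omega>" by (rule prob_fiber)
  have i: "integrable (\<mu> \<omega>) (\<lambda>x. f (\<omega>, x))"
    by (rule integrable_fiber[of _ B]) (use assms in \<open>auto intro: measurable_compose[OF _ assms(1)]\<close>)
  have "\<bar>fiber_int f \<omega>\<bar> \<le> (\<integral>x. \<bar>f (\<omega>, x)\<bar> \<partial>\<mu> \<omega>)" unfolding fiber_int_def
    by (rule integral_abs_bound)
  also have "\<dots> \<le> (\<integral>x. B \<partial>\<mu> \<omega>)" by (rule integral_mono) (use i assms in auto)
  finally show ?thesis using prob_space by simp
qed

lemma fiber_int_unit:
  assumes "f \<in> borel_measurable BB" "\<And>z. f z \<in> {0..1}"
  shows "fiber_int f \<omega> \<in> {0..1}"
proof -
  have "0 \<le> fiber_int f \<omega>" unfolding fiber_int_def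
    by (rule Bochner_Integration.integral_nonneg) (use assms in auto)
  moreover have "\<bar>fiber_int f \<omega>\<bar> \<le> 1" by (rule fiber_int_bound) (use assms in auto)
  ultimately show ?thesis by auto
qed

text \<open>Writing \<open>\<nu>\<close> as a bind turns the disintegration formula for nonnegative functions into one for
  bounded real functions.\<close>
lemma total_eq_bind: "\<nu> = P \<bind> fiber_kernel"
proof (rule measure_eqI)
  have m: "fiber_kernel \<in> P \<rightarrow>\<^sub>M subprob_algebra BB"
    using fiber_kernel_measurable measurable_cong_sets[OF sets_base refl] by blast
  show "sets \<nu> = sets (P \<bind> fiber_kernel)"
    using sets_bind[of P fiber_kernel BB] by (simp add: sets_total fiber_kernel_def)
  fix A assume "A \<in> sets \<nu>"
  then have A[measurable]: "A \<in> sets BB" by (simp add: sets_total)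
  have "emeasure \<nu> A = (\<integral>\<^sup>+ z. indicator A z \<partial>\<nu>)" using A sets_total by simp
  also have "\<dots> = (\<integral>\<^sup>+ \<omega>. (\<integral>\<^sup>+ x. indicator A (\<omega>, x) \<partial>\<mu> \<omega>) \<partial>P)"
    by (rule disint[unfolded disintegration_def, THEN conjunct2, rule_format]) simp
  also have "\<dots> = (\<integral>\<^sup>+ \<omega>. (\<integral>\<^sup>+ z. indicator A z \<partial>fiber_kernel \<omega>) \<partial>P)"
  proof (intro nn_integral_cong)
    fix \<omega>
    show "(\<integral>\<^sup>+ x. indicator A (\<omega>, x) \<partial>\<mu> \<omega>) = (\<integral>\<^sup>+ z. indicator A z \<partial>fiber_kernel \<omega>)"
      unfolding fiber_kernel_def by (rule nn_integral_distr[symmetric]) auto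
  qed
  also have "\<dots> = emeasure (P \<bind> fiber_kernel) A"
    using emeasure_bind[OF _ m A] by (simp add: fiber_kernel_def)
  finally show "emeasure \<nu> A = emeasure (P \<bind> fiber_kernel) A" .
qed

lemma integral_total:
  fixes f :: "'w \<times> 'x \<Rightarrow> real"
  assumes f: "f \<in> borel_measurable BB" "\<And>z. \<bar>f z\<bar> \<le> B"
  shows "(\<integral>z. f z \<partial>\<nu>) = (\<integral>\<omega>. fiber_int f \<omega> \<partial>P)"
proof -
  have m: "fiber_kernel \<in> P \<rightarrow>\<^sub>M subprob_algebra BB"
    using fiber_kernel_measurable measurable_cong_sets[OF sets_base refl] by blast
  have "(\<integral>z. f z \<partial>\<nu>) = (\<integral>\<omega>. (\<integral>z. f z \<partial>fiber_kernel \<omega>) \<partial>P)"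
    unfolding total_eq_bind
    by (rule integral_bind[where K = BB and B = B and B' = 1])
       (use f m in \<open>auto intro!: subprob_space.subprob_emeasure_le_1 base.finite_measure_axioms
          prob_space_imp_subprob_space prob_space_fiber_kernel\<close>)
  then show ?thesis by (simp add: fiber_kernel_integral[OF f(1)])
qed

definition pair_kernel :: "'w \<Rightarrow> ('w \<times> 'x \<times> 'x) measure" where
  "pair_kernel \<omega> = distr (\<mu> \<omega> \<Otimes>\<^sub>M \<mu> \<omega>) BBB (Pair \<omega>)"

text \<open>The law of \<open>(\<omega>, x, y)\<close>, where \<open>x\<close> and \<open>y\<close> are independent with law \<open>\<mu> \<omega>\<close>
  in the same fiber.\<close>
definition pairs :: "('w \<times> 'x \<times> 'x) measure" where
  "pairs = P \<bind> pair_kernel"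

lemma pair_kernel_measurable: "pair_kernel \<in> P \<rightarrow>\<^sub>M subprob_algebra BBB"
proof -
  have "pair_kernel \<in> borel \<rightarrow>\<^sub>M subprob_algebra BBB"
    unfolding pair_kernel_def
    by (rule measurable_distr2[OF _ measurable_pair_measure[OF kernel_subprob kernel_subprob]]) simp
  then show ?thesis using measurable_cong_sets[OF sets_base refl] by blast
qed

lemma sets_pairs [measurable_cong]: "sets pairs = sets BBB"
  unfolding pairs_def by (rule sets_bind) (auto simp: pair_kernel_def)

lemma space_pairs [simp]: "space pairs = UNIV"
  using sets_eq_imp_space_eq[OF sets_pairs] by (simp add: space_pair_measure)

lemma pair_prob_fiber: "pair_prob_space (\<mu> \<omega>) (\<mu> \<omega>)"
  using prob_fiber[of \<omega>]
  by (simp add: pair_prob_space_def pair_sigma_finite_def prob_space_imp_sigma_finite)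

lemma sets_pair_fiber [measurable_cong]: "sets (\<mu> \<omega> \<Otimes>\<^sub>M \<mu> \<omega>) = sets (borel \<Otimes>\<^sub>M borel)"
  by (intro sets_pair_measure_cong sets_fiber)

lemma prob_space_pair_kernel: "prob_space (pair_kernel \<omega>)"
proof -
  interpret pair_prob_space "\<mu> \<omega>" "\<mu> \<omega>" by (rule pair_prob_fiber)
  show ?thesis unfolding pair_kernel_def by (rule P.prob_space_distr) simp
qed

sublocale pairs: prob_space pairs
  unfolding pairs_def
  by (rule base.prob_space_bind[OF _ pair_kernel_measurable]) (simp add: prob_space_pair_kernel)

lemma AE_pairs:
  assumes "Measurable.pred BBB Q" "AE z in pairs. Q z"
  shows "AE \<omega> in P. AE z in \<mu> \<omega> \<Otimes>\<^sub>M \<mu> \<omega>. Q (\<omega>, z)"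
proof -
  have "AE \<omega> in P. AE z in pair_kernel \<omega>. Q z"
    using assms(2) AE_bind[OF pair_kernel_measurable assms(1)] unfolding pairs_def by blast
  moreover have "(AE z in pair_kernel \<omega>. Q z) \<longleftrightarrow> (AE z in \<mu> \<omega> \<Otimes>\<^sub>M \<mu> \<omega>. Q (\<omega>, z))" for \<omega>
    unfolding pair_kernel_def by (rule AE_distr_iff) (use assms(1) in \<open>auto simp: pred_def\<close>)
  ultimately show ?thesis by simp
qed

lemma integrable_pairs:
  fixes f :: "'w \<times> 'x \<times> 'x \<Rightarrow> real"
  assumes "f \<in> borel_measurable BBB" "\<And>z. \<bar>f z\<bar> \<le> B"
  shows "integrable pairs f"
  by (rule pairs.integrable_const_bound[of _ B]) (use assms in auto)

text \<open>Independence of the two points given the fiber.\<close>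
lemma integral_pairs_mult:
  fixes f g :: "'w \<times> 'x \<Rightarrow> real"
  assumes f[measurable]: "f \<in> borel_measurable BB" and fB: "\<And>z. \<bar>f z\<bar> \<le> B"
    and g[measurable]: "g \<in> borel_measurable BB" and gB: "\<And>z. \<bar>g z\<bar> \<le> B"
  shows "(\<integral>z. f (fst z, fst (snd z)) * g (fst z, snd (snd z)) \<partial>pairs)
      = (\<integral>\<omega>. fiber_int f \<omega> * fiber_int g \<omega> \<partial>P)"
proof -
  let ?h = "\<lambda>z. f (fst z, fst (snd z)) * g (fst z, snd (snd z))"
  have bnd: "\<bar>?h z\<bar> \<le> B * B" for z
    unfolding abs_mult using fB gB by (intro mult_mono) (auto intro: order_trans[OF abs_ge_zero])
  have h[measurable]: "?h \<in> borel_measurable BBB" by measurable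
  have "(\<integral>z. ?h z \<partial>pairs) = (\<integral>\<omega>. (\<integral>z. ?h z \<partial>pair_kernel \<omega>) \<partial>P)"
    unfolding pairs_def
    by (rule integral_bind[where K = BBB and B = "B * B" and B' = 1])
       (use bnd h pair_kernel_measurable in \<open>auto intro!: subprob_space.subprob_emeasure_le_1
          base.finite_measure_axioms prob_space_imp_subprob_space prob_space_pair_kernel\<close>)
  also have "\<dots> = (\<integral>\<omega>. fiber_int f \<omega> * fiber_int g \<omega> \<partial>P)"
  proof (intro Bochner_Integration.integral_cong refl)
    fix \<omega>
    interpret pair_prob_space "\<mu> \<omega>" "\<mu> \<omega>" by (rule pair_prob_fiber)
    have "(\<integral>z. ?h z \<partial>pair_kernel \<omega>) = (\<integral>z. ?h (\<omega>, z) \<partial>(\<mu> \<omega> \<Otimes>\<^sub>M \<mu> \<omega>))"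
      unfolding pair_kernel_def by (rule integral_distr) auto
    also have "\<dots> = (\<integral>x. (\<integral>y. ?h (\<omega>, x, y) \<partial>\<mu> \<omega>) \<partial>\<mu> \<omega>)"
      by (rule integral_fst'[symmetric], rule P.integrable_const_bound[of _ "B * B"])
         (use bnd[of "(\<omega>, _)"] in auto)
    also have "\<dots> = fiber_int f \<omega> * fiber_int g \<omega>" by (simp add: fiber_int_def)
    finally show "(\<integral>z. ?h z \<partial>pair_kernel \<omega>) = fiber_int f \<omega> * fiber_int g \<omega>" .
  qed
  finally show ?thesis .
qed

definition orbit :: "nat \<Rightarrow> 'w \<times> 'x \<Rightarrow> 'w \<times> 'x" where
  "orbit n z = ((\<theta> ^^ n) (fst z), fiber_iter \<theta> T n (fst z) (snd z))"

lemma orbit_Suc: "orbit (Suc n) = skew_product \<theta> T \<circ> orbit n"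
  by (auto simp: orbit_def skew_product_def fun_eq_iff)

lemma orbit_0: "orbit 0 = id" by (auto simp: orbit_def fun_eq_iff)

lemma orbit_measurable [measurable]: "orbit n \<in> BB \<rightarrow>\<^sub>M BB"
proof (induction n)
  case (Suc n)
  then show ?case unfolding orbit_Suc by (rule measurable_comp[OF _ skew_measurable])
qed (simp add: orbit_0)

lemma orbit_invariant: "distr \<nu> \<nu> (orbit n) = \<nu>"
proof (induction n)
  case 0
  then show ?case by (simp add: orbit_0 id_def distr_id)
next
  case (Suc n)
  have m: "orbit n \<in> \<nu> \<rightarrow>\<^sub>M \<nu>" "skew_product \<theta> T \<in> \<nu> \<rightarrow>\<^sub>M \<nu>"
    using orbit_measurable skew_measurable measurable_cong_sets[OF sets_total sets_total] by blast+
  show ?case unfolding orbit_Suc distr_distr[OF m(2,1), symmetric] Suc by (rule skew_invariant)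
qed

lemma base_iter_measurable [measurable]: "\<theta> ^^ n \<in> borel \<rightarrow>\<^sub>M borel"
proof (induction n)
  case (Suc n)
  then show ?case using measurable_comp[OF Suc base_measurable] by (simp only: funpow.simps)
qed simp

lemma base_iter_invariant: "distr P P (\<theta> ^^ n) = P"
proof (induction n)
  case 0
  then show ?case by (simp add: id_def distr_id)
next
  case (Suc n)
  have m: "\<theta> ^^ n \<in> P \<rightarrow>\<^sub>M P" "\<theta> \<in> P \<rightarrow>\<^sub>M P"
    using base_iter_measurable base_measurable measurable_cong_sets[OF sets_base sets_base] by blast+
  show ?case unfolding funpow.simps distr_distr[OF m(2,1), symmetric] Suc by (rule base_invariant)
qed

lemma integral_base_iter:
  fixes f :: "'w \<Rightarrow> real"
  assumes [measurable]: "f \<in> borel_measurable borel"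
  shows "(\<integral>\<omega>. f ((\<theta> ^^ n) \<omega>) \<partial>P) = (\<integral>\<omega>. f \<omega> \<partial>P)"
proof -
  have "\<theta> ^^ n \<in> P \<rightarrow>\<^sub>M P"
    using base_iter_measurable measurable_cong_sets[OF sets_base sets_base] by blast
  then have "(\<integral>\<omega>. f \<omega> \<partial>distr P P (\<theta> ^^ n)) = (\<integral>\<omega>. f ((\<theta> ^^ n) \<omega>) \<partial>P)"
    by (rule integral_distr) measurable
  then show ?thesis by (simp add: base_iter_invariant)
qed

lemma integral_orbit:
  fixes f :: "'w \<times> 'x \<Rightarrow> real"
  assumes [measurable]: "f \<in> borel_measurable BB"
  shows "(\<integral>z. f (orbit n z) \<partial>\<nu>) = (\<integral>z. f z \<partial>\<nu>)"
proof -
  have "(\<integral>z. f z \<partial>distr \<nu> \<nu> (orbit n)) = (\<integral>z. f (orbit n z) \<partial>\<nu>)"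
    by (rule integral_distr) auto
  then show ?thesis by (simp add: orbit_invariant)
qed

lemma fiber_iter_add:
  "fiber_iter \<theta> T (i + k) \<omega> x = fiber_iter \<theta> T k ((\<theta> ^^ i) \<omega>) (fiber_iter \<theta> T i \<omega> x)"
proof (induction k)
  case (Suc k)
  have "(\<theta> ^^ (i + k)) \<omega> = (\<theta> ^^ k) ((\<theta> ^^ i) \<omega>)" by (metis add.commute comp_apply funpow_add)
  with Suc show ?case by simp
qed simp

text \<open>A continuous bijection of a compact space is a homeomorphism.\<close>
lemma base_iter_image_borel:
  assumes A: "A \<in> sets borel" shows "(\<theta> ^^ n) ` A \<in> sets borel"
proof -
  have bij: "bij (\<theta> ^^ n)" by (rule bij_betw_funpow[OF base_bij])
  have "continuous_on UNIV (\<theta> ^^ n)"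
    by (induction n) (auto intro!: continuous_on_compose2[OF continuous_base] simp: id_def)
  then have "continuous_on (range (\<theta> ^^ n)) (inv (\<theta> ^^ n))"
    by (rule continuous_on_inv[OF _ compact_base]) (simp add: bij bij_is_inj)
  then have "inv (\<theta> ^^ n) \<in> borel_measurable borel"
    using bij_is_surj[OF bij] by (intro borel_measurable_continuous_onI) simp
  from measurable_sets[OF this A] show ?thesis
    using bij_vimage_eq_inv_image[OF bij_imp_bij_inv[OF bij], of A] bij by (simp add: inv_inv_eq)
qed

text \<open>Equivariance \<open>(T \<omega>)\<^sub>* \<mu> \<omega> = \<mu> (\<theta> \<omega>)\<close> for iterates, tested against a single function. Both sides
  have the same integral over every \<open>(\<theta> ^^ n)\<close>-preimage by invariance of \<open>\<nu>\<close>, and every Borel set is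
  such a preimage since \<open>\<theta>\<close> is a homeomorphism.\<close>
lemma fiber_int_orbit:
  fixes f :: "'w \<times> 'x \<Rightarrow> real"
  assumes f[measurable]: "f \<in> borel_measurable BB" and fB: "\<And>z. \<bar>f z\<bar> \<le> B"
  shows "AE \<omega> in P. fiber_int (\<lambda>z. f (orbit n z)) \<omega> = fiber_int f ((\<theta> ^^ n) \<omega>)"
proof (rule density_unique_real)
  have B0: "0 \<le> B" using fB[of undefined] by linarith
  have m: "(\<lambda>z. f (orbit n z)) \<in> borel_measurable BB" by measurable
  show "integrable P (fiber_int (\<lambda>z. f (orbit n z)))"
    by (rule integrable_base[of _ B]) (auto intro!: fiber_int_bound fB)
  show "integrable P (\<lambda>\<omega>. fiber_int f ((\<theta> ^^ n) \<omega>))"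
    by (rule integrable_base[of _ B]) (auto intro!: fiber_int_bound fB)
  fix A assume "A \<in> sets P"
  then have A[measurable]: "A \<in> sets borel" by (simp add: sets_base)
  have [measurable]: "(\<theta> ^^ n) ` A \<in> sets borel" by (rule base_iter_image_borel[OF A])
  have inj: "inj (\<theta> ^^ n)" by (rule bij_is_inj[OF bij_betw_funpow[OF base_bij]])
  have ind: "indicator A \<omega> = (indicator ((\<theta> ^^ n) ` A) ((\<theta> ^^ n) \<omega>) :: real)" for \<omega>
    using inj by (auto simp: indicator_def inj_image_mem_iff)
  let ?g = "\<lambda>z. indicator ((\<theta> ^^ n) ` A) (fst z) * f z"
  have g[measurable]: "?g \<in> borel_measurable BB" by measurable
  have gB: "\<bar>?g z\<bar> \<le> B" for z using fB[of z] B0 by (auto simp: indicator_def)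
  have "(\<integral>\<omega>\<in>A. fiber_int (\<lambda>z. f (orbit n z)) \<omega> \<partial>P) = (\<integral>\<omega>. fiber_int (\<lambda>z. ?g (orbit n z)) \<omega> \<partial>P)"
    unfolding set_lebesgue_integral_def by (simp add: ind fiber_int_def orbit_def)
  also have "\<dots> = (\<integral>z. ?g (orbit n z) \<partial>\<nu>)"
    by (rule integral_total[symmetric, of _ B]) (use gB in auto)
  also have "\<dots> = (\<integral>z. ?g z \<partial>\<nu>)" by (rule integral_orbit[OF g])
  also have "\<dots> = (\<integral>\<omega>. fiber_int ?g \<omega> \<partial>P)" by (rule integral_total[OF g gB])
  also have "\<dots> = (\<integral>\<omega>. fiber_int ?g ((\<theta> ^^ n) \<omega>) \<partial>P)"
    by (rule integral_base_iter[symmetric]) simp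
  also have "\<dots> = (\<integral>\<omega>\<in>A. fiber_int f ((\<theta> ^^ n) \<omega>) \<partial>P)"
    unfolding set_lebesgue_integral_def by (simp add: ind fiber_int_def)
  finally show "(\<integral>\<omega>\<in>A. fiber_int (\<lambda>z. f (orbit n z)) \<omega> \<partial>P) =
      (\<integral>\<omega>\<in>A. fiber_int f ((\<theta> ^^ n) \<omega>) \<partial>P)" .
qed

definition mean :: "('x \<Rightarrow> real) \<Rightarrow> 'w \<Rightarrow> real" where
  "mean f \<omega> = (\<integral>x. f x \<partial>\<mu> \<omega>)"

lemma mean_fiber_int: "mean f = fiber_int (\<lambda>z. f (snd z))"
  by (simp add: mean_def fiber_int_def fun_eq_iff)

lemma mean_measurable [measurable]:
  assumes [measurable]: "f \<in> borel_measurable borel"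
  shows "mean f \<in> borel_measurable borel"
  unfolding mean_fiber_int by (rule fiber_int_measurable) measurable

lemma mean_unit:
  assumes [measurable]: "f \<in> borel_measurable borel" and f: "\<And>x. f x \<in> {0..1}"
  shows "mean f \<omega> \<in> {0..1}"
  unfolding mean_fiber_int by (rule fiber_int_unit) (measurable, rule f)

text \<open>The integral against the marginal of \<open>\<nu>\<close> on \<open>X\<close>, expressed through the fiber means so that
  mixing of the base can produce it; see \<open>annealed_eq\<close>.\<close>
definition annealed :: "('x \<Rightarrow> real) \<Rightarrow> real" where
  "annealed f = (\<integral>\<omega>. mean f \<omega> \<partial>P)"

lemma annealed_eq:
  fixes f :: "'x \<Rightarrow> real"
  assumes [measurable]: "f \<in> borel_measurable borel" and B: "\<And>x. \<bar>f x\<bar> \<le> B"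
  shows "(\<integral>x. f x \<partial>fiber_marginal \<nu>) = annealed f"
proof -
  have "(\<integral>x. f x \<partial>fiber_marginal \<nu>) = (\<integral>z. f (snd z) \<partial>\<nu>)"
    unfolding fiber_marginal_def by (rule integral_distr) measurable
  also have "\<dots> = annealed f" unfolding annealed_def mean_fiber_int
    by (rule integral_total[of _ B]) (measurable, rule B)
  finally show ?thesis .
qed

lemma prob_fiber_marginal: "prob_space (fiber_marginal \<nu>)"
  unfolding fiber_marginal_def by (rule total.prob_space_distr) measurable

text \<open>The correlation inside the fiber over \<open>\<omega>\<close> of \<open>f\<close> at time \<open>i\<close> and \<open>g\<close> at time \<open>j\<close>.\<close>
definition joint :: "('x \<Rightarrow> real) \<Rightarrow> ('x \<Rightarrow> real) \<Rightarrow> nat \<Rightarrow> nat \<Rightarrow> 'w \<Rightarrow> real" where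
  "joint f g i j = fiber_int (\<lambda>z. f (snd (orbit i z)) * g (snd (orbit j z)))"

lemma joint_commute: "joint f g i j = joint g f j i"
  by (simp add: joint_def mult.commute)

lemma joint_measurable [measurable]:
  assumes [measurable]: "f \<in> borel_measurable borel" "g \<in> borel_measurable borel"
  shows "joint f g i j \<in> borel_measurable borel"
  unfolding joint_def by (rule fiber_int_measurable) measurable

lemma joint_unit:
  assumes [measurable]: "f \<in> borel_measurable borel" "g \<in> borel_measurable borel"
    and "\<And>x. f x \<in> {0..1}" "\<And>x. g x \<in> {0..1}"
  shows "joint f g i j \<omega> \<in> {0..1}"
  unfolding joint_def using assms(3,4)
  by (intro fiber_int_unit) (measurable, auto simp: mult_le_one)

lemma AE_mean_orbit:
  assumes [measurable]: "f \<in> borel_measurable borel" and B: "\<And>x. f x \<in> {0..1}"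
  shows "AE \<omega> in P. fiber_int (\<lambda>z. f (snd (orbit i z))) \<omega> = mean f ((\<theta> ^^ i) \<omega>)"
  unfolding mean_fiber_int
  using fiber_int_orbit[of "\<lambda>z. f (snd z)" 1 i] B by auto

lemma AE_joint_same:
  assumes [measurable]: "f \<in> borel_measurable borel" "g \<in> borel_measurable borel"
    and "\<And>x. f x \<in> {0..1}" "\<And>x. g x \<in> {0..1}"
  shows "AE \<omega> in P. joint f g i i \<omega> = mean (\<lambda>x. f x * g x) ((\<theta> ^^ i) \<omega>)"
  unfolding joint_def
  using AE_mean_orbit[of "\<lambda>x. f x * g x" i] assms(3,4) by (auto simp: mult_le_one)

lemma AE_joint_later:
  assumes [measurable]: "f \<in> borel_measurable borel" "g \<in> borel_measurable borel"
    and fg: "\<And>x. f x \<in> {0..1}" "\<And>x. g x \<in> {0..1}"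
  shows "AE \<omega> in P. joint f g i (i + k) \<omega> =
    (\<integral>x. f x * g (fiber_iter \<theta> T k ((\<theta> ^^ i) \<omega>) x) \<partial>\<mu> ((\<theta> ^^ i) \<omega>))"
proof -
  let ?F = "\<lambda>z. f (snd z) * g (snd (orbit k z))"
  have "\<bar>?F z\<bar> \<le> 1" for z using fg(1)[of "snd z"] fg(2)[of "snd (orbit k z)"]
    by (simp add: mult_le_one abs_mult)
  then have "AE \<omega> in P. fiber_int (\<lambda>z. ?F (orbit i z)) \<omega> = fiber_int ?F ((\<theta> ^^ i) \<omega>)"
    by (intro fiber_int_orbit) measurable
  moreover have "joint f g i (i + k) = fiber_int (\<lambda>z. ?F (orbit i z))"
    by (simp add: joint_def orbit_def fiber_iter_add)
  ultimately show ?thesis by (simp add: fiber_int_def orbit_def)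
qed

end


section \<open>Expected numbers of close pairs of times\<close>

lemma unit_prod_close:
  fixes a b x y :: real
  assumes "a \<in> {0..1}" "b \<in> {0..1}" "x \<in> {0..1}" "y \<in> {0..1}" "\<bar>a - x\<bar> \<le> d" "\<bar>b - y\<bar> \<le> d'"
  shows "\<bar>a * b - x * y\<bar> \<le> d + d'"
proof -
  have "\<bar>a * b - x * y\<bar> = \<bar>(a - x) * b + x * (b - y)\<bar>" by (simp add: algebra_simps)
  also have "\<dots> \<le> \<bar>a - x\<bar> * \<bar>b\<bar> + \<bar>x\<bar> * \<bar>b - y\<bar>" by (metis abs_mult abs_triangle_ineq)
  also have "\<dots> \<le> d * 1 + 1 * d'" using assms by (intro add_mono mult_mono) auto
  finally show ?thesis by simp
qed

lemma unit_mult: "(a::real) \<in> {0..1} \<Longrightarrow> b \<in> {0..1} \<Longrightarrow> a * b \<in> {0..1}"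
  by (auto simp: mult_le_one)

context fibered_rds
begin

definition first_orbit :: "nat \<Rightarrow> 'w \<times> 'x \<times> 'x \<Rightarrow> 'x" where
  "first_orbit i z = snd (orbit i (fst z, fst (snd z)))"

definition second_orbit :: "nat \<Rightarrow> 'w \<times> 'x \<times> 'x \<Rightarrow> 'x" where
  "second_orbit i z = snd (orbit i (fst z, snd (snd z)))"

lemma first_orbit_measurable [measurable]: "first_orbit i \<in> BBB \<rightarrow>\<^sub>M borel"
  unfolding first_orbit_def by measurable

lemma second_orbit_measurable [measurable]: "second_orbit i \<in> BBB \<rightarrow>\<^sub>M borel"
  unfolding second_orbit_def by measurable

lemma base_iter_diff: "i \<le> j \<Longrightarrow> (\<theta> ^^ (j - i)) ((\<theta> ^^ i) \<omega>) = (\<theta> ^^ j) \<omega>"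
  by (metis comp_apply funpow_add le_add_diff_inverse2)

lemma orbit_dist_measurable [measurable]:
  "(\<lambda>z. dist (first_orbit i z) (second_orbit j z)) \<in> borel_measurable BBB"
proof -
  have "(\<lambda>z. (first_orbit i z, second_orbit j z)) \<in> BBB \<rightarrow>\<^sub>M borel \<Otimes>\<^sub>M borel" by measurable
  from measurable_compose[OF this compact_dist_measurable[OF compact_fiber]] show ?thesis by simp
qed

lemma integral_unit:
  fixes f :: "'w \<Rightarrow> real"
  assumes [measurable]: "f \<in> borel_measurable borel" and f: "\<And>x. f x \<in> {0..1}"
  shows "(\<integral>\<omega>. f \<omega> \<partial>P) \<in> {0..1}" "integrable P f"
proof -
  show i: "integrable P f" by (rule integrable_base[of _ 1]) (use f in auto)
  have "(\<integral>\<omega>. f \<omega> \<partial>P) \<le> (\<integral>\<omega>. 1 \<partial>P)" by (rule integral_mono) (use f i in auto)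
  moreover have "0 \<le> (\<integral>\<omega>. f \<omega> \<partial>P)" by (rule Bochner_Integration.integral_nonneg) (use f in auto)
  ultimately show "(\<integral>\<omega>. f \<omega> \<partial>P) \<in> {0..1}" using base.prob_space by simp
qed

text \<open>Replaces almost everywhere approximations inside an expectation of a product, at the cost of the sum
  of the errors since all factors are bounded by 1.\<close>
lemma integral_prod_close:
  fixes a b x y :: "'w \<Rightarrow> real"
  assumes [measurable]: "a \<in> borel_measurable borel" "b \<in> borel_measurable borel"
      "x \<in> borel_measurable borel" "y \<in> borel_measurable borel"
    and u: "\<And>\<omega>. a \<omega> \<in> {0..1}" "\<And>\<omega>. b \<omega> \<in> {0..1}" "\<And>\<omega>. x \<omega> \<in> {0..1}" "\<And>\<omega>. y \<omega> \<in> {0..1}"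
    and close: "AE \<omega> in P. \<bar>a \<omega> - x \<omega>\<bar> \<le> d" "AE \<omega> in P. \<bar>b \<omega> - y \<omega>\<bar> \<le> d'"
  shows "(\<integral>\<omega>. a \<omega> * b \<omega> \<partial>P) \<le> (\<integral>\<omega>. x \<omega> * y \<omega> \<partial>P) + (d + d')"
proof -
  have i: "integrable P (\<lambda>\<omega>. a \<omega> * b \<omega>)" "integrable P (\<lambda>\<omega>. x \<omega> * y \<omega>)"
    by (rule integral_unit(2); (intro unit_mult u)?; measurable)+
  have "AE \<omega> in P. a \<omega> * b \<omega> \<le> x \<omega> * y \<omega> + (d + d')"
    using close
  proof eventually_elim
    case (elim \<omega>)
    then show ?case using unit_prod_close[OF u[of \<omega>] elim] by simp
  qed
  then have "(\<integral>\<omega>. a \<omega> * b \<omega> \<partial>P) \<le> (\<integral>\<omega>. x \<omega> * y \<omega> + (d + d') \<partial>P)"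
    by (intro integral_mono_AE) (use i in auto)
  also have "\<dots> = (\<integral>\<omega>. x \<omega> * y \<omega> \<partial>P) + (d + d')" using i base.prob_space by simp
  finally show ?thesis .
qed

text \<open>The functions on \<open>\<Omega>\<close> to which mixing of the base is applied. The constant function lets
  4-mixing be used with fewer than four factors, and the means of products occur when two of the
  times coincide.\<close>
definition observables :: "(nat \<Rightarrow> 'x \<Rightarrow> real) \<Rightarrow> ('w \<Rightarrow> real) set" where
  "observables \<phi> = insert (\<lambda>_. 1) (range (\<lambda>p. mean (\<phi> p)) \<union> range (\<lambda>(p, q). mean (\<lambda>x. \<phi> p x * \<phi> q x)))"

end

text \<open>Mixing at a fixed time separation \<open>g\<close> with a fixed error \<open>e\<close>. Keeping rates out of the picture makes
  every moment estimate below a plain inequality between finitely many numbers.\<close>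
locale decorrelated_family = fibered_rds P \<nu> \<theta> T \<mu> + bump_family I \<phi> C0 L r
  for P :: "'w::metric_space measure" and \<nu> :: "('w \<times> 'x::metric_space) measure"
    and \<theta> T \<mu> I and \<phi> :: "nat \<Rightarrow> 'x \<Rightarrow> real" and C0 L r +
  fixes g :: nat and e :: real
  assumes gap_pos: "g \<ge> 1" and e_nonneg: "0 \<le> e"
    and fiber_mix: "\<And>p q k \<omega>. g \<le> k \<Longrightarrow>
      \<bar>(\<integral>x. \<phi> p x * \<phi> q (fiber_iter \<theta> T k \<omega> x) \<partial>\<mu> \<omega>) - mean (\<phi> p) \<omega> * mean (\<phi> q) ((\<theta> ^^ k) \<omega>)\<bar> \<le> e"
    and base_mix: "\<And>f1 f2 g1 g2 a b c. f1 \<in> observables \<phi> \<Longrightarrow> f2 \<in> observables \<phi> \<Longrightarrow>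
      g1 \<in> observables \<phi> \<Longrightarrow> g2 \<in> observables \<phi> \<Longrightarrow>
      a \<le> b \<Longrightarrow> b \<le> c \<Longrightarrow> g \<le> b - a \<Longrightarrow>
      \<bar>(\<integral>\<omega>. f1 \<omega> * f2 ((\<theta> ^^ a) \<omega>) * g1 ((\<theta> ^^ b) \<omega>) * g2 ((\<theta> ^^ c) \<omega>) \<partial>P)
        - (\<integral>\<omega>. f1 \<omega> * f2 ((\<theta> ^^ a) \<omega>) \<partial>P) * (\<integral>\<omega>. g1 \<omega> * g2 ((\<theta> ^^ (c - b)) \<omega>) \<partial>P)\<bar> \<le> e"
begin

abbreviation "Obs \<equiv> observables \<phi>"

text \<open>The smoothed indicator that the first orbit at time \<open>i\<close> and the second one at time \<open>j\<close> are
  close.\<close>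
definition kern :: "nat \<Rightarrow> nat \<Rightarrow> 'w \<times> 'x \<times> 'x \<Rightarrow> real" where
  "kern i j z = kernel (first_orbit i z) (second_orbit j z)"

definition quenched_mass :: real where
  "quenched_mass = (\<Sum>p\<in>I. \<integral>\<omega>. (mean (\<phi> p) \<omega>)\<^sup>2 \<partial>P)"

definition annealed_mass :: real where
  "annealed_mass = (\<Sum>p\<in>I. (annealed (\<phi> p))\<^sup>2)"

lemma Obs_one: "(\<lambda>_. 1) \<in> Obs" and Obs_mean: "mean (\<phi> p) \<in> Obs"
  and Obs_prod: "mean (\<lambda>x. \<phi> p x * \<phi> q x) \<in> Obs"
  unfolding observables_def by auto

lemma prod_unit: "\<phi> p x * \<phi> q x \<in> {0..1}"
  by (intro unit_mult unit)

lemma Obs_measurable [measurable_dest]: "f \<in> Obs \<Longrightarrow> f \<in> borel_measurable borel"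
  unfolding observables_def by auto

lemma Obs_unit: "f \<in> Obs \<Longrightarrow> f \<omega> \<in> {0..1}"
  unfolding observables_def using mean_unit[OF bump_measurable unit]
    mean_unit[OF borel_measurable_times[OF bump_measurable bump_measurable] prod_unit] by auto

lemma annealed_unit: "annealed (\<phi> p) \<in> {0..1}" "annealed (\<lambda>x. \<phi> p x * \<phi> q x) \<in> {0..1}"
  unfolding annealed_def
  by (rule integral_unit(1)[OF Obs_measurable Obs_unit]; rule Obs_mean Obs_prod)+

text \<open>Invariance of \<open>P\<close> moves the earliest time of each expectation to zero, where the mixing hypothesis is
  stated.\<close>
lemma base_mix_ordered:
  assumes obs: "f1 \<in> Obs" "f2 \<in> Obs" "g1 \<in> Obs" "g2 \<in> Obs"
    and ord: "i \<le> i'" "i' + g \<le> j" "j \<le> j'"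
  shows "\<bar>(\<integral>\<omega>. (f1 ((\<theta> ^^ i) \<omega>) * f2 ((\<theta> ^^ i') \<omega>)) * (g1 ((\<theta> ^^ j) \<omega>) * g2 ((\<theta> ^^ j') \<omega>)) \<partial>P)
      - (\<integral>\<omega>. f1 ((\<theta> ^^ i) \<omega>) * f2 ((\<theta> ^^ i') \<omega>) \<partial>P) * (\<integral>\<omega>. g1 ((\<theta> ^^ j) \<omega>) * g2 ((\<theta> ^^ j') \<omega>) \<partial>P)\<bar> \<le> e"
proof -
  note [measurable] = obs[THEN Obs_measurable]
  let ?F = "\<lambda>\<omega>. f1 \<omega> * f2 ((\<theta> ^^ (i' - i)) \<omega>) * g1 ((\<theta> ^^ (j - i)) \<omega>) * g2 ((\<theta> ^^ (j' - i)) \<omega>)"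
  have 1: "(\<integral>\<omega>. (f1 ((\<theta> ^^ i) \<omega>) * f2 ((\<theta> ^^ i') \<omega>)) * (g1 ((\<theta> ^^ j) \<omega>) * g2 ((\<theta> ^^ j') \<omega>)) \<partial>P)
      = (\<integral>\<omega>. ?F \<omega> \<partial>P)"
    using integral_base_iter[of ?F i] ord by (simp add: base_iter_diff mult.assoc)
  have 2: "(\<integral>\<omega>. f1 ((\<theta> ^^ i) \<omega>) * f2 ((\<theta> ^^ i') \<omega>) \<partial>P) = (\<integral>\<omega>. f1 \<omega> * f2 ((\<theta> ^^ (i' - i)) \<omega>) \<partial>P)"
    using integral_base_iter[of "\<lambda>\<omega>. f1 \<omega> * f2 ((\<theta> ^^ (i' - i)) \<omega>)" i] ord by (simp add: base_iter_diff)
  have 3: "(\<integral>\<omega>. g1 ((\<theta> ^^ j) \<omega>) * g2 ((\<theta> ^^ j') \<omega>) \<partial>P) =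
      (\<integral>\<omega>. g1 \<omega> * g2 ((\<theta> ^^ ((j' - i) - (j - i))) \<omega>) \<partial>P)"
    using integral_base_iter[of "\<lambda>\<omega>. g1 \<omega> * g2 ((\<theta> ^^ (j' - j)) \<omega>)" j] ord by (simp add: base_iter_diff)
  show ?thesis unfolding 1 2 3 by (rule base_mix[OF obs]) (use ord in auto)
qed

text \<open>Only the separation between the early pair and the late pair matters: the two factors within a pair
  may be exchanged.\<close>
lemma base_mix4:
  assumes obs: "f1 \<in> Obs" "f2 \<in> Obs" "g1 \<in> Obs" "g2 \<in> Obs"
    and ord: "i + g \<le> j" "i + g \<le> j'" "i' + g \<le> j" "i' + g \<le> j'"
  shows "\<bar>(\<integral>\<omega>. (f1 ((\<theta> ^^ i) \<omega>) * f2 ((\<theta> ^^ i') \<omega>)) * (g1 ((\<theta> ^^ j) \<omega>) * g2 ((\<theta> ^^ j') \<omega>)) \<partial>P)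
      - (\<integral>\<omega>. f1 ((\<theta> ^^ i) \<omega>) * f2 ((\<theta> ^^ i') \<omega>) \<partial>P) * (\<integral>\<omega>. g1 ((\<theta> ^^ j) \<omega>) * g2 ((\<theta> ^^ j') \<omega>) \<partial>P)\<bar> \<le> e"
proof -
  consider "i \<le> i'" "j \<le> j'" | "i' \<le> i" "j \<le> j'" | "i \<le> i'" "j' \<le> j" | "i' \<le> i" "j' \<le> j" by linarith
  then show ?thesis
  proof cases
    case 1 then show ?thesis by (intro base_mix_ordered obs ord)
  next
    case 2 then show ?thesis using base_mix_ordered[OF obs(2,1,3,4), of i' i j j'] ord
      by (simp only: mult.commute[of "f1 _"])
  next
    case 3 then show ?thesis using base_mix_ordered[OF obs(1,2,4,3), of i i' j' j] ord
      by (simp only: mult.commute[of "g1 _"])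
  next
    case 4 then show ?thesis using base_mix_ordered[OF obs(2,1,4,3), of i' i j' j] ord
      by (simp only: mult.commute[of "g1 _"] mult.commute[of "f1 _"])
  qed
qed

lemma base_mix2:
  assumes obs: "f \<in> Obs" "h \<in> Obs" and ord: "i + g \<le> j \<or> j + g \<le> i"
  shows "\<bar>(\<integral>\<omega>. f ((\<theta> ^^ i) \<omega>) * h ((\<theta> ^^ j) \<omega>) \<partial>P) - (\<integral>\<omega>. f \<omega> \<partial>P) * (\<integral>\<omega>. h \<omega> \<partial>P)\<bar> \<le> e"
proof -
  have *: "\<bar>(\<integral>\<omega>. f ((\<theta> ^^ i) \<omega>) * h ((\<theta> ^^ j) \<omega>) \<partial>P) - (\<integral>\<omega>. f \<omega> \<partial>P) * (\<integral>\<omega>. h \<omega> \<partial>P)\<bar> \<le> e"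
    if "f \<in> Obs" "h \<in> Obs" "i + g \<le> j" for f h i j
    using base_mix4[OF that(1) Obs_one that(2) Obs_one that(3) that(3) that(3) that(3)]
      integral_base_iter[OF Obs_measurable[OF that(1)], of i]
      integral_base_iter[OF Obs_measurable[OF that(2)], of j] by simp
  show ?thesis using ord *[OF obs, of i j] *[OF obs(2,1), of j i] by (auto simp: mult.commute)
qed

text \<open>By equivariance the correlation in the fiber over \<open>\<omega>\<close> equals one started at the earlier of the two
  times, where mixing along the fibers applies.\<close>
lemma joint_mix:
  assumes "i + g \<le> i' \<or> i' + g \<le> i"
  shows "AE \<omega> in P. \<bar>joint (\<phi> p) (\<phi> q) i i' \<omega> - mean (\<phi> p) ((\<theta> ^^ i) \<omega>) * mean (\<phi> q) ((\<theta> ^^ i') \<omega>)\<bar> \<le> e"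
proof -
  have *: "AE \<omega> in P. \<bar>joint (\<phi> p) (\<phi> q) i i' \<omega> - mean (\<phi> p) ((\<theta> ^^ i) \<omega>) * mean (\<phi> q) ((\<theta> ^^ i') \<omega>)\<bar> \<le> e"
    if le: "i + g \<le> i'" for i i' p q
  proof -
    define k where "k = i' - i"
    have k: "i' = i + k" "g \<le> k" using le by (auto simp: k_def)
    have "AE \<omega> in P. joint (\<phi> p) (\<phi> q) i (i + k) \<omega> =
        (\<integral>x. \<phi> p x * \<phi> q (fiber_iter \<theta> T k ((\<theta> ^^ i) \<omega>) x) \<partial>\<mu> ((\<theta> ^^ i) \<omega>))"
      by (intro AE_joint_later bump_measurable unit)
    then show ?thesis
    proof eventually_elim
      case (elim \<omega>)
      have "(\<theta> ^^ k) ((\<theta> ^^ i) \<omega>) = (\<theta> ^^ i') \<omega>"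
        using base_iter_diff[of i i'] k by simp
      then show ?case using fiber_mix[OF k(2), where p = p and q = q and \<omega> = "(\<theta> ^^ i) \<omega>"] elim k(1) by simp
    qed
  qed
  show ?thesis using assms *[of i i' p q] *[of i' i q p]
    by (auto simp: joint_commute[of "\<phi> p"] mult.commute)
qed

lemma kern_measurable [measurable]: "kern i j \<in> borel_measurable BBB"
  unfolding kern_def kernel_def by measurable

lemma kern_nonneg: "0 \<le> kern i j z" and kern_le: "kern i j z \<le> C0"
  by (simp_all add: kern_def kernel_nonneg kernel_le_multiplicity)

lemma kern_integrable: "integrable pairs (kern i j)"
  by (rule integrable_pairs[of _ C0]) (auto simp: kern_nonneg kern_le)

lemma kern_prod_integrable: "integrable pairs (\<lambda>z. kern i j z * kern i' j' z)"
proof (rule integrable_pairs[of _ "real C0 * real C0"])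
  show "\<bar>kern i j z * kern i' j' z\<bar> \<le> real C0 * real C0" for z
    unfolding abs_mult by (intro mult_mono) (auto simp: kern_nonneg kern_le)
qed measurable

lemma kern_expectation:
  "(\<integral>z. kern i j z \<partial>pairs) = (\<Sum>p\<in>I. \<integral>\<omega>. mean (\<phi> p) ((\<theta> ^^ i) \<omega>) * mean (\<phi> p) ((\<theta> ^^ j) \<omega>) \<partial>P)"
proof -
  let ?f = "\<lambda>p i z. \<phi> p (snd (orbit i z))"
  have "(\<integral>z. kern i j z \<partial>pairs) =
      (\<integral>z. (\<Sum>p\<in>I. ?f p i (fst z, fst (snd z)) * ?f p j (fst z, snd (snd z))) \<partial>pairs)"
    by (simp add: kern_def kernel_def first_orbit_def second_orbit_def)
  also have "\<dots> = (\<Sum>p\<in>I. \<integral>z. ?f p i (fst z, fst (snd z)) * ?f p j (fst z, snd (snd z)) \<partial>pairs)"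
    by (intro Bochner_Integration.integral_sum integrable_pairs[of _ 1])
       (measurable, simp add: abs_mult nonneg mult_le_one le_one)
  also have "\<dots> = (\<Sum>p\<in>I. \<integral>\<omega>. fiber_int (?f p i) \<omega> * fiber_int (?f p j) \<omega> \<partial>P)"
    by (intro sum.cong refl integral_pairs_mult[of _ 1]) (measurable, auto simp: nonneg le_one)
  also have "\<dots> = (\<Sum>p\<in>I. \<integral>\<omega>. mean (\<phi> p) ((\<theta> ^^ i) \<omega>) * mean (\<phi> p) ((\<theta> ^^ j) \<omega>) \<partial>P)"
  proof (intro sum.cong refl integral_cong_AE)
    fix p
    show "AE \<omega> in P. fiber_int (?f p i) \<omega> * fiber_int (?f p j) \<omega> =
        mean (\<phi> p) ((\<theta> ^^ i) \<omega>) * mean (\<phi> p) ((\<theta> ^^ j) \<omega>)"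
      using AE_mean_orbit[OF bump_measurable unit, of p i] AE_mean_orbit[OF bump_measurable unit, of p j]
      by eventually_elim simp
  qed measurable
  finally show ?thesis .
qed

lemma kern_prod_expectation:
  "(\<integral>z. kern i j z * kern i' j' z \<partial>pairs) =
    (\<Sum>p\<in>I. \<Sum>q\<in>I. \<integral>\<omega>. joint (\<phi> p) (\<phi> q) i i' \<omega> * joint (\<phi> p) (\<phi> q) j j' \<omega> \<partial>P)"
proof -
  let ?f = "\<lambda>p q i i' z. \<phi> p (snd (orbit i z)) * \<phi> q (snd (orbit i' z))"
  have b: "\<bar>?f p q i i' z\<bar> \<le> 1" for p q i i' z by (simp add: abs_mult nonneg mult_le_one le_one)
  have bb: "\<bar>?f p q i i' z * ?f p q j j' z'\<bar> \<le> 1" for p q i i' j j' z z'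
    unfolding abs_mult[of "?f p q i i' z"] using b by (intro mult_le_one) auto
  have i: "integrable pairs (\<lambda>z. ?f p q i i' (fst z, fst (snd z)) * ?f p q j j' (fst z, snd (snd z)))" for p q
    by (rule integrable_pairs[of _ 1]) (measurable, rule bb)
  have "(\<integral>z. kern i j z * kern i' j' z \<partial>pairs) = (\<integral>z. (\<Sum>p\<in>I. \<Sum>q\<in>I.
      ?f p q i i' (fst z, fst (snd z)) * ?f p q j j' (fst z, snd (snd z))) \<partial>pairs)"
    by (simp add: kern_def kernel_def first_orbit_def second_orbit_def sum_product mult_ac)
  also have "\<dots> = (\<Sum>p\<in>I. \<Sum>q\<in>I. \<integral>z.
      ?f p q i i' (fst z, fst (snd z)) * ?f p q j j' (fst z, snd (snd z)) \<partial>pairs)"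
    using i by (subst Bochner_Integration.integral_sum)
      (auto intro!: Bochner_Integration.integrable_sum sum.cong Bochner_Integration.integral_sum)
  also have "\<dots> = (\<Sum>p\<in>I. \<Sum>q\<in>I. \<integral>\<omega>. joint (\<phi> p) (\<phi> q) i i' \<omega> * joint (\<phi> p) (\<phi> q) j j' \<omega> \<partial>P)"
    unfolding joint_def
    by (intro sum.cong refl integral_pairs_mult[of _ 1]) (measurable, auto intro: b)
  finally show ?thesis .
qed

lemma unit_at: "f \<in> Obs \<Longrightarrow> h \<in> Obs \<Longrightarrow> f ((\<theta> ^^ i) \<omega>) * h ((\<theta> ^^ j) \<omega>) \<in> {0..1}"
  by (intro unit_mult Obs_unit)

lemma quenched_mass_nonneg: "0 \<le> quenched_mass" and annealed_mass_nonneg: "0 \<le> annealed_mass"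
  unfolding quenched_mass_def annealed_mass_def by (auto intro!: sum_nonneg)

lemma kern_expectation_same: "(\<integral>z. kern i i z \<partial>pairs) = quenched_mass"
  unfolding kern_expectation quenched_mass_def
  by (intro sum.cong refl)
     (use integral_base_iter[of "\<lambda>\<omega>. (mean (\<phi> _) \<omega>)\<^sup>2" i] in \<open>simp add: power2_eq_square\<close>)

text \<open>By \<open>2 * a * b \<le> a\<^sup>2 + b\<^sup>2\<close> and invariance, no pair of times counts more than a diagonal
  one. This is what controls pairs of times too close to each other for mixing to say anything.\<close>
lemma kern_expectation_le: "(\<integral>z. kern i j z \<partial>pairs) \<le> quenched_mass"
proof -
  have "(\<integral>\<omega>. mean (\<phi> p) ((\<theta> ^^ i) \<omega>) * mean (\<phi> p) ((\<theta> ^^ j) \<omega>) \<partial>P) \<le> (\<integral>\<omega>. (mean (\<phi> p) \<omega>)\<^sup>2 \<partial>P)" for p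
  proof -
    let ?m = "mean (\<phi> p)"
    have u: "?m \<omega> \<in> {0..1}" for \<omega> by (intro Obs_unit Obs_mean)
    have i: "integrable P (\<lambda>\<omega>. (?m ((\<theta> ^^ k) \<omega>))\<^sup>2)" for k
      unfolding power2_eq_square by (intro integral_unit(2) unit_mult u) measurable
    have "(\<integral>\<omega>. ?m ((\<theta> ^^ i) \<omega>) * ?m ((\<theta> ^^ j) \<omega>) \<partial>P) \<le>
        (\<integral>\<omega>. ((?m ((\<theta> ^^ i) \<omega>))\<^sup>2 + (?m ((\<theta> ^^ j) \<omega>))\<^sup>2) / 2 \<partial>P)"
    proof (rule integral_mono)
      show "integrable P (\<lambda>\<omega>. ?m ((\<theta> ^^ i) \<omega>) * ?m ((\<theta> ^^ j) \<omega>))"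
        by (intro integral_unit(2) unit_mult u) measurable
      show "?m ((\<theta> ^^ i) \<omega>) * ?m ((\<theta> ^^ j) \<omega>) \<le> ((?m ((\<theta> ^^ i) \<omega>))\<^sup>2 + (?m ((\<theta> ^^ j) \<omega>))\<^sup>2) / 2" for \<omega>
        using sum_squares_bound[of "?m ((\<theta> ^^ i) \<omega>)" "?m ((\<theta> ^^ j) \<omega>)"] by simp
    qed (use i in auto)
    also have "\<dots> = (\<integral>\<omega>. (?m \<omega>)\<^sup>2 \<partial>P)"
      using i[of i] i[of j] integral_base_iter[of "\<lambda>\<omega>. (?m \<omega>)\<^sup>2" i] integral_base_iter[of "\<lambda>\<omega>. (?m \<omega>)\<^sup>2" j]
      by simp
    finally show ?thesis .
  qed
  then show ?thesis unfolding kern_expectation quenched_mass_def by (intro sum_mono)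
qed

lemma kern_expectation_far:
  assumes "i + g \<le> j \<or> j + g \<le> i"
  shows "\<bar>(\<integral>z. kern i j z \<partial>pairs) - annealed_mass\<bar> \<le> card I * e"
proof -
  have "\<bar>(\<integral>z. kern i j z \<partial>pairs) - annealed_mass\<bar> \<le>
     (\<Sum>p\<in>I. \<bar>(\<integral>\<omega>. mean (\<phi> p) ((\<theta> ^^ i) \<omega>) * mean (\<phi> p) ((\<theta> ^^ j) \<omega>) \<partial>P) - annealed (\<phi> p) * annealed (\<phi> p)\<bar>)"
    unfolding kern_expectation annealed_mass_def power2_eq_square sum_subtractf[symmetric] by (rule sum_abs)
  also have "\<dots> \<le> (\<Sum>p\<in>I. e)"
    unfolding annealed_def by (intro sum_mono base_mix2 Obs_mean assms)
  finally show ?thesis by simp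
qed

text \<open>First moment: near the diagonal a pair of times contributes at most the quenched mass, away
  from it about the annealed mass.\<close>
lemma prob_close_le:
  "measure pairs {z. \<exists>i<n. \<exists>j<n. dist (first_orbit i z) (second_orbit j z) < r}
    \<le> 2 * real n * g * quenched_mass + (real n)\<^sup>2 * (annealed_mass + card I * e)"
proof -
  let ?A = "{z. \<exists>i<n. \<exists>j<n. dist (first_orbit i z) (second_orbit j z) < r}"
  let ?Z = "\<lambda>z. \<Sum>i<n. \<Sum>j<n. kern i j z"
  have A[measurable]: "?A \<in> sets BBB"
  proof -
    have "Measurable.pred BBB (\<lambda>z. \<exists>i<n. \<exists>j<n. dist (first_orbit i z) (second_orbit j z) < r)"
      by measurable
    then show ?thesis by (simp add: pred_def space_pair_measure)
  qed
  have "measure pairs ?A = (\<integral>z. indicator ?A z \<partial>pairs)" by simp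
  also have "\<dots> \<le> (\<integral>z. ?Z z \<partial>pairs)"
  proof (rule integral_mono)
    show "integrable pairs (indicator ?A :: _ \<Rightarrow> real)"
      by (rule integrable_pairs[of _ 1]) (auto simp: indicator_def)
    show "integrable pairs ?Z" by (intro Bochner_Integration.integrable_sum kern_integrable)
    show "indicator ?A z \<le> ?Z z" for z
    proof (cases "z \<in> ?A")
      case True
      then obtain i j where ij: "i < n" "j < n" "dist (first_orbit i z) (second_orbit j z) < r" by blast
      then have "1 \<le> kern i j z" by (simp add: kern_def kernel_ge_one)
      also have "\<dots> \<le> (\<Sum>j<n. kern i j z)"
        using member_le_sum[of j "{..<n}" "\<lambda>j. kern i j z"] ij by (simp add: kern_nonneg)
      also have "\<dots> \<le> ?Z z"
        using member_le_sum[of i "{..<n}" "\<lambda>i. \<Sum>j<n. kern i j z"] ij by (simp add: kern_nonneg sum_nonneg)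
      finally show ?thesis using True by simp
    next
      case False
      then show ?thesis by (auto intro!: sum_nonneg simp: kern_nonneg)
    qed
  qed
  also have "\<dots> = (\<Sum>i<n. \<Sum>j<n. \<integral>z. kern i j z \<partial>pairs)"
    by (simp add: Bochner_Integration.integral_sum Bochner_Integration.integrable_sum kern_integrable)
  also have "\<dots> \<le> (\<Sum>i<n. 2 * g * quenched_mass + real n * (annealed_mass + card I * e))"
  proof (rule sum_mono)
    fix i assume "i \<in> {..<n}"
    let ?near = "{j. j < n \<and> \<not> (i + g \<le> j \<or> j + g \<le> i)}"
    let ?far = "{j. j < n \<and> (i + g \<le> j \<or> j + g \<le> i)}"
    have split: "{..<n} = ?near \<union> ?far" by auto
    have "?near \<subseteq> {Suc i - g..<i + g}" by auto
    from card_mono[OF _ this] have cn: "card ?near \<le> 2 * g" by simp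
    have cf: "card ?far \<le> n" using card_mono[of "{..<n}" ?far] by auto
    have nn: "0 \<le> annealed_mass + card I * e" using annealed_mass_nonneg e_nonneg by simp
    have "(\<Sum>j<n. \<integral>z. kern i j z \<partial>pairs) =
        (\<Sum>j\<in>?near. \<integral>z. kern i j z \<partial>pairs) + (\<Sum>j\<in>?far. \<integral>z. kern i j z \<partial>pairs)"
      unfolding split by (rule sum.union_disjoint) auto
    also have "\<dots> \<le> (\<Sum>j\<in>?near. quenched_mass) + (\<Sum>j\<in>?far. annealed_mass + card I * e)"
      using kern_expectation_far[of i] by (intro add_mono sum_mono kern_expectation_le) (force simp: abs_le_iff)
    also have "\<dots> \<le> real (2 * g) * quenched_mass + real n * (annealed_mass + card I * e)"
      using cn cf nn quenched_mass_nonneg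
      by (simp only: sum_constant) (intro add_mono mult_right_mono of_nat_mono, auto)
    finally show "(\<Sum>j<n. \<integral>z. kern i j z \<partial>pairs) \<le> 2 * g * quenched_mass + real n * (annealed_mass + card I * e)"
      by simp
  qed
  also have "\<dots> = 2 * real n * g * quenched_mass + (real n)\<^sup>2 * (annealed_mass + card I * e)"
    by (simp add: algebra_simps power2_eq_square)
  finally show ?thesis .
qed

text \<open>Mixing along the fibers separates the two times for each of the two points, which leaves the square
  of a product of fiber means. Grouping it by time instead of by point gives four observables in two
  pairs of equal times, and 4-mixing factors the expectation.\<close>
lemma kern_prod_same_time:
  assumes "i + g \<le> i' \<or> i' + g \<le> i"
  shows "(\<integral>z. kern i i z * kern i' i' z \<partial>pairs) \<le> quenched_mass\<^sup>2 + 3 * (card I)\<^sup>2 * e"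
proof -
  let ?m = "\<lambda>p. mean (\<phi> p)"
  have "(\<integral>\<omega>. joint (\<phi> p) (\<phi> q) i i' \<omega> * joint (\<phi> p) (\<phi> q) i i' \<omega> \<partial>P)
      \<le> (\<integral>\<omega>. (?m p \<omega>)\<^sup>2 \<partial>P) * (\<integral>\<omega>. (?m q \<omega>)\<^sup>2 \<partial>P) + 3 * e" for p q
  proof -
    let ?x = "\<lambda>\<omega>. ?m p ((\<theta> ^^ i) \<omega>) * ?m q ((\<theta> ^^ i') \<omega>)"
    have sq: "(\<integral>\<omega>. ?m p ((\<theta> ^^ i) \<omega>) * ?m p ((\<theta> ^^ i) \<omega>) \<partial>P) = (\<integral>\<omega>. (?m p \<omega>)\<^sup>2 \<partial>P)" for p i
      using integral_base_iter[of "\<lambda>\<omega>. (?m p \<omega>)\<^sup>2" i] by (simp add: power2_eq_square)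
    have "(\<integral>\<omega>. joint (\<phi> p) (\<phi> q) i i' \<omega> * joint (\<phi> p) (\<phi> q) i i' \<omega> \<partial>P) \<le> (\<integral>\<omega>. ?x \<omega> * ?x \<omega> \<partial>P) + (e + e)"
      by (intro integral_prod_close joint_mix assms joint_unit unit unit_at Obs_mean) measurable
    also have "(\<integral>\<omega>. ?x \<omega> * ?x \<omega> \<partial>P) \<le> (\<integral>\<omega>. (?m p \<omega>)\<^sup>2 \<partial>P) * (\<integral>\<omega>. (?m q \<omega>)\<^sup>2 \<partial>P) + e"
      using assms
    proof
      assume le: "i + g \<le> i'"
      show ?thesis
        using base_mix4[OF Obs_mean[of p] Obs_mean[of p] Obs_mean[of q] Obs_mean[of q] le le le le]
        unfolding sq by (simp add: mult_ac abs_le_iff)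
    next
      assume le: "i' + g \<le> i"
      show ?thesis
        using base_mix4[OF Obs_mean[of q] Obs_mean[of q] Obs_mean[of p] Obs_mean[of p] le le le le]
        unfolding sq by (simp add: mult_ac abs_le_iff)
    qed
    finally show ?thesis by simp
  qed
  then have "(\<integral>z. kern i i z * kern i' i' z \<partial>pairs) \<le>
      (\<Sum>p\<in>I. \<Sum>q\<in>I. (\<integral>\<omega>. (?m p \<omega>)\<^sup>2 \<partial>P) * (\<integral>\<omega>. (?m q \<omega>)\<^sup>2 \<partial>P) + 3 * e)"
    unfolding kern_prod_expectation by (intro sum_mono)
  also have "\<dots> = quenched_mass\<^sup>2 + 3 * (card I)\<^sup>2 * e"
    unfolding quenched_mass_def power2_eq_square sum_product
    by (simp add: sum.distrib power2_eq_square)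
  finally show ?thesis .
qed

text \<open>The average over \<open>\<omega>\<close> of the correlation inside a fiber of the bumps \<open>p\<close> and \<open>q\<close>, at equal times or in
  the limit of separated ones.\<close>
definition overlap :: "bool \<Rightarrow> nat \<Rightarrow> nat \<Rightarrow> real" where
  "overlap same p q = (if same then annealed (\<lambda>x. \<phi> p x * \<phi> q x) else annealed (\<phi> p) * annealed (\<phi> q))"

text \<open>Equal and separated times are treated alike: in both cases the correlation inside the fiber is close
  to a product of two observables, one of which is constant when the times agree.\<close>
lemma joint_decouple:
  assumes "i = i' \<or> i + g \<le> i' \<or> i' + g \<le> i"
  shows "\<exists>f\<in>Obs. \<exists>h\<in>Obs.
    (AE \<omega> in P. \<bar>joint (\<phi> p) (\<phi> q) i i' \<omega> - f ((\<theta> ^^ i) \<omega>) * h ((\<theta> ^^ i') \<omega>)\<bar> \<le> e) \<and>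
    \<bar>(\<integral>\<omega>. f ((\<theta> ^^ i) \<omega>) * h ((\<theta> ^^ i') \<omega>) \<partial>P) - overlap (i = i') p q\<bar> \<le> e"
proof (cases "i = i'")
  case True
  have "AE \<omega> in P. joint (\<phi> p) (\<phi> q) i i \<omega> = mean (\<lambda>x. \<phi> p x * \<phi> q x) ((\<theta> ^^ i) \<omega>)"
    by (intro AE_joint_same bump_measurable unit)
  then have "AE \<omega> in P. \<bar>joint (\<phi> p) (\<phi> q) i i \<omega> - mean (\<lambda>x. \<phi> p x * \<phi> q x) ((\<theta> ^^ i) \<omega>) * 1\<bar> \<le> e"
    by eventually_elim (simp add: e_nonneg)
  moreover have "(\<integral>\<omega>. mean (\<lambda>x. \<phi> p x * \<phi> q x) ((\<theta> ^^ i) \<omega>) * 1 \<partial>P) = overlap True p q"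
    using integral_base_iter[OF Obs_measurable[OF Obs_prod], of p q i] by (simp add: overlap_def annealed_def)
  ultimately show ?thesis using True e_nonneg
    by (intro bexI[OF _ Obs_prod[of p q]] bexI[OF _ Obs_one]) simp
next
  case False
  with assms have far: "i + g \<le> i' \<or> i' + g \<le> i" by blast
  show ?thesis
    using joint_mix[OF far, of p q] base_mix2[OF Obs_mean[of p] Obs_mean[of q] far] False
    by (intro bexI[OF _ Obs_mean[of p]] bexI[OF _ Obs_mean[of q]]) (simp add: overlap_def annealed_def)
qed

lemma overlap_unit: "overlap s p q \<in> {0..1}"
  unfolding overlap_def using annealed_unit by (auto intro: unit_mult simp: mult_le_one)

text \<open>The first orbit is observed at the early times and the second at the late ones, so 4-mixing
  removes the dependence that comes from the common base point.\<close>
lemma kern_prod_early_late: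
  assumes ii: "i = i' \<or> i + g \<le> i' \<or> i' + g \<le> i" and jj: "j = j' \<or> j + g \<le> j' \<or> j' + g \<le> j"
    and ord: "i + g \<le> j" "i + g \<le> j'" "i' + g \<le> j" "i' + g \<le> j'"
  shows "(\<integral>z. kern i j z * kern i' j' z \<partial>pairs) \<le>
    (\<Sum>p\<in>I. \<Sum>q\<in>I. overlap (i = i') p q * overlap (j = j') p q) + 5 * (card I)\<^sup>2 * e"
proof -
  have "(\<integral>\<omega>. joint (\<phi> p) (\<phi> q) i i' \<omega> * joint (\<phi> p) (\<phi> q) j j' \<omega> \<partial>P)
      \<le> overlap (i = i') p q * overlap (j = j') p q + 5 * e" for p q
  proof -
    obtain f1 f2 where f: "f1 \<in> Obs" "f2 \<in> Obs"
      "AE \<omega> in P. \<bar>joint (\<phi> p) (\<phi> q) i i' \<omega> - f1 ((\<theta> ^^ i) \<omega>) * f2 ((\<theta> ^^ i') \<omega>)\<bar> \<le> e"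
      "\<bar>(\<integral>\<omega>. f1 ((\<theta> ^^ i) \<omega>) * f2 ((\<theta> ^^ i') \<omega>) \<partial>P) - overlap (i = i') p q\<bar> \<le> e"
      using joint_decouple[OF ii, of p q] by blast
    obtain g1 g2 where gg: "g1 \<in> Obs" "g2 \<in> Obs"
      "AE \<omega> in P. \<bar>joint (\<phi> p) (\<phi> q) j j' \<omega> - g1 ((\<theta> ^^ j) \<omega>) * g2 ((\<theta> ^^ j') \<omega>)\<bar> \<le> e"
      "\<bar>(\<integral>\<omega>. g1 ((\<theta> ^^ j) \<omega>) * g2 ((\<theta> ^^ j') \<omega>) \<partial>P) - overlap (j = j') p q\<bar> \<le> e"
      using joint_decouple[OF jj, of p q] by blast
    note [measurable] = f(1,2)[THEN Obs_measurable] gg(1,2)[THEN Obs_measurable]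
    let ?x = "\<lambda>\<omega>. f1 ((\<theta> ^^ i) \<omega>) * f2 ((\<theta> ^^ i') \<omega>)" and ?y = "\<lambda>\<omega>. g1 ((\<theta> ^^ j) \<omega>) * g2 ((\<theta> ^^ j') \<omega>)"
    have "(\<integral>\<omega>. joint (\<phi> p) (\<phi> q) i i' \<omega> * joint (\<phi> p) (\<phi> q) j j' \<omega> \<partial>P) \<le> (\<integral>\<omega>. ?x \<omega> * ?y \<omega> \<partial>P) + (e + e)"
      by (intro integral_prod_close joint_unit unit unit_at f gg) measurable
    also have "(\<integral>\<omega>. ?x \<omega> * ?y \<omega> \<partial>P) \<le> (\<integral>\<omega>. ?x \<omega> \<partial>P) * (\<integral>\<omega>. ?y \<omega> \<partial>P) + e"
      using base_mix4[OF f(1,2) gg(1,2) ord(1) ord(2) ord(3) ord(4)] by (simp add: abs_le_iff)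
    also have "(\<integral>\<omega>. ?x \<omega> \<partial>P) * (\<integral>\<omega>. ?y \<omega> \<partial>P) \<le> overlap (i = i') p q * overlap (j = j') p q + (e + e)"
    proof -
      have "(\<integral>\<omega>. ?x \<omega> \<partial>P) \<in> {0..1}" "(\<integral>\<omega>. ?y \<omega> \<partial>P) \<in> {0..1}"
        by (intro integral_unit(1) unit_at f gg; measurable)+
      from unit_prod_close[OF this overlap_unit overlap_unit f(4) gg(4)] show ?thesis by (simp add: abs_le_iff)
    qed
    finally show ?thesis by simp
  qed
  then have "(\<integral>z. kern i j z * kern i' j' z \<partial>pairs) \<le>
      (\<Sum>p\<in>I. \<Sum>q\<in>I. overlap (i = i') p q * overlap (j = j') p q + 5 * e)"
    unfolding kern_prod_expectation by (intro sum_mono)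
  also have "\<dots> = (\<Sum>p\<in>I. \<Sum>q\<in>I. overlap (i = i') p q * overlap (j = j') p q) + 5 * (card I)\<^sup>2 * e"
    by (simp add: sum.distrib power2_eq_square)
  finally show ?thesis .
qed

end


text \<open>The second moment is taken about an arbitrary \<open>a\<close> instead of the mean, so that the mean need only be
  known approximately.\<close>
lemma (in prob_space) prob_zero_le:
  fixes Z :: "'a \<Rightarrow> real"
  assumes [measurable]: "Z \<in> borel_measurable M" and B: "\<And>x. \<bar>Z x\<bar> \<le> B" and a: "a > 0"
  shows "prob {x\<in>space M. Z x = 0} \<le> (expectation (\<lambda>x. (Z x)\<^sup>2) - 2 * a * expectation Z + a\<^sup>2) / a\<^sup>2"
proof -
  have i1: "integrable M Z" by (rule integrable_const_bound[of _ B]) (use B in auto)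
  have "(Z x)\<^sup>2 \<le> B\<^sup>2" for x using power_mono[OF B[of x] abs_ge_zero, of 2] by simp
  then have i2: "integrable M (\<lambda>x. (Z x)\<^sup>2)"
    by (intro integrable_const_bound[of _ "B\<^sup>2"]) auto
  have eq: "(Z x - a)\<^sup>2 = (Z x)\<^sup>2 - 2 * a * Z x + a\<^sup>2" for x by (simp add: power2_diff)
  have "prob {x\<in>space M. Z x = 0} \<le> prob {x\<in>space M. \<bar>Z x - a\<bar> \<ge> a}"
    by (rule finite_measure_mono) auto
  also have "\<dots> \<le> expectation (\<lambda>x. (Z x - a)\<^sup>2) / a\<^sup>2"
    by (rule second_moment_method) (use a i1 i2 in \<open>auto simp: eq\<close>)
  also have "expectation (\<lambda>x. (Z x - a)\<^sup>2) = expectation (\<lambda>x. (Z x)\<^sup>2) - 2 * a * expectation Z + a\<^sup>2"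
    unfolding eq using i1 i2 prob_space by simp
  finally show ?thesis .
qed

context decorrelated_family
begin

lemma sets_marginal [measurable_cong]: "sets (fiber_marginal \<nu>) = sets borel"
  by (simp add: fiber_marginal_def)

lemma marginal_integrable:
  fixes f :: "'x \<Rightarrow> real"
  assumes [measurable]: "f \<in> borel_measurable borel" and "\<And>x. f x \<in> {0..1}"
  shows "integrable (fiber_marginal \<nu>) f"
proof -
  interpret N: prob_space "fiber_marginal \<nu>" by (rule prob_fiber_marginal)
  show ?thesis by (rule N.integrable_const_bound[of _ 1]) (use assms in auto)
qed

lemma annealed_bump: "annealed (\<phi> p) = (\<integral>x. \<phi> p x \<partial>fiber_marginal \<nu>)"
  by (rule annealed_eq[symmetric, of _ 1]) (auto simp: nonneg le_one)

lemma annealed_prod: "annealed (\<lambda>x. \<phi> p x * \<phi> q x) = (\<integral>x. \<phi> p x * \<phi> q x \<partial>fiber_marginal \<nu>)"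
  by (rule annealed_eq[symmetric, of _ 1]) (use prod_unit[of p _ q] in auto)

lemma integrable_bump: "integrable (fiber_marginal \<nu>) (\<phi> p)"
  and integrable_prod: "integrable (fiber_marginal \<nu>) (\<lambda>x. \<phi> p x * \<phi> q x)"
  by (intro marginal_integrable unit prod_unit; measurable)+

lemma overlap_distinct: "(\<Sum>p\<in>I. \<Sum>q\<in>I. overlap False p q * overlap False p q) = annealed_mass\<^sup>2"
  by (simp add: overlap_def annealed_mass_def power2_eq_square sum_product mult_ac)

text \<open>The left side is the integral of the square of \<open>\<Sum>p\<in>I. annealed (\<phi> p) * \<phi> p x\<close>, which plays the role
  of \<open>\<mu>(B(x, r))\<close>. It is at most \<open>C0\<close> times the sum of the cubes of the bump means, and the
  \<open>\<ell>\<^sup>3\<close> norm is at most the \<open>\<ell>\<^sup>2\<close> norm.\<close>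
lemma overlap_half: "(\<Sum>p\<in>I. \<Sum>q\<in>I. overlap True p q * overlap False p q) \<le> C0 * (annealed_mass * sqrt annealed_mass)"
proof -
  let ?a = "\<lambda>p. annealed (\<phi> p)"
  have a0: "0 \<le> ?a p" for p using annealed_unit(1)[of p] by simp
  have "(\<Sum>p\<in>I. \<Sum>q\<in>I. overlap True p q * overlap False p q) =
      (\<integral>x. (\<Sum>p\<in>I. \<Sum>q\<in>I. \<phi> p x * \<phi> q x * (?a p * ?a q)) \<partial>fiber_marginal \<nu>)"
    using integrable_prod by (simp add: overlap_def annealed_prod)
  also have "\<dots> = (\<integral>x. (\<Sum>p\<in>I. ?a p * \<phi> p x)\<^sup>2 \<partial>fiber_marginal \<nu>)"
    by (simp add: power2_eq_square sum_product mult_ac)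
  also have "\<dots> \<le> (\<integral>x. C0 * (\<Sum>p\<in>I. (?a p)\<^sup>2 * \<phi> p x) \<partial>fiber_marginal \<nu>)"
  proof (rule integral_mono)
    have "integrable (fiber_marginal \<nu>) (\<lambda>x. \<Sum>p\<in>I. \<Sum>q\<in>I. \<phi> p x * \<phi> q x * (?a p * ?a q))"
      by (intro Bochner_Integration.integrable_sum integrable_mult_left integrable_prod)
    then show "integrable (fiber_marginal \<nu>) (\<lambda>x. (\<Sum>p\<in>I. ?a p * \<phi> p x)\<^sup>2)"
      by (simp add: power2_eq_square sum_product mult_ac)
  qed (use square_sum_le[of ?a] a0 integrable_bump in auto)
  also have "\<dots> = C0 * (\<Sum>p\<in>I. (?a p)\<^sup>2 * ?a p)"
    using integrable_bump by (simp add: annealed_bump)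
  also have "\<dots> \<le> C0 * (\<Sum>p\<in>I. (?a p)\<^sup>2 * sqrt annealed_mass)"
  proof (intro mult_left_mono sum_mono)
    fix p assume "p \<in> I"
    then have "(?a p)\<^sup>2 \<le> annealed_mass" unfolding annealed_mass_def
      using member_le_sum[of p I "\<lambda>p. (?a p)\<^sup>2"] finite_index by simp
    then show "?a p \<le> sqrt annealed_mass" by (rule real_le_rsqrt)
  qed auto
  also have "\<dots> = C0 * (annealed_mass * sqrt annealed_mass)"
    by (simp add: annealed_mass_def sum_distrib_right)
  finally show ?thesis .
qed

text \<open>Each bump mean bounds the means of its products, and at most \<open>C0\<close> bumps meet at a point.\<close>
lemma overlap_full: "(\<Sum>p\<in>I. \<Sum>q\<in>I. overlap True p q * overlap True p q) \<le> C0 * annealed_mass"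
proof -
  let ?a = "\<lambda>p. annealed (\<phi> p)" and ?b = "\<lambda>p q. annealed (\<lambda>x. \<phi> p x * \<phi> q x)"
  have a0: "0 \<le> ?a p" for p using annealed_unit(1)[of p] by simp
  have b0: "0 \<le> ?b p q" for p q using annealed_unit(2)[of p q] by simp
  have ba: "?b p q \<le> ?a p" for p q
    unfolding annealed_bump annealed_prod
    by (intro integral_mono integrable_bump integrable_prod) (simp add: mult_left_le nonneg le_one)
  have sb: "(\<Sum>q\<in>I. ?b p q) \<le> C0 * ?a p" for p
  proof -
    have "(\<Sum>q\<in>I. ?b p q) = (\<integral>x. (\<Sum>q\<in>I. \<phi> p x * \<phi> q x) \<partial>fiber_marginal \<nu>)"
      using integrable_prod by (simp add: annealed_prod)
    also have "\<dots> \<le> (\<integral>x. C0 * \<phi> p x \<partial>fiber_marginal \<nu>)"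
    proof (intro integral_mono Bochner_Integration.integrable_sum integrable_mult_right integrable_prod integrable_bump)
      show "(\<Sum>q\<in>I. \<phi> p x * \<phi> q x) \<le> C0 * \<phi> p x" for x
        unfolding sum_distrib_left[symmetric]
        using mult_right_mono[OF sum_bump_le[of x] nonneg[of p x]] by (simp add: mult.commute)
    qed
    finally show ?thesis by (simp add: annealed_bump)
  qed
  have "(\<Sum>p\<in>I. \<Sum>q\<in>I. overlap True p q * overlap True p q) \<le> (\<Sum>p\<in>I. \<Sum>q\<in>I. ?a p * ?b p q)"
    unfolding overlap_def by (auto intro!: sum_mono mult_right_mono ba b0)
  also have "\<dots> \<le> (\<Sum>p\<in>I. ?a p * (C0 * ?a p))"
    unfolding sum_distrib_left[symmetric] by (intro sum_mono mult_left_mono sb a0)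
  also have "\<dots> = C0 * annealed_mass"
    by (simp add: annealed_mass_def sum_distrib_left power2_eq_square mult_ac)
  finally show ?thesis .
qed

lemma overlap_sum_le:
  "(\<Sum>p\<in>I. \<Sum>q\<in>I. overlap s p q * overlap s' p q) \<le> annealed_mass\<^sup>2
     + (of_bool s + of_bool s') * (C0 * (annealed_mass * sqrt annealed_mass))
     + of_bool s * of_bool s' * (C0 * annealed_mass)"
proof -
  have nn: "0 \<le> C0 * (annealed_mass * sqrt annealed_mass)" "0 \<le> annealed_mass\<^sup>2"
    using annealed_mass_nonneg by auto
  have sym: "(\<Sum>p\<in>I. \<Sum>q\<in>I. overlap False p q * overlap True p q) =
      (\<Sum>p\<in>I. \<Sum>q\<in>I. overlap True p q * overlap False p q)"
    by (intro sum.cong refl mult.commute)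
  consider "s" "s'" | "s" "\<not> s'" | "\<not> s" "s'" | "\<not> s" "\<not> s'" by blast
  then show ?thesis
  proof cases
    case 1
    then show ?thesis using overlap_full nn by (simp add: add_increasing)
  next
    case 2
    then show ?thesis using overlap_half nn by (simp add: add_increasing)
  next
    case 3
    then show ?thesis using overlap_half nn sym by (simp add: add_increasing)
  next
    case 4
    then show ?thesis using overlap_distinct by simp
  qed
qed

lemma kern_eq_0: "8 * r \<le> dist (first_orbit i z) (second_orbit j z) \<Longrightarrow> kern i j z = 0"
  using kernel_le[of "first_orbit i z" "second_orbit j z"] kern_nonneg[of i j z] by (simp add: kern_def)

lemma kern_sum_bound:
  assumes "finite A" shows "\<bar>\<Sum>t\<in>A. kern (f t) (h t) z\<bar> \<le> card A * C0"
proof -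
  have "\<bar>\<Sum>t\<in>A. kern (f t) (h t) z\<bar> \<le> (\<Sum>t\<in>A. \<bar>kern (f t) (h t) z\<bar>)" by (rule sum_abs)
  also have "\<dots> \<le> (\<Sum>t\<in>A. real C0)" by (intro sum_mono) (simp add: kern_nonneg kern_le)
  finally show ?thesis by simp
qed

text \<open>Distances of at least \<open>8 * r\<close> make every kernel vanish, so the event lies in the zero set of the
  count.\<close>
lemma prob_all_far_le:
  assumes A: "finite A" and a: "a > 0"
  shows "measure pairs {z. \<forall>t\<in>A. 8 * r \<le> dist (first_orbit (f t) z) (second_orbit (h t) z)} \<le>
    ((\<Sum>t\<in>A. \<Sum>t'\<in>A. \<integral>z. kern (f t) (h t) z * kern (f t') (h t') z \<partial>pairs)
      - 2 * a * (\<Sum>t\<in>A. \<integral>z. kern (f t) (h t) z \<partial>pairs) + a\<^sup>2) / a\<^sup>2"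
proof -
  let ?Z = "\<lambda>z. \<Sum>t\<in>A. kern (f t) (h t) z"
  have "measure pairs {z. \<forall>t\<in>A. 8 * r \<le> dist (first_orbit (f t) z) (second_orbit (h t) z)} \<le>
      measure pairs {z\<in>space pairs. ?Z z = 0}"
  proof (rule pairs.finite_measure_mono)
    show "{z. \<forall>t\<in>A. 8 * r \<le> dist (first_orbit (f t) z) (second_orbit (h t) z)} \<subseteq> {z\<in>space pairs. ?Z z = 0}"
      by (auto intro!: sum.neutral kern_eq_0)
  qed measurable
  also have "\<dots> \<le> (pairs.expectation (\<lambda>z. (?Z z)\<^sup>2) - 2 * a * pairs.expectation ?Z + a\<^sup>2) / a\<^sup>2"
    by (rule pairs.prob_zero_le[OF _ kern_sum_bound[OF A] a]) measurable
  also have "pairs.expectation ?Z = (\<Sum>t\<in>A. \<integral>z. kern (f t) (h t) z \<partial>pairs)"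
    by (simp add: kern_integrable)
  also have "pairs.expectation (\<lambda>z. (?Z z)\<^sup>2) =
      (\<Sum>t\<in>A. \<Sum>t'\<in>A. \<integral>z. kern (f t) (h t) z * kern (f t') (h t') z \<partial>pairs)"
    unfolding power2_eq_square sum_product by (simp add: kern_prod_integrable)
  finally show ?thesis .
qed

text \<open>The variance of the count over \<open>m\<close> equal times consists of \<open>m\<close> diagonal terms, each at most
  \<open>C0 * quenched_mass\<close>, and of decorrelated ones.\<close>
lemma prob_same_time_far_le:
  fixes m :: nat
  assumes m: "m \<ge> 1" and q: "quenched_mass > 0"
  shows "measure pairs {z. \<forall>u<m. 8 * r \<le> dist (first_orbit (u * g) z) (second_orbit (u * g) z)}
    \<le> C0 / (m * quenched_mass) + 3 * (card I)\<^sup>2 * e / quenched_mass\<^sup>2"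
proof -
  let ?q = quenched_mass and ?a = "m * quenched_mass"
  let ?E = "3 * real ((card I)\<^sup>2) * e"
  have E0: "0 \<le> ?E" using e_nonneg by simp
  have a: "?a > 0" using m q by simp
  have t: "(\<integral>z. kern (u * g) (u * g) z * kern (u' * g) (u' * g) z \<partial>pairs)
      \<le> (?q\<^sup>2 + ?E) + of_bool (u = u') * (C0 * ?q)" for u u'
  proof (cases "u = u'")
    case True
    have "(\<integral>z. kern (u * g) (u * g) z * kern (u' * g) (u' * g) z \<partial>pairs) \<le> (\<integral>z. C0 * kern (u * g) (u * g) z \<partial>pairs)"
      by (intro integral_mono kern_prod_integrable integrable_mult_right kern_integrable)
         (metis kern_le kern_nonneg mult.commute mult_left_mono)
    also have "\<dots> = C0 * ?q" by (simp add: kern_expectation_same)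
    finally show ?thesis using True E0 by (simp add: add_increasing)
  next
    case False
    then have "u * g + g \<le> u' * g \<or> u' * g + g \<le> u * g"
      by (metis Suc_leI linorder_neqE_nat mult_Suc mult_le_mono1 add.commute)
    from kern_prod_same_time[OF this] show ?thesis using False by simp
  qed
  have "(\<Sum>u<m. \<Sum>u'<m. \<integral>z. kern (u * g) (u * g) z * kern (u' * g) (u' * g) z \<partial>pairs) \<le>
      (\<Sum>u<m. \<Sum>u'<m. (?q\<^sup>2 + ?E) + of_bool (u = u') * (C0 * ?q))" by (intro sum_mono t)
  also have "\<dots> = (real m)\<^sup>2 * (?q\<^sup>2 + ?E) + m * (C0 * ?q)"
    by (simp add: sum.distrib sum_distrib_right[symmetric] power2_eq_square of_bool_def distrib_left mult.assoc)
  finally have s: "(\<Sum>u<m. \<Sum>u'<m. \<integral>z. kern (u * g) (u * g) z * kern (u' * g) (u' * g) z \<partial>pairs)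
      \<le> (real m)\<^sup>2 * (?q\<^sup>2 + ?E) + m * (C0 * ?q)" .
  have "measure pairs {z. \<forall>u\<in>{..<m}. 8 * r \<le> dist (first_orbit (u * g) z) (second_orbit (u * g) z)}
      \<le> ((\<Sum>u<m. \<Sum>u'<m. \<integral>z. kern (u * g) (u * g) z * kern (u' * g) (u' * g) z \<partial>pairs)
      - 2 * ?a * (\<Sum>u<m. \<integral>z. kern (u * g) (u * g) z \<partial>pairs) + ?a\<^sup>2) / ?a\<^sup>2"
    by (rule prob_all_far_le[OF _ a]) simp
  also have "\<dots> \<le> (((real m)\<^sup>2 * (?q\<^sup>2 + ?E) + m * (C0 * ?q)) - 2 * ?a * ?a + ?a\<^sup>2) / ?a\<^sup>2"
    using s by (intro divide_right_mono) (simp_all add: kern_expectation_same)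
  also have "\<dots> = ((real m)\<^sup>2 * ?E + m * (C0 * ?q)) / ?a\<^sup>2"
    by (simp add: power2_eq_square algebra_simps)
  also have "\<dots> = C0 / (m * ?q) + ?E / ?q\<^sup>2"
    using m q by (simp add: power2_eq_square field_simps)
  finally show ?thesis by (simp add: lessThan_def)
qed

lemma annealed_mass_le_card: "annealed_mass \<le> card I"
proof -
  have "annealed_mass \<le> (\<Sum>p\<in>I. 1)" unfolding annealed_mass_def
    by (intro sum_mono power_le_one) (use annealed_unit(1) in auto)
  then show ?thesis by simp
qed

text \<open>Among the quadruples of times, those sharing exactly one time number of order \<open>m ^ 3\<close> and those
  sharing both number \<open>m\<^sup>2\<close>. Relative to the squared mean \<open>m ^ 4 * annealed_mass\<^sup>2\<close> their
  contributions are small as soon as \<open>m\<^sup>2 * annealed_mass\<close> is large.\<close>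
lemma prob_early_late_far_le:
  fixes m :: nat
  assumes m: "m \<ge> 1" and M: "annealed_mass > 0"
  shows "measure pairs {z. \<forall>u<m. \<forall>v<m. 8 * r \<le> dist (first_orbit (u * g) z) (second_orbit ((m + v) * g) z)}
    \<le> 2 * C0 / (m * sqrt annealed_mass) + C0 / ((real m)\<^sup>2 * annealed_mass)
      + 7 * (card I)\<^sup>2 * e / annealed_mass\<^sup>2"
proof -
  let ?M = annealed_mass and ?a = "(real m)\<^sup>2 * annealed_mass"
  let ?K = "real (card I)"
  let ?B = "C0 * (annealed_mass * sqrt annealed_mass)"
  have a: "?a > 0" using m M by simp
  define A where "A = {..<m} \<times> {..<m}"
  define f where "f t = fst t * g" for t :: "nat \<times> nat"
  define h where "h t = (m + snd t) * g" for t :: "nat \<times> nat"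
  have g0: "g > 0" using gap_pos by simp
  have gap: "u = u' \<or> u * g + g \<le> u' * g \<or> u' * g + g \<le> u * g" for u u' :: nat
    by (metis Suc_leI linorder_neqE_nat mult_Suc mult_le_mono1 add.commute)
  have t: "(\<integral>z. kern (f (u, v)) (h (u, v)) z * kern (f (u', v')) (h (u', v')) z \<partial>pairs) \<le>
      (?M\<^sup>2 + 5 * ?K\<^sup>2 * e) + of_bool (u = u') * ?B + of_bool (v = v') * ?B
       + of_bool (u = u') * of_bool (v = v') * (C0 * ?M)"
    if "u < m" "u' < m" for u v u' v'
  proof -
    have o: "u * g + g \<le> (m + v) * g" if "u < m" for u v
      using that mult_le_mono1[of "Suc u" "m + v" g] by simp
    have "(\<integral>z. kern (u * g) ((m + v) * g) z * kern (u' * g) ((m + v') * g) z \<partial>pairs) \<le>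
       (\<Sum>p\<in>I. \<Sum>q\<in>I. overlap (u * g = u' * g) p q * overlap ((m + v) * g = (m + v') * g) p q)
         + 5 * (card I)\<^sup>2 * e"
      using gap[of u u'] gap[of "m + v" "m + v'"]
      by (intro kern_prod_early_late o that) auto
    also have "\<dots> = (\<Sum>p\<in>I. \<Sum>q\<in>I. overlap (u = u') p q * overlap (v = v') p q) + 5 * ?K\<^sup>2 * e"
      using g0 by simp
    also note overlap_sum_le[of "u = u'" "v = v'"]
    finally show ?thesis by (simp add: f_def h_def algebra_simps)
  qed
  have "(\<Sum>t\<in>A. \<Sum>t'\<in>A. \<integral>z. kern (f t) (h t) z * kern (f t') (h t') z \<partial>pairs) =
     (\<Sum>u<m. \<Sum>v<m. \<Sum>u'<m. \<Sum>v'<m. \<integral>z. kern (f (u, v)) (h (u, v)) z * kern (f (u', v')) (h (u', v')) z \<partial>pairs)"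
    unfolding A_def sum.cartesian_product' ..
  also have "\<dots> \<le> (\<Sum>u<m. \<Sum>v<m. \<Sum>u'<m. \<Sum>v'<m. (?M\<^sup>2 + 5 * ?K\<^sup>2 * e) + of_bool (u = u') * ?B
       + of_bool (v = v') * ?B + of_bool (u = u') * of_bool (v = v') * (C0 * ?M))"
    by (intro sum_mono t) auto
  also have "\<dots> = (real m)^4 * (?M\<^sup>2 + 5 * ?K\<^sup>2 * e) + 2 * (real m)^3 * ?B + (real m)\<^sup>2 * (C0 * ?M)"
  proof -
    have 1: "(\<Sum>u'<m. of_bool (u = u') * c) = (c::real)" if "u < m" for u c
      using that by (simp add: of_bool_def if_distrib[of "\<lambda>x. x * c"] cong: if_cong)
    have "(\<Sum>u'<m. \<Sum>v'<m. (?M\<^sup>2 + 5 * ?K\<^sup>2 * e) + of_bool (u = u') * ?B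
       + of_bool (v = v') * ?B + of_bool (u = u') * of_bool (v = v') * (C0 * ?M))
      = (real m)\<^sup>2 * (?M\<^sup>2 + 5 * ?K\<^sup>2 * e) + 2 * real m * ?B + C0 * ?M" if "u < m" "v < m" for u v
      using that by (simp add: sum.distrib 1 sum_distrib_left[symmetric] power2_eq_square algebra_simps)
    then show ?thesis by (simp add: power2_eq_square power3_eq_cube power4_eq_xxxx algebra_simps)
  qed
  finally have s: "(\<Sum>t\<in>A. \<Sum>t'\<in>A. \<integral>z. kern (f t) (h t) z * kern (f t') (h t') z \<partial>pairs)
    \<le> (real m)^4 * (?M\<^sup>2 + 5 * ?K\<^sup>2 * e) + 2 * (real m)^3 * ?B + (real m)\<^sup>2 * (C0 * ?M)" .
  have "(\<Sum>t\<in>A. ?M - ?K * e) \<le> (\<Sum>t\<in>A. \<integral>z. kern (f t) (h t) z \<partial>pairs)"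
  proof (rule sum_mono)
    fix t assume "t \<in> A"
    then have "f t + g \<le> h t"
      using mult_le_mono1[of "Suc (fst t)" "m + snd t" g] by (auto simp: A_def f_def h_def)
    then show "?M - ?K * e \<le> (\<integral>z. kern (f t) (h t) z \<partial>pairs)"
      using kern_expectation_far[of "f t" "h t"] by (simp add: abs_le_iff)
  qed
  then have l: "(real m)\<^sup>2 * (?M - ?K * e) \<le> (\<Sum>t\<in>A. \<integral>z. kern (f t) (h t) z \<partial>pairs)"
    by (simp add: A_def power2_eq_square)
  have KM: "?M * (?K * e) \<le> ?K\<^sup>2 * e"
    using mult_right_mono[OF annealed_mass_le_card, of "?K * e"] e_nonneg by (simp add: power2_eq_square)
  have "measure pairs {z. \<forall>t\<in>A. 8 * r \<le> dist (first_orbit (f t) z) (second_orbit (h t) z)}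
      \<le> ((\<Sum>t\<in>A. \<Sum>t'\<in>A. \<integral>z. kern (f t) (h t) z * kern (f t') (h t') z \<partial>pairs)
      - 2 * ?a * (\<Sum>t\<in>A. \<integral>z. kern (f t) (h t) z \<partial>pairs) + ?a\<^sup>2) / ?a\<^sup>2"
    by (rule prob_all_far_le[OF _ a]) (simp add: A_def)
  also have "\<dots> \<le> (((real m)^4 * (?M\<^sup>2 + 5 * ?K\<^sup>2 * e) + 2 * (real m)^3 * ?B + (real m)\<^sup>2 * (C0 * ?M))
      - 2 * ?a * ((real m)\<^sup>2 * (?M - ?K * e)) + ?a\<^sup>2) / ?a\<^sup>2"
    using a by (intro divide_right_mono add_right_mono diff_mono s mult_left_mono l) auto
  also have "\<dots> = ((real m)^4 * (5 * ?K\<^sup>2 * e + 2 * (?M * (?K * e))) + 2 * (real m)^3 * ?B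
      + (real m)\<^sup>2 * (C0 * ?M)) / ?a\<^sup>2"
    by (simp add: power2_eq_square power4_eq_xxxx algebra_simps)
  also have "\<dots> \<le> ((real m)^4 * (7 * ?K\<^sup>2 * e) + 2 * (real m)^3 * ?B + (real m)\<^sup>2 * (C0 * ?M)) / ?a\<^sup>2"
    using KM by (intro divide_right_mono add_right_mono mult_left_mono) (auto simp: mult.commute[of e])
  also have "\<dots> = 2 * C0 / (m * sqrt ?M) + C0 / ((real m)\<^sup>2 * ?M) + 7 * ?K\<^sup>2 * e / ?M\<^sup>2"
  proof -
    define w where "w = sqrt ?M"
    have w: "w > 0" "?M = w * w" using M by (auto simp: w_def)
    show ?thesis unfolding w_def[symmetric] unfolding w(2) using m w(1)
      by (simp add: field_simps power2_eq_square power3_eq_cube power4_eq_xxxx)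
  qed
  also have "{z. \<forall>t\<in>A. 8 * r \<le> dist (first_orbit (f t) z) (second_orbit (h t) z)} =
      {z. \<forall>u<m. \<forall>v<m. 8 * r \<le> dist (first_orbit (u * g) z) (second_orbit ((m + v) * g) z)}"
    by (auto simp: A_def f_def h_def)
  finally show ?thesis by simp
qed

end


section \<open>Probabilities in terms of correlation integrals\<close>

lemma correlation_unit:
  fixes M :: "'x::metric_space measure"
  assumes "compact (UNIV :: 'x set)" "prob_space M" "sets M = sets borel"
  shows "correlation M s \<in> {0..1}"
proof -
  interpret prob_space M by fact
  interpret MM: pair_prob_space M M ..
  show ?thesis unfolding correlation_eq[OF assms] using MM.prob_le_1 by simp
qed

lemma (in fibered_rds) correlation_fiber_measurable:
  "(\<lambda>\<omega>. correlation (\<mu> \<omega>) s) \<in> borel_measurable borel"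
  unfolding correlation_eq[OF compact_fiber prob_fiber sets_fiber]
  by (rule measurable_compose[OF measurable_pair_measure[OF kernel_subprob kernel_subprob]
        measurable_measure_subprob_algebra[OF compact_dist_less_measurable[OF compact_fiber]]])

context decorrelated_family
begin

lemma quenched_mass_bounds:
  "quenched_correlation P \<mu> r \<le> quenched_mass" "quenched_mass \<le> C0 * quenched_correlation P \<mu> (8 * r)"
proof -
  have i: "integrable P (\<lambda>\<omega>. (mean (\<phi> p) \<omega>)\<^sup>2)" for p
    unfolding power2_eq_square by (intro integral_unit(2) unit_mult Obs_unit Obs_mean) measurable
  have c: "integrable P (\<lambda>\<omega>. correlation (\<mu> \<omega>) s)" for s
    by (intro integral_unit(2) correlation_fiber_measurable correlation_unit compact_fiber prob_fiber sets_fiber)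
  have q: "quenched_mass = (\<integral>\<omega>. (\<Sum>p\<in>I. (mean (\<phi> p) \<omega>)\<^sup>2) \<partial>P)"
    unfolding quenched_mass_def using i by (simp add: Bochner_Integration.integral_sum)
  note b = correlation_bounds[OF compact_fiber prob_fiber sets_fiber, folded mean_def]
  show "quenched_correlation P \<mu> r \<le> quenched_mass"
    unfolding q quenched_correlation_def
    by (intro integral_mono Bochner_Integration.integrable_sum i c b)
  show "quenched_mass \<le> C0 * quenched_correlation P \<mu> (8 * r)"
    unfolding q quenched_correlation_def integral_mult_right_zero[symmetric]
    by (intro integral_mono Bochner_Integration.integrable_sum integrable_mult_right i c b)
qed

lemma annealed_mass_bounds:
  "correlation (fiber_marginal \<nu>) r \<le> annealed_mass"
  "annealed_mass \<le> C0 * correlation (fiber_marginal \<nu>) (8 * r)"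
  unfolding annealed_mass_def annealed_bump
  by (rule correlation_bounds[OF compact_fiber prob_fiber_marginal sets_marginal])+

end

context fibered_rds
begin

text \<open>A fiber mean of a Lipschitz function is Lipschitz in \<open>\<omega>\<close> with a norm of order \<open>L\<close>, since the measures
  \<open>\<mu> \<omega>\<close> depend on \<open>\<omega>\<close> in a Lipschitz way. The four norms in the mixing hypothesis account for
  \<open>L ^ 4\<close>.\<close>
lemma decorrelated_families:
  assumes "lipschitz_measures \<mu>" "stretched_exp_fiber_mixing \<theta> T \<mu>" "stretched_exp_4_mixing P \<theta>"
  obtains c C where "c > 0" "C > 0"
    "\<And>I \<phi> C0 L r g. bump_family I \<phi> C0 L r \<Longrightarrow> L \<ge> 1 \<Longrightarrow> g \<ge> 1 \<Longrightarrow>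
      decorrelated_family P \<nu> \<theta> T \<mu> I \<phi> C0 L r g (C * L ^ 4 * exp (- (real g powr c)))"
proof -
  obtain C1 where C1: "C1 > 0" and lm: "\<And>f \<omega> \<omega>'. is_lipschitz f \<Longrightarrow>
      \<bar>(\<integral>x. f x \<partial>\<mu> \<omega>) - (\<integral>x. f x \<partial>\<mu> \<omega>')\<bar> \<le> C1 * lip_norm f * dist \<omega> \<omega>'"
    using assms(1) unfolding lipschitz_measures_def by auto
  obtain c3 C3 where c3: "c3 > 0" "C3 > 0" and fm: "\<And>f g (n::nat) \<omega>. is_lipschitz f \<Longrightarrow> is_lipschitz g \<Longrightarrow>
      \<bar>(\<integral>x. f x * g (fiber_iter \<theta> T n \<omega> x) \<partial>\<mu> \<omega>) - (\<integral>x. f x \<partial>\<mu> \<omega>) * (\<integral>x. g x \<partial>\<mu> ((\<theta> ^^ n) \<omega>))\<bar>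
       \<le> C3 * exp (- (real n powr c3)) * lip_norm f * lip_norm g"
    using assms(2) unfolding stretched_exp_fiber_mixing_def by auto
  obtain c2 C2 where c2: "c2 > 0" "C2 > 0" and bm: "\<And>f1 f2 g1 g2 n a b c. is_lipschitz f1 \<Longrightarrow> is_lipschitz f2 \<Longrightarrow>
      is_lipschitz g1 \<Longrightarrow> is_lipschitz g2 \<Longrightarrow> a \<le> b \<Longrightarrow> b \<le> c \<Longrightarrow> n \<le> b - a \<Longrightarrow>
      \<bar>(\<integral>\<omega>. f1 \<omega> * f2 ((\<theta> ^^ a) \<omega>) * g1 ((\<theta> ^^ b) \<omega>) * g2 ((\<theta> ^^ c) \<omega>) \<partial>P)
        - (\<integral>\<omega>. f1 \<omega> * f2 ((\<theta> ^^ a) \<omega>) \<partial>P) * (\<integral>\<omega>. g1 \<omega> * g2 ((\<theta> ^^ (c - b)) \<omega>) \<partial>P)\<bar>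
       \<le> C2 * exp (- (real n powr c2)) * lip_norm f1 * lip_norm f2 * lip_norm g1 * lip_norm g2"
    using assms(3) unfolding stretched_exp_4_mixing_def by meson
  define c where "c = min c2 c3"
  define B where "B = 1 + 3 * C1"
  define C where "C = C2 * B ^ 4 + C3 * 4"
  have c: "c > 0" "c \<le> c2" "c \<le> c3" using c2 c3 by (auto simp: c_def)
  have B: "B > 0" using C1 by (simp add: B_def)
  have C: "C > 0" using c2 c3 B by (simp add: C_def add_pos_pos)
  show ?thesis
  proof (rule that[OF c(1) C])
    fix I and \<phi> :: "nat \<Rightarrow> 'x \<Rightarrow> real" and C0 L r and g :: nat
    assume bump: "bump_family I \<phi> C0 L r" and L: "L \<ge> 1" and g: "g \<ge> 1"
    interpret bump_family I \<phi> C0 L r by fact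
    let ?e = "C * L ^ 4 * exp (- (real g powr c))"
    have ex: "exp (- (real g powr c')) \<le> exp (- (real g powr c))" if "c \<le> c'" for c'
      using that g by (simp add: powr_mono)
    have mean_lip: "(C1 * (1 + K))-lipschitz_on UNIV (mean f)"
      if f: "K-lipschitz_on UNIV f" "\<And>x. f x \<in> {0..1}" for f :: "'x \<Rightarrow> real" and K
    proof (rule lipschitz_onI)
      fix \<omega> \<omega>' :: 'w
      have norm: "lip_norm f \<le> 1 + K"
      proof (rule lip_norm_le[OF f(1)])
        show "\<bar>f x\<bar> \<le> 1" for x using f(2)[of x] by auto
      qed
      have "is_lipschitz f" using f(1) by (auto simp: is_lipschitz_def)
      from lm[OF this, of \<omega> \<omega>'] have "dist (mean f \<omega>) (mean f \<omega>') \<le> C1 * lip_norm f * dist \<omega> \<omega>'"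
        by (simp add: mean_def dist_real_def)
      also have "\<dots> \<le> C1 * (1 + K) * dist \<omega> \<omega>'"
        using norm C1 by (intro mult_right_mono mult_left_mono) auto
      finally show "dist (mean f \<omega>) (mean f \<omega>') \<le> C1 * (1 + K) * dist \<omega> \<omega>'" .
    qed (use C1 f(1) in \<open>auto simp: lipschitz_on_def\<close>)
    have obs: "is_lipschitz f \<and> 0 \<le> lip_norm f \<and> lip_norm f \<le> B * L" if "f \<in> observables \<phi>" for f
    proof -
      have key: "is_lipschitz h \<and> 0 \<le> lip_norm h \<and> lip_norm h \<le> B * L"
        if h: "K-lipschitz_on UNIV h" "\<And>\<omega>. h \<omega> \<in> {0..1}" "1 + K \<le> B * L" for h :: "'w \<Rightarrow> real" and K
      proof -
        have b: "\<bar>h \<omega>\<bar> \<le> 1" for \<omega> using h(2)[of \<omega>] by auto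
        have l: "is_lipschitz h" using h(1) by (auto simp: is_lipschitz_def)
        show ?thesis using l lip_norm_nonneg[OF l b] lip_norm_le[OF h(1) b] h(3) by simp
      qed
      have BL: "1 + C1 * (1 + K) \<le> B * L" if "K \<le> 2 * L" for K
      proof -
        have "C1 * (1 + K) \<le> C1 * (3 * L)" using that C1 L by (intro mult_left_mono) auto
        moreover have "B * L = L + C1 * (3 * L)" by (simp add: B_def algebra_simps)
        ultimately show ?thesis using L by linarith
      qed
      have 0: "is_lipschitz (\<lambda>_::'w. 1::real) \<and> 0 \<le> lip_norm (\<lambda>_::'w. 1::real) \<and> lip_norm (\<lambda>_::'w. 1::real) \<le> B * L"
        by (rule key[of 0]) (use BL[of "-1"] L in \<open>auto simp: lipschitz_on_def\<close>)
      have 1: "is_lipschitz (mean (\<phi> p)) \<and> 0 \<le> lip_norm (mean (\<phi> p)) \<and> lip_norm (mean (\<phi> p)) \<le> B * L" for p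
        by (rule key[OF mean_lip[OF lip unit] mean_unit[OF bump_measurable unit]])
           (use L in \<open>simp add: BL\<close>)
      have 2: "is_lipschitz (mean (\<lambda>x. \<phi> p x * \<phi> q x)) \<and> 0 \<le> lip_norm (mean (\<lambda>x. \<phi> p x * \<phi> q x)) \<and>
          lip_norm (mean (\<lambda>x. \<phi> p x * \<phi> q x)) \<le> B * L" for p q
        by (rule key[OF mean_lip[OF lipschitz_unit_mult[OF lip unit lip unit] unit_mult[OF unit unit]]
              mean_unit[OF borel_measurable_times[OF bump_measurable bump_measurable] unit_mult[OF unit unit]]])
           (simp add: BL)
      show ?thesis using that 0 1 2 unfolding observables_def by auto
    qed
    have phi_lip: "is_lipschitz (\<phi> p)" and phi_norm: "0 \<le> lip_norm (\<phi> p)" "lip_norm (\<phi> p) \<le> 2 * L" for p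
    proof -
      show l: "is_lipschitz (\<phi> p)" using lip by (auto simp: is_lipschitz_def)
      have b: "\<bar>\<phi> p x\<bar> \<le> 1" for x by (simp add: nonneg le_one)
      show "0 \<le> lip_norm (\<phi> p)" by (rule lip_norm_nonneg[OF l b])
      show "lip_norm (\<phi> p) \<le> 2 * L" using lip_norm_le[OF lip[of p] b] L by simp
    qed
    show "decorrelated_family P \<nu> \<theta> T \<mu> I \<phi> C0 L r g ?e"
    proof (intro decorrelated_family.intro decorrelated_family_axioms.intro fibered_rds_axioms bump g)
      show "0 \<le> ?e" using C L by simp
      fix p q k \<omega> assume k: "g \<le> k"
      have "\<bar>(\<integral>x. \<phi> p x * \<phi> q (fiber_iter \<theta> T k \<omega> x) \<partial>\<mu> \<omega>) - mean (\<phi> p) \<omega> * mean (\<phi> q) ((\<theta> ^^ k) \<omega>)\<bar>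
          \<le> C3 * exp (- (real k powr c3)) * lip_norm (\<phi> p) * lip_norm (\<phi> q)"
        unfolding mean_def by (rule fm[OF phi_lip phi_lip])
      also have "\<dots> \<le> C3 * exp (- (real g powr c)) * (2 * L) * (2 * L)"
      proof (intro mult_mono phi_norm)
        have "exp (- (real k powr c3)) \<le> exp (- (real g powr c3))" using k c3 by (simp add: powr_mono2)
        also have "\<dots> \<le> exp (- (real g powr c))" by (rule ex[OF c(3)])
        finally show "exp (- (real k powr c3)) \<le> exp (- (real g powr c))" .
      qed (use c3 L phi_norm in auto)
      also have "\<dots> = C3 * 4 * L ^ 2 * exp (- (real g powr c))" by (simp add: power2_eq_square)
      also have "\<dots> \<le> ?e"
      proof (intro mult_right_mono mult_mono)
        show "C3 * 4 \<le> C" using c2 B by (simp add: C_def)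
        show "L ^ 2 \<le> L ^ 4" using L by (intro power_increasing) auto
      qed (use C L in auto)
      finally show "\<bar>(\<integral>x. \<phi> p x * \<phi> q (fiber_iter \<theta> T k \<omega> x) \<partial>\<mu> \<omega>) - mean (\<phi> p) \<omega> * mean (\<phi> q) ((\<theta> ^^ k) \<omega>)\<bar> \<le> ?e" .
    next
      fix f1 f2 g1 g2 :: "'w \<Rightarrow> real" and a b d :: nat
      assume o: "f1 \<in> observables \<phi>" "f2 \<in> observables \<phi>" "g1 \<in> observables \<phi>" "g2 \<in> observables \<phi>"
        and ord: "a \<le> b" "b \<le> d" "g \<le> b - a"
      note o' = o[THEN obs]
      have "\<bar>(\<integral>\<omega>. f1 \<omega> * f2 ((\<theta> ^^ a) \<omega>) * g1 ((\<theta> ^^ b) \<omega>) * g2 ((\<theta> ^^ d) \<omega>) \<partial>P)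
        - (\<integral>\<omega>. f1 \<omega> * f2 ((\<theta> ^^ a) \<omega>) \<partial>P) * (\<integral>\<omega>. g1 \<omega> * g2 ((\<theta> ^^ (d - b)) \<omega>) \<partial>P)\<bar>
        \<le> C2 * exp (- (real g powr c2)) * lip_norm f1 * lip_norm f2 * lip_norm g1 * lip_norm g2"
        by (rule bm) (use o' ord in auto)
      also have "\<dots> \<le> C2 * exp (- (real g powr c)) * (B * L) * (B * L) * (B * L) * (B * L)"
        using o' c2 B L by (intro mult_mono ex c) auto
      also have "\<dots> = C2 * B ^ 4 * L ^ 4 * exp (- (real g powr c))" by (simp add: power4_eq_xxxx)
      also have "\<dots> \<le> ?e"
        using c3 L by (intro mult_right_mono) (auto simp: C_def)
      finally show "\<bar>(\<integral>\<omega>. f1 \<omega> * f2 ((\<theta> ^^ a) \<omega>) * g1 ((\<theta> ^^ b) \<omega>) * g2 ((\<theta> ^^ d) \<omega>) \<partial>P)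
        - (\<integral>\<omega>. f1 \<omega> * f2 ((\<theta> ^^ a) \<omega>) \<partial>P) * (\<integral>\<omega>. g1 \<omega> * g2 ((\<theta> ^^ (d - b)) \<omega>) \<partial>P)\<bar> \<le> ?e" .
    qed
  qed
qed

definition close_pairs :: "nat \<Rightarrow> real \<Rightarrow> ('w \<times> 'x \<times> 'x) set" where
  "close_pairs n \<rho> = {z. \<exists>i<n. \<exists>j<n. dist (first_orbit i z) (second_orbit j z) < \<rho>}"

lemma close_pairs_measurable [measurable]: "close_pairs n \<rho> \<in> sets BBB"
proof -
  have "Measurable.pred BBB (\<lambda>z. \<exists>i<n. \<exists>j<n. dist (first_orbit i z) (second_orbit j z) < \<rho>)"
    by measurable
  then show ?thesis by (simp add: pred_def space_pair_measure close_pairs_def)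
qed

lemma not_close_pairs:
  "z \<in> - close_pairs n \<rho> \<Longrightarrow> i < n \<Longrightarrow> j < n \<Longrightarrow> \<rho> \<le> dist (first_orbit i z) (second_orbit j z)"
  unfolding close_pairs_def by (metis (mono_tags, lifting) ComplD CollectI not_less)

lemma far_pairs_measurable [measurable]:
  fixes A :: "'i::countable set"
  shows "{z. \<forall>i\<in>A. dist (first_orbit (f i) z) (second_orbit (h i) z) \<ge> \<rho>} \<in> sets BBB"
proof -
  have "Measurable.pred BBB (\<lambda>z. \<forall>i\<in>A. dist (first_orbit (f i) z) (second_orbit (h i) z) \<ge> \<rho>)"
    by measurable
  then show ?thesis by (simp add: pred_def space_pair_measure)
qed

text \<open>The moment bounds with all data of the bump family eliminated: the masses are compared with the
  correlation integrals, and the number of bumps and their Lipschitz constant \<open>1 / (2 * r)\<close> only enter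
  through a power of \<open>1 / r\<close> in front of the stretched exponential.\<close>
lemma close_pairs_probability:
  assumes "lipschitz_measures \<mu>" "stretched_exp_fiber_mixing \<theta> T \<mu>" "stretched_exp_4_mixing P \<theta>"
    and "bounded_local_complexity (UNIV :: 'x set)"
  obtains c K D r0 :: real and C0 :: nat where "c > 0" "K > 0" "r0 > 0"
    "\<And>r g n. 0 < r \<Longrightarrow> r < r0 \<Longrightarrow> g \<ge> 1 \<Longrightarrow> measure pairs (close_pairs n r) \<le>
      2 * real n * real g * (C0 * quenched_correlation P \<mu> (8 * r)) + (real n)\<^sup>2 *
        (C0 * correlation (fiber_marginal \<nu>) (8 * r) + K * r powr (- D) * exp (- (real g powr c)))"
    "\<And>r g n m. 0 < r \<Longrightarrow> r < r0 \<Longrightarrow> g \<ge> 1 \<Longrightarrow> m \<ge> 1 \<Longrightarrow> 2 * m * g \<le> n \<Longrightarrow>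
      quenched_correlation P \<mu> r > 0 \<Longrightarrow> measure pairs (- close_pairs n (8 * r)) \<le>
      C0 / (real m * quenched_correlation P \<mu> r)
        + 3 * (K * r powr (- D) * exp (- (real g powr c))) / (quenched_correlation P \<mu> r)\<^sup>2"
    "\<And>r g n m. 0 < r \<Longrightarrow> r < r0 \<Longrightarrow> g \<ge> 1 \<Longrightarrow> m \<ge> 1 \<Longrightarrow> 2 * m * g \<le> n \<Longrightarrow>
      correlation (fiber_marginal \<nu>) r > 0 \<Longrightarrow> measure pairs (- close_pairs n (8 * r)) \<le>
      2 * C0 / (real m * sqrt (correlation (fiber_marginal \<nu>) r))
        + C0 / ((real m)\<^sup>2 * correlation (fiber_marginal \<nu>) r)
        + 7 * (K * r powr (- D) * exp (- (real g powr c))) / (correlation (fiber_marginal \<nu>) r)\<^sup>2"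
proof -
  obtain c C where c: "c > 0" and C: "C > 0" and dec:
    "\<And>I \<phi> C0 L r g. bump_family I \<phi> C0 L r \<Longrightarrow> L \<ge> 1 \<Longrightarrow> g \<ge> 1 \<Longrightarrow>
      decorrelated_family P \<nu> \<theta> T \<mu> I \<phi> C0 L r g (C * L ^ 4 * exp (- (real g powr c)))"
    using decorrelated_families[OF assms(1-3)] by blast
  show ?thesis
  proof (rule bump_families_exist[OF assms(4)])
    fix C0 :: nat and D \<kappa> r0 :: real
    assume *: "r0 > 0" "\<kappa> > 0"
      and bumps: "\<And>r. 0 < r \<Longrightarrow> r < r0 \<Longrightarrow> \<exists>I (\<phi> :: nat \<Rightarrow> 'x \<Rightarrow> real).
        bump_family I \<phi> C0 (1 / (2 * r)) r \<and> real (card I) \<le> \<kappa> * r powr (- D)"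
    define K where "K = \<kappa>\<^sup>2 * C / 16"
    define E where "E r g = K * r powr (- (2 * D + 4)) * exp (- (real g powr c))" for r and g :: nat
    have K: "K > 0" using * C by (simp add: K_def)
    have r1: "min r0 (1 / 2) > 0" using * by simp
    have ex: "\<exists>I \<phi> e. decorrelated_family P \<nu> \<theta> T \<mu> I \<phi> C0 (1 / (2 * r)) r g e \<and> real ((card I)\<^sup>2) * e \<le> E r g"
      if r: "0 < r" "r < min r0 (1 / 2)" and g: "g \<ge> 1" for r and g :: nat
    proof -
      obtain I and \<phi> :: "nat \<Rightarrow> 'x \<Rightarrow> real" where b: "bump_family I \<phi> C0 (1 / (2 * r)) r"
        and card: "real (card I) \<le> \<kappa> * r powr (- D)"
        using bumps[of r] r by auto
      let ?e = "C * (1 / (2 * r)) ^ 4 * exp (- (real g powr c))"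
      have d: "decorrelated_family P \<nu> \<theta> T \<mu> I \<phi> C0 (1 / (2 * r)) r g ?e"
        by (rule dec[OF b _ g]) (use r in \<open>simp add: field_simps\<close>)
      have "real ((card I)\<^sup>2) * ?e \<le> (\<kappa> * r powr (- D))\<^sup>2 * ?e"
        using card C by (intro mult_right_mono) (auto intro!: power_mono)
      also have "\<dots> = E r g"
      proof -
        have "r powr (- (2 * D + 4)) = (r powr (- D))\<^sup>2 * (1 / r ^ 4)"
        proof -
          have "r powr (- (2 * D + 4)) = r powr (- D) * r powr (- D) * r powr (- 4)"
            by (simp add: powr_add[symmetric])
          also have "r powr (- 4) = 1 / r ^ 4" using r by (simp add: powr_minus_divide)
          finally show ?thesis by (simp add: power2_eq_square)
        qed
        then show ?thesis by (simp add: E_def K_def power_mult_distrib power_divide)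
      qed
      finally show ?thesis using d by blast
    qed
    show thesis
    proof (rule that[OF c K r1, of C0 "2 * D + 4"])
      fix r :: real and g n :: nat
      assume r: "0 < r" "r < min r0 (1 / 2)" and g: "g \<ge> 1"
      obtain I \<phi> e where d: "decorrelated_family P \<nu> \<theta> T \<mu> I \<phi> C0 (1 / (2 * r)) r g e"
        and eE: "real ((card I)\<^sup>2) * e \<le> E r g" using ex[OF r g] by blast
      interpret decorrelated_family P \<nu> \<theta> T \<mu> I \<phi> C0 "1 / (2 * r)" r g e by (rule d)
      have "real (card I) \<le> real ((card I)\<^sup>2)"
        by (rule of_nat_mono) (simp add: power2_eq_square)
      from mult_right_mono[OF this e_nonneg] have e1: "card I * e \<le> E r g" using eE by linarith
      have "measure pairs (close_pairs n r) \<le> 2 * real n * g * quenched_mass + (real n)\<^sup>2 * (annealed_mass + card I * e)"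
        unfolding close_pairs_def by (rule prob_close_le)
      also have "\<dots> \<le> 2 * real n * g * (C0 * quenched_correlation P \<mu> (8 * r)) +
          (real n)\<^sup>2 * (C0 * correlation (fiber_marginal \<nu>) (8 * r) + E r g)"
        by (intro add_mono mult_left_mono quenched_mass_bounds annealed_mass_bounds e1) auto
      finally show "measure pairs (close_pairs n r) \<le>
        2 * real n * real g * (C0 * quenched_correlation P \<mu> (8 * r)) + (real n)\<^sup>2 *
        (C0 * correlation (fiber_marginal \<nu>) (8 * r) + K * r powr (- (2 * D + 4)) * exp (- (real g powr c)))"
        by (simp add: E_def)
    next
      fix r :: real and g n m :: nat
      assume r: "0 < r" "r < min r0 (1 / 2)" and g: "g \<ge> 1" and m: "m \<ge> 1" "2 * m * g \<le> n"
        and pos: "quenched_correlation P \<mu> r > 0"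
      let ?Q = "quenched_correlation P \<mu> r"
      obtain I \<phi> e where d: "decorrelated_family P \<nu> \<theta> T \<mu> I \<phi> C0 (1 / (2 * r)) r g e"
        and eE: "real ((card I)\<^sup>2) * e \<le> E r g" using ex[OF r g] by blast
      interpret decorrelated_family P \<nu> \<theta> T \<mu> I \<phi> C0 "1 / (2 * r)" r g e by (rule d)
      have q: "?Q \<le> quenched_mass" by (rule quenched_mass_bounds)
      have E0: "0 \<le> E r g" using K by (simp add: E_def)
      have "measure pairs (- close_pairs n (8 * r)) \<le>
         measure pairs {z. \<forall>u\<in>{..<m}. 8 * r \<le> dist (first_orbit (u * g) z) (second_orbit (u * g) z)}"
      proof (rule pairs.finite_measure_mono)
        have "u * g < n" if "u < m" for u
        proof -
          have "u * g < m * g" using that g by simp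
          with m(2) show ?thesis by linarith
        qed
        then show "- close_pairs n (8 * r) \<subseteq>
            {z. \<forall>u\<in>{..<m}. 8 * r \<le> dist (first_orbit (u * g) z) (second_orbit (u * g) z)}"
          by (intro subsetI CollectI ballI not_close_pairs[of _ n "8 * r"]) simp_all
      qed (simp only: sets_pairs far_pairs_measurable)
      also have "\<dots> \<le> C0 / (m * quenched_mass) + 3 * (card I)\<^sup>2 * e / quenched_mass\<^sup>2"
        using prob_same_time_far_le[OF m(1)] pos q by (simp add: Ball_def)
      also have "\<dots> \<le> C0 / (m * ?Q) + 3 * E r g / ?Q\<^sup>2"
        using pos q m(1) eE E0 by (intro add_mono frac_le mult_left_mono power_mono) auto
      finally show "measure pairs (- close_pairs n (8 * r)) \<le> C0 / (real m * ?Q)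
        + 3 * (K * r powr (- (2 * D + 4)) * exp (- (real g powr c))) / ?Q\<^sup>2" by (simp add: E_def)
    next
      fix r :: real and g n m :: nat
      assume r: "0 < r" "r < min r0 (1 / 2)" and g: "g \<ge> 1" and m: "m \<ge> 1" "2 * m * g \<le> n"
        and pos: "correlation (fiber_marginal \<nu>) r > 0"
      let ?A = "correlation (fiber_marginal \<nu>) r"
      obtain I \<phi> e where d: "decorrelated_family P \<nu> \<theta> T \<mu> I \<phi> C0 (1 / (2 * r)) r g e"
        and eE: "real ((card I)\<^sup>2) * e \<le> E r g" using ex[OF r g] by blast
      interpret decorrelated_family P \<nu> \<theta> T \<mu> I \<phi> C0 "1 / (2 * r)" r g e by (rule d)
      have q: "?A \<le> annealed_mass" by (rule annealed_mass_bounds)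
      have E0: "0 \<le> E r g" using K by (simp add: E_def)
      have "measure pairs (- close_pairs n (8 * r)) \<le> measure pairs
        {z. \<forall>t\<in>{..<m} \<times> {..<m}. 8 * r \<le> dist (first_orbit (fst t * g) z) (second_orbit ((m + snd t) * g) z)}"
      proof (rule pairs.finite_measure_mono)
        have "u * g < n" "(m + u) * g < n" if "u < m" for u
        proof -
          have "(m + u) * g < (2 * m) * g" using that g by simp
          with m(2) show "(m + u) * g < n" by linarith
          then show "u * g < n" by (simp add: add_mult_distrib)
        qed
        then show "- close_pairs n (8 * r) \<subseteq>
            {z. \<forall>t\<in>{..<m} \<times> {..<m}. 8 * r \<le> dist (first_orbit (fst t * g) z) (second_orbit ((m + snd t) * g) z)}"
          by (intro subsetI CollectI ballI not_close_pairs[of _ n "8 * r"]) auto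
      qed (simp only: sets_pairs far_pairs_measurable)
      also have "\<dots> = measure pairs
        {z. \<forall>u<m. \<forall>v<m. 8 * r \<le> dist (first_orbit (u * g) z) (second_orbit ((m + v) * g) z)}"
        by (rule arg_cong[of _ _ "measure pairs"]) auto
      also have "\<dots> \<le> 2 * C0 / (m * sqrt annealed_mass) + C0 / ((real m)\<^sup>2 * annealed_mass)
          + 7 * (card I)\<^sup>2 * e / annealed_mass\<^sup>2"
        using prob_early_late_far_le[OF m(1)] pos q by simp
      also have "\<dots> \<le> 2 * C0 / (m * sqrt ?A) + C0 / ((real m)\<^sup>2 * ?A) + 7 * E r g / ?A\<^sup>2"
        using pos q m(1) eE E0
        by (intro add_mono frac_le mult_left_mono power_mono) auto
      finally show "measure pairs (- close_pairs n (8 * r)) \<le>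
        2 * C0 / (real m * sqrt ?A) + C0 / ((real m)\<^sup>2 * ?A)
        + 7 * (K * r powr (- (2 * D + 4)) * exp (- (real g powr c))) / ?A\<^sup>2" by (simp add: E_def)
    qed
  qed
qed

text \<open>Along powers of two polynomial decay becomes geometric, hence summable.\<close>
lemma eventually_not_bad:
  assumes "\<And>n. A n \<in> sets BBB" and \<delta>: "\<delta> > 0"
    and ev: "\<forall>\<^sub>F n in sequentially. measure pairs (A n) \<le> C * real n powr (- \<delta>)"
  shows "AE z in pairs. \<forall>\<^sub>F l in sequentially. z \<notin> A (2 ^ l)"
proof -
  have "filterlim (\<lambda>l. 2 ^ l :: nat) sequentially sequentially"
    by (rule filterlim_subseq) (simp add: strict_mono_def)
  from eventually_compose_filterlim[OF ev this]
  have "\<forall>\<^sub>F l in sequentially. norm (measure pairs (A (2 ^ l))) \<le> C * (2 powr (- \<delta>)) ^ l"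
    by (rule eventually_mono)
       (simp add: powr_realpow[symmetric] powr_powr powr_power mult.commute)
  moreover have "summable (\<lambda>l. C * (2 powr (- \<delta>)) ^ l)"
    using \<delta> by (intro summable_mult summable_geometric) (simp add: powr_less_one)
  ultimately have "summable (\<lambda>l. measure pairs (A (2 ^ l)))"
    by (rule summable_comparison_test_ev)
  then have "AE z in pairs. \<forall>\<^sub>F l in sequentially. z \<in> space pairs - A (2 ^ l)"
    using assms(1) by (intro borel_cantelli_AE1) (auto simp: sets_pairs less_top[symmetric])
  then show ?thesis by simp
qed

end


section \<open>Polynomial decay along suitable radii\<close>

lemma stretched_exp_negligible:
  fixes a b :: real
  assumes "b > 0"
  shows "\<forall>\<^sub>F n in sequentially. real n powr a * exp (- (real n powr b)) \<le> real n powr (-1)"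
proof -
  have "\<forall>\<^sub>F x :: real in at_top. x powr a * exp (- (x powr b)) \<le> x powr (-1)"
    using assms by real_asymp
  then show ?thesis by (rule eventually_compose_filterlim[OF _ filterlim_real_sequentially])
qed

text \<open>The choice of time scales: a gap \<open>g\<close> of order \<open>n powr \<epsilon>\<close> makes mixing errors negligible and still
  leaves room for almost \<open>n\<close> separated times. Twice as many are needed since early and late times are
  disjoint.\<close>
lemma gap_exists:
  assumes "0 < \<epsilon>" "\<epsilon> < 1"
  shows "\<forall>\<^sub>F n in sequentially. \<exists>g m :: nat. g \<ge> 1 \<and> m \<ge> 1 \<and> 2 * m * g \<le> n \<and>
    real n powr \<epsilon> \<le> g \<and> g \<le> 2 * real n powr \<epsilon> \<and> real n powr (1 - \<epsilon>) / 8 \<le> m"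
proof -
  have "filterlim (\<lambda>n. real n powr (1 - \<epsilon>)) at_top sequentially"
    using assms by real_asymp
  then have "\<forall>\<^sub>F n in sequentially. 8 \<le> real n powr (1 - \<epsilon>)"
    by (simp add: filterlim_at_top)
  then show ?thesis using eventually_ge_at_top[of 1]
  proof eventually_elim
    case (elim n)
    define g where "g = nat \<lceil>real n powr \<epsilon>\<rceil>"
    define m where "m = n div (2 * g)"
    have e1: "1 \<le> real n powr \<epsilon>" using elim assms by (simp add: ge_one_powr_ge_zero)
    have g: "real n powr \<epsilon> \<le> g" "real g \<le> real n powr \<epsilon> + 1"
      using e1 unfolding g_def by linarith+
    have g2: "g \<le> 2 * real n powr \<epsilon>" using g e1 by linarith
    have g1: "g \<ge> 1" using g e1 by linarith
    have "real n powr (1 - \<epsilon>) / 4 = real n / (4 * real n powr \<epsilon>)"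
      using elim by (simp add: powr_diff)
    also have "\<dots> \<le> real n / (2 * g)" using g1 g2 e1 elim by (intro divide_left_mono mult_pos_pos) auto
    also have "\<dots> < m + 1"
    proof -
      have "n < (m + 1) * (2 * g)" using g1 dividend_less_times_div[of "2 * g" n] by (simp add: m_def algebra_simps)
      then have "real n < real ((m + 1) * (2 * g))" by (rule less_imp_of_nat_less)
      then show ?thesis using g1 by (simp add: field_simps)
    qed
    finally have m: "real n powr (1 - \<epsilon>) / 8 \<le> m" using elim(1) by linarith
    then have "m \<ge> 1" using elim(1) by linarith
    moreover have "2 * m * g \<le> n" unfolding m_def
      by (metis div_times_less_eq_dividend mult.assoc mult.commute)
    ultimately show ?case using g g1 g2 m by blast
  qed
qed

lemma rescaled_radius_eventually:
  assumes "s > 0" "\<rho> > (0::real)" "k > 0"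
  shows "\<forall>\<^sub>F n in sequentially. 0 < k * real n powr (-s) \<and> k * real n powr (-s) < \<rho>"
proof -
  have "((\<lambda>n. k * real n powr (-s)) \<longlongrightarrow> 0) sequentially" using assms(1,3) by real_asymp
  then have "\<forall>\<^sub>F n in sequentially. k * real n powr (-s) < \<rho>" using assms(2) by (rule order_tendstoD)
  then show ?thesis using eventually_gt_at_top[of 0]
    by eventually_elim (use assms in auto)
qed

text \<open>Only upper bounds are recorded, so that the class is closed under sums and under domination.\<close>
definition poly_decay :: "(nat \<Rightarrow> real) \<Rightarrow> bool" where
  "poly_decay f \<longleftrightarrow> (\<exists>C \<delta>. \<delta> > 0 \<and> (\<forall>\<^sub>F n in sequentially. f n \<le> C * real n powr (- \<delta>)))"

lemma poly_decay_add:
  assumes "poly_decay f" "poly_decay h" shows "poly_decay (\<lambda>n. f n + h n)"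
proof -
  obtain C \<delta> C' \<delta>' where *: "\<delta> > 0" "\<forall>\<^sub>F n in sequentially. f n \<le> C * real n powr (- \<delta>)"
    "\<delta>' > 0" "\<forall>\<^sub>F n in sequentially. h n \<le> C' * real n powr (- \<delta>')"
    using assms unfolding poly_decay_def by blast
  have "\<forall>\<^sub>F n in sequentially. f n + h n \<le> (\<bar>C\<bar> + \<bar>C'\<bar>) * real n powr (- min \<delta> \<delta>')"
    using *(2,4) eventually_ge_at_top[of 1]
  proof eventually_elim
    case (elim n)
    have "C * real n powr (- \<delta>) \<le> \<bar>C\<bar> * real n powr (- min \<delta> \<delta>')"
      "C' * real n powr (- \<delta>') \<le> \<bar>C'\<bar> * real n powr (- min \<delta> \<delta>')"
      using elim(3) by (intro mult_mono powr_mono; simp)+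
    with elim show ?case by (simp add: distrib_right)
  qed
  then show ?thesis unfolding poly_decay_def using *(1,3)
    by (intro exI[of _ "\<bar>C\<bar> + \<bar>C'\<bar>"] exI[of _ "min \<delta> \<delta>'"]) auto
qed

lemma poly_decay_powr: "a < 0 \<Longrightarrow> poly_decay (\<lambda>n. C * real n powr a)"
  unfolding poly_decay_def by (intro exI[of _ C] exI[of _ "- a"]) auto

lemma poly_decay_stretched:
  assumes "b > 0" "0 \<le> C" shows "poly_decay (\<lambda>n. C * (real n powr a * exp (- (real n powr b))))"
proof -
  have "\<forall>\<^sub>F n in sequentially. C * (real n powr a * exp (- (real n powr b))) \<le> C * real n powr (- 1)"
    using stretched_exp_negligible[OF assms(1), of a]
    by (rule eventually_mono) (erule mult_left_mono[OF _ assms(2)])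
  then show ?thesis unfolding poly_decay_def by (intro exI[of _ C] exI[of _ 1]) auto
qed

lemma poly_decay_mono:
  assumes "\<forall>\<^sub>F n in sequentially. f n \<le> h n" "poly_decay h" shows "poly_decay f"
proof -
  obtain C \<delta> where *: "\<delta> > 0" "\<forall>\<^sub>F n in sequentially. h n \<le> C * real n powr (- \<delta>)"
    using assms(2) unfolding poly_decay_def by blast
  have "\<forall>\<^sub>F n in sequentially. f n \<le> C * real n powr (- \<delta>)"
    using assms(1) *(2) by eventually_elim linarith
  then show ?thesis using *(1) unfolding poly_decay_def by blast
qed

text \<open>At \<open>r = n powr (- s)\<close> the strip around the diagonal contributes the exponent \<open>1 + \<epsilon> - s * D2\<close> and the
  rest \<open>2 - s * D1\<close>; both are negative for small \<open>\<epsilon>\<close>.\<close>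
lemma first_moment_decay:
  fixes p :: "nat \<Rightarrow> real" and A Q :: "real \<Rightarrow> real" and C0 :: real
  assumes s: "s > 0" and D1: "s * D1 > 2" and D2: "s * D2 > 1" and c: "c > 0"
    and K: "K > 0" and C0: "C0 \<ge> 0" and r0: "r0 > 0"
    and A: "\<forall>\<^sub>F r in at_right 0. A r \<le> r powr D1" and Q: "\<forall>\<^sub>F r in at_right 0. Q r \<le> r powr D2"
    and p: "\<And>r g n. 0 < r \<Longrightarrow> r < r0 \<Longrightarrow> (g::nat) \<ge> 1 \<Longrightarrow> r = real n powr (- s) \<Longrightarrow> p n \<le>
      2 * real n * real g * (C0 * Q (8 * r)) +
        (real n)\<^sup>2 * (C0 * A (8 * r) + K * r powr (- D) * exp (- (real g powr c)))"
  shows "poly_decay p"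
proof -
  obtain \<rho> where \<rho>: "\<rho> > 0" "\<And>r. 0 < r \<Longrightarrow> r < \<rho> \<Longrightarrow> A r \<le> r powr D1 \<and> Q r \<le> r powr D2"
    using eventually_conj[OF A Q] unfolding eventually_at_right_field by auto
  \<comment> \<open>The gap may cost a factor \<open>n powr \<epsilon>\<close> on the diagonal, for which \<open>s * D2 > 1\<close> leaves room.\<close>
  define \<epsilon> where "\<epsilon> = min (1 / 2) ((s * D2 - 1) / 2)"
  have e: "0 < \<epsilon>" "\<epsilon> < 1" "1 + \<epsilon> - s * D2 < 0" using D2 by (auto simp: \<epsilon>_def min_def field_simps)
  have eight: "(0::real) < 8" by simp
  let ?b = "\<lambda>n. 4 * C0 * 8 powr D2 * real n powr (1 + \<epsilon> - s * D2) +
      C0 * 8 powr D1 * real n powr (2 - s * D1) +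
      K * (real n powr (2 + s * D) * exp (- (real n powr (\<epsilon> * c))))"
  have "poly_decay ?b"
    using e D1 c K by (intro poly_decay_add poly_decay_powr poly_decay_stretched) auto
  moreover have "\<forall>\<^sub>F n in sequentially. p n \<le> ?b n"
    using gap_exists[OF e(1,2)] rescaled_radius_eventually[OF s r0 zero_less_one]
      rescaled_radius_eventually[OF s \<rho>(1) eight] eventually_ge_at_top[of 1]
  proof eventually_elim
    case (elim n)
    then obtain g :: nat where g: "g \<ge> 1" "real n powr \<epsilon> \<le> g" "g \<le> 2 * real n powr \<epsilon>" by blast
    define N where "N = real n"
    have N: "N \<ge> 1" using elim by (simp add: N_def)
    let ?r = "N powr (- s)"
    have r: "0 < ?r" "?r < r0" using elim by (auto simp: N_def)
    have "A (8 * ?r) \<le> (8 * ?r) powr D1" "Q (8 * ?r) \<le> (8 * ?r) powr D2"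
      using \<rho>(2)[of "8 * ?r"] elim by (auto simp: N_def)
    then have AQ: "A (8 * ?r) \<le> 8 powr D1 * N powr (- s * D1)" "Q (8 * ?r) \<le> 8 powr D2 * N powr (- s * D2)"
      by (simp_all add: powr_mult powr_powr)
    have "p n \<le> 2 * N * real g * (C0 * Q (8 * ?r)) +
        N\<^sup>2 * (C0 * A (8 * ?r) + K * ?r powr (- D) * exp (- (real g powr c)))"
      unfolding N_def by (rule p) (use r g in \<open>auto simp: N_def\<close>)
    also have "\<dots> \<le> 2 * N * (2 * N powr \<epsilon>) * (C0 * (8 powr D2 * N powr (- s * D2))) +
        N\<^sup>2 * (C0 * (8 powr D1 * N powr (- s * D1)) + K * ?r powr (- D) * exp (- ((N powr \<epsilon>) powr c)))"
    proof (rule add_mono)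
      show "2 * N * real g * (C0 * Q (8 * ?r)) \<le> 2 * N * (2 * N powr \<epsilon>) * (C0 * (8 powr D2 * N powr (- s * D2)))"
      proof -
        have "2 * N * real g * (C0 * Q (8 * ?r)) \<le> 2 * N * real g * (C0 * (8 powr D2 * N powr (- s * D2)))"
          using AQ C0 N by (intro mult_left_mono) auto
        also have "\<dots> \<le> 2 * N * (2 * N powr \<epsilon>) * (C0 * (8 powr D2 * N powr (- s * D2)))"
          using g C0 N by (intro mult_right_mono mult_left_mono) (auto simp: N_def)
        finally show ?thesis .
      qed
      show "N\<^sup>2 * (C0 * A (8 * ?r) + K * ?r powr (- D) * exp (- (real g powr c))) \<le>
        N\<^sup>2 * (C0 * (8 powr D1 * N powr (- s * D1)) + K * ?r powr (- D) * exp (- ((N powr \<epsilon>) powr c)))"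
        using AQ C0 K g c by (intro mult_left_mono add_mono) (auto simp: N_def intro!: powr_mono2)
    qed
    also have "\<dots> = 4 * C0 * 8 powr D2 * N powr (1 + \<epsilon> - s * D2) +
      C0 * 8 powr D1 * N powr (2 - s * D1) + K * (N powr (2 + s * D) * exp (- (N powr (\<epsilon> * c))))"
    proof -
      have 1: "N powr (1 + \<epsilon> - s * D2) = N * N powr \<epsilon> * N powr (- s * D2)"
        using N by (simp add: powr_diff powr_add powr_minus divide_simps)
      have 2: "N powr (2 - s * D1) = N\<^sup>2 * N powr (- s * D1)"
        using N by (simp add: powr_diff powr_minus divide_simps)
      have 3: "N powr (2 + s * D) = N\<^sup>2 * ?r powr (- D)"
        using N by (simp add: powr_add powr_powr)
      show ?thesis unfolding 1 2 3 by (simp add: powr_powr algebra_simps)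
    qed
    finally show ?case by (simp add: N_def)
  qed
  ultimately show ?thesis by (rule poly_decay_mono[rotated])
qed

lemma radius_power:
  fixes N s d :: real
  assumes "N > 0" shows "(N powr (- s) / 8) powr d = 8 powr (- d) * N powr (- (s * d))"
proof -
  have "(N powr (- s) / 8) powr d = (N powr (- s)) powr d / 8 powr d" by (rule powr_divide)
  then show ?thesis unfolding powr_powr powr_minus_divide[of 8 d] by simp
qed

text \<open>With \<open>m\<close> of order \<open>n powr (1 - \<epsilon>)\<close> the mean, which is at least \<open>m * Q r\<close>, has order at least
  \<open>n powr (1 - \<epsilon> - s * d)\<close>, a positive power for small \<open>\<epsilon>\<close>. The radius carries the factor \<open>1 / 8\<close>
  because a nonzero kernel only forces the distance below \<open>8 * r\<close>.\<close>
lemma quenched_second_moment_decay: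
  fixes p :: "nat \<Rightarrow> real" and Q :: "real \<Rightarrow> real" and C0 :: real
  assumes s: "s > 0" and d: "s * d < 1" and c: "c > 0" and K: "K > 0" and C0: "C0 \<ge> 0" and r0: "r0 > 0"
    and Q: "\<forall>\<^sub>F r in at_right 0. r powr d \<le> Q r"
    and p: "\<And>r g n m. 0 < r \<Longrightarrow> r < r0 \<Longrightarrow> (g::nat) \<ge> 1 \<Longrightarrow> (m::nat) \<ge> 1 \<Longrightarrow> 2 * m * g \<le> n \<Longrightarrow>
      Q r > 0 \<Longrightarrow> r = real n powr (- s) / 8 \<Longrightarrow>
      p n \<le> C0 / (real m * Q r) + 3 * (K * r powr (- D) * exp (- (real g powr c))) / (Q r)\<^sup>2"
  shows "poly_decay p"
proof -
  obtain \<rho> where \<rho>: "\<rho> > 0" "\<And>r. 0 < r \<Longrightarrow> r < \<rho> \<Longrightarrow> r powr d \<le> Q r"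
    using Q unfolding eventually_at_right_field by auto
  define \<epsilon> where "\<epsilon> = min (1 / 2) ((1 - s * d) / 2)"
  have e: "0 < \<epsilon>" "\<epsilon> < 1" "\<epsilon> + s * d - 1 < 0" using d by (auto simp: \<epsilon>_def min_def field_simps)
  have eighth: "(0::real) < 1 / 8" by simp
  let ?b = "\<lambda>n. 8 * C0 * 8 powr d * real n powr (\<epsilon> + s * d - 1) +
      3 * K * 8 powr D * (8 powr d)\<^sup>2 * (real n powr (s * D + 2 * (s * d)) * exp (- (real n powr (\<epsilon> * c))))"
  have "poly_decay ?b"
    using e c K by (intro poly_decay_add poly_decay_powr poly_decay_stretched) auto
  moreover have "\<forall>\<^sub>F n in sequentially. p n \<le> ?b n"
    using gap_exists[OF e(1,2)] rescaled_radius_eventually[OF s r0 eighth]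
      rescaled_radius_eventually[OF s \<rho>(1) eighth] eventually_ge_at_top[of 1]
  proof eventually_elim
    case (elim n)
    then obtain g m :: nat where g: "g \<ge> 1" "m \<ge> 1" "2 * m * g \<le> n" "real n powr \<epsilon> \<le> g"
      "real n powr (1 - \<epsilon>) / 8 \<le> m" by blast
    define N where "N = real n"
    have N: "N \<ge> 1" using elim by (simp add: N_def)
    let ?r = "N powr (- s) / 8"
    have r: "0 < ?r" "?r < r0" using elim by (auto simp: N_def)
    define q where "q = 8 powr (- d) * N powr (- (s * d))"
    have q: "q > 0" "q \<le> Q ?r"
      using \<rho>(2)[of ?r] elim radius_power[of N s d] N by (auto simp: N_def q_def)
    define M where "M = N powr (1 - \<epsilon>) / 8"
    have M: "M > 0" "M \<le> m" using N g by (auto simp: M_def N_def)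
    have "p n \<le> C0 / (real m * Q ?r) + 3 * (K * ?r powr (- D) * exp (- (real g powr c))) / (Q ?r)\<^sup>2"
      by (rule p) (use r g q in \<open>auto simp: N_def\<close>)
    also have "\<dots> \<le> C0 / (M * q) + 3 * (K * ?r powr (- D) * exp (- ((N powr \<epsilon>) powr c))) / q\<^sup>2"
      using q M C0 K g(4) c
      by (intro add_mono frac_le mult_left_mono mult_mono power_mono) (auto simp: N_def intro!: powr_mono2)
    also have "\<dots> = 8 * C0 * 8 powr d * N powr (\<epsilon> + s * d - 1) +
      3 * K * 8 powr D * (8 powr d)\<^sup>2 * (N powr (s * D + 2 * (s * d)) * exp (- (N powr (\<epsilon> * c))))"
    proof -
      have 1: "1 / (M * q) = 8 * 8 powr d * N powr (\<epsilon> + s * d - 1)"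
        unfolding M_def q_def using N by (simp add: powr_diff powr_add powr_minus divide_simps)
      have 2: "?r powr (- D) = 8 powr D * N powr (s * D)"
        using radius_power[of N s "- D"] N by simp
      have 3: "1 / q\<^sup>2 = (8 powr d)\<^sup>2 * N powr (2 * (s * d))"
        unfolding q_def mult_2 powr_add using N by (simp add: powr_minus divide_simps power2_eq_square)
      have "C0 / (M * q) + 3 * (K * ?r powr (- D) * exp (- ((N powr \<epsilon>) powr c))) / q\<^sup>2 =
        C0 * (1 / (M * q)) + 3 * (K * ?r powr (- D) * exp (- ((N powr \<epsilon>) powr c))) * (1 / q\<^sup>2)" by simp
      then show ?thesis unfolding 1 2 3 by (simp add: powr_powr powr_add algebra_simps)
    qed
    finally show ?case by (simp add: N_def)
  qed
  ultimately show ?thesis by (rule poly_decay_mono[rotated])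
qed

text \<open>Here the relevant quantity is \<open>m * sqrt (A r)\<close>, of order at least \<open>n powr (1 - \<epsilon> - s * d / 2)\<close>.\<close>
lemma annealed_second_moment_decay:
  fixes p :: "nat \<Rightarrow> real" and A :: "real \<Rightarrow> real" and C0 :: real
  assumes s: "s > 0" and d: "s * d < 2" and c: "c > 0" and K: "K > 0" and C0: "C0 \<ge> 0" and r0: "r0 > 0"
    and A: "\<forall>\<^sub>F r in at_right 0. r powr d \<le> A r"
    and p: "\<And>r g n m. 0 < r \<Longrightarrow> r < r0 \<Longrightarrow> (g::nat) \<ge> 1 \<Longrightarrow> (m::nat) \<ge> 1 \<Longrightarrow> 2 * m * g \<le> n \<Longrightarrow>
      A r > 0 \<Longrightarrow> r = real n powr (- s) / 8 \<Longrightarrow>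
      p n \<le> 2 * C0 / (real m * sqrt (A r)) + C0 / ((real m)\<^sup>2 * A r)
        + 7 * (K * r powr (- D) * exp (- (real g powr c))) / (A r)\<^sup>2"
  shows "poly_decay p"
proof -
  obtain \<rho> where \<rho>: "\<rho> > 0" "\<And>r. 0 < r \<Longrightarrow> r < \<rho> \<Longrightarrow> r powr d \<le> A r"
    using A unfolding eventually_at_right_field by auto
  define \<epsilon> where "\<epsilon> = min (1 / 2) ((2 - s * d) / 4)"
  have e: "0 < \<epsilon>" "\<epsilon> < 1" "\<epsilon> + s * d / 2 - 1 < 0" using d by (auto simp: \<epsilon>_def min_def field_simps)
  \<comment> \<open>The constants from \<open>m \<ge> n powr (1 - \<epsilon>) / 8\<close> and \<open>r = n powr (- s) / 8\<close>.\<close>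
  define B where "B = 8 * 8 powr (d / 2)"
  have eighth: "(0::real) < 1 / 8" by simp
  let ?b = "\<lambda>n. 2 * C0 * B * real n powr (\<epsilon> + s * d / 2 - 1) + C0 * B\<^sup>2 * real n powr (2 * (\<epsilon> + s * d / 2 - 1)) +
      7 * K * 8 powr D * (8 powr d)\<^sup>2 * (real n powr (s * D + 2 * (s * d)) * exp (- (real n powr (\<epsilon> * c))))"
  have "poly_decay ?b"
    using e c K by (intro poly_decay_add poly_decay_powr poly_decay_stretched) auto
  moreover have "\<forall>\<^sub>F n in sequentially. p n \<le> ?b n"
    using gap_exists[OF e(1,2)] rescaled_radius_eventually[OF s r0 eighth]
      rescaled_radius_eventually[OF s \<rho>(1) eighth] eventually_ge_at_top[of 1]
  proof eventually_elim
    case (elim n)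
    then obtain g m :: nat where g: "g \<ge> 1" "m \<ge> 1" "2 * m * g \<le> n" "real n powr \<epsilon> \<le> g"
      "real n powr (1 - \<epsilon>) / 8 \<le> m" by blast
    define N where "N = real n"
    have N: "N \<ge> 1" using elim by (simp add: N_def)
    let ?r = "N powr (- s) / 8"
    have r: "0 < ?r" "?r < r0" using elim by (auto simp: N_def)
    define w where "w = 8 powr (- (d / 2)) * N powr (- (s * d / 2))"
    have w2: "w\<^sup>2 = 8 powr (- d) * N powr (- (s * d))"
    proof -
      have h: "x powr (- (a / 2)) * x powr (- (a / 2)) = x powr (- a)" for x a :: real
        by (simp add: powr_add[symmetric])
      have "w\<^sup>2 = (8 powr (- (d / 2)) * 8 powr (- (d / 2))) * (N powr (- (s * d / 2)) * N powr (- (s * d / 2)))"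
        unfolding w_def by (simp only: power2_eq_square mult_ac)
      then show ?thesis unfolding h .
    qed
    have w: "w > 0" "w\<^sup>2 \<le> A ?r"
      using \<rho>(2)[of ?r] elim radius_power[of N s d] N by (auto simp: w2) (auto simp: N_def w_def)
    have ws: "w \<le> sqrt (A ?r)" using w by (intro real_le_rsqrt) auto
    have Apos: "A ?r > 0" using w by (meson less_le_trans zero_less_power)
    define M where "M = N powr (1 - \<epsilon>) / 8"
    have M: "M > 0" "M \<le> m" using N g by (auto simp: M_def N_def)
    have "p n \<le> 2 * C0 / (real m * sqrt (A ?r)) + C0 / ((real m)\<^sup>2 * A ?r)
        + 7 * (K * ?r powr (- D) * exp (- (real g powr c))) / (A ?r)\<^sup>2"
      by (rule p) (use r g Apos in \<open>auto simp: N_def\<close>)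
    also have "\<dots> \<le> 2 * C0 / (M * w) + C0 / (M\<^sup>2 * w\<^sup>2)
        + 7 * (K * ?r powr (- D) * exp (- ((N powr \<epsilon>) powr c))) / (w\<^sup>2)\<^sup>2"
    proof (intro add_mono)
      show "2 * C0 / (real m * sqrt (A ?r)) \<le> 2 * C0 / (M * w)"
        using ws w M C0 Apos by (intro frac_le mult_mono) auto
      show "C0 / ((real m)\<^sup>2 * A ?r) \<le> C0 / (M\<^sup>2 * w\<^sup>2)"
        using w M C0 Apos by (intro frac_le mult_mono power_mono) auto
      have "exp (- (real g powr c)) \<le> exp (- ((N powr \<epsilon>) powr c))"
        using g(4) c by (auto simp: N_def intro!: powr_mono2)
      then show "7 * (K * ?r powr (- D) * exp (- (real g powr c))) / (A ?r)\<^sup>2 \<le>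
          7 * (K * ?r powr (- D) * exp (- ((N powr \<epsilon>) powr c))) / (w\<^sup>2)\<^sup>2"
        using w K by (intro frac_le mult_left_mono power_mono) auto
    qed
    also have "\<dots> = 2 * C0 * B * N powr (\<epsilon> + s * d / 2 - 1) + C0 * B\<^sup>2 * N powr (2 * (\<epsilon> + s * d / 2 - 1)) +
      7 * K * 8 powr D * (8 powr d)\<^sup>2 * (N powr (s * D + 2 * (s * d)) * exp (- (N powr (\<epsilon> * c))))"
    proof -
      have 1: "1 / (M * w) = B * N powr (\<epsilon> + s * d / 2 - 1)"
      proof -
        have "\<epsilon> + s * d / 2 - 1 = s * d / 2 - (1 - \<epsilon>)" by simp
        then have "N powr (\<epsilon> + s * d / 2 - 1) = N powr (s * d / 2) / N powr (1 - \<epsilon>)"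
          by (simp only: powr_diff)
        moreover have "1 / (x / 8 * (1 / y * (1 / z))) = 8 * y * (z / x)" for x y z :: real
          by simp
        ultimately show ?thesis
          unfolding M_def w_def B_def powr_minus_divide[of 8 "d / 2"] powr_minus_divide[of N "s * d / 2"]
          by simp
      qed
      have 2: "?r powr (- D) = 8 powr D * N powr (s * D)"
        using radius_power[of N s "- D"] N by simp
      have 3: "1 / (w\<^sup>2)\<^sup>2 = (8 powr d)\<^sup>2 * N powr (2 * (s * d))"
        unfolding w2 mult_2 powr_add using N by (simp add: powr_minus divide_simps power2_eq_square)
      have 4: "1 / (M\<^sup>2 * w\<^sup>2) = B\<^sup>2 * N powr (2 * (\<epsilon> + s * d / 2 - 1))"
      proof -
        have "1 / (M\<^sup>2 * w\<^sup>2) = (1 / (M * w))\<^sup>2" by (simp add: power_mult_distrib power_divide)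
        then show ?thesis unfolding 1 mult_2 powr_add by (simp add: power_mult_distrib power2_eq_square)
      qed
      have 5: "N powr (s * D + 2 * (s * d)) = N powr (s * D) * N powr (2 * (s * d))" by (rule powr_add)
      have eq: "2 * C0 / (M * w) + C0 / (M\<^sup>2 * w\<^sup>2) + 7 * (K * ?r powr (- D) * exp (- ((N powr \<epsilon>) powr c))) / (w\<^sup>2)\<^sup>2 =
        2 * C0 * (1 / (M * w)) + C0 * (1 / (M\<^sup>2 * w\<^sup>2)) +
        7 * (K * ?r powr (- D) * exp (- ((N powr \<epsilon>) powr c))) * (1 / (w\<^sup>2)\<^sup>2)" by simp
      show ?thesis unfolding eq unfolding 1 2 3 4 5 powr_powr by (simp only: mult_ac)
    qed
    finally show ?case by (simp add: N_def)
  qed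
  ultimately show ?thesis by (rule poly_decay_mono[rotated])
qed

section \<open>Correlation dimensions and logarithmic rates\<close>

lemma Liminf_dimension:
  fixes f :: "real \<Rightarrow> real"
  assumes "Liminf (at_right 0) (\<lambda>r. elog (f r) / ereal (ln r)) = D" "ereal D1 < D" "\<And>r. f r \<ge> 0"
  shows "\<forall>\<^sub>F r in at_right 0. f r \<le> r powr D1"
proof -
  have "\<forall>\<^sub>F r in at_right 0. ereal D1 < elog (f r) / ereal (ln r)"
    by (rule less_LiminfD) (use assms in simp)
  moreover have "\<forall>\<^sub>F r in at_right 0. 0 < r \<and> r < (1::real)"
    unfolding eventually_at_right_field by (intro exI[of _ 1]) auto
  ultimately show ?thesis
  proof eventually_elim
    case (elim r)
    show ?case
    proof (cases "f r = 0")
      case False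
      then have f: "f r > 0" using assms(3)[of r] by simp
      have "ln r < 0" using elim by simp
      then have "D1 < ln (f r) / ln r" using elim(1) False by (simp add: elog_def)
      then have "ln (f r) < D1 * ln r" using \<open>ln r < 0\<close> by (simp add: neg_less_divide_eq)
      then have "exp (ln (f r)) \<le> exp (D1 * ln r)" by simp
      then show ?thesis using f elim by (simp add: powr_def)
    qed simp
  qed
qed

lemma Limsup_dimension:
  fixes f :: "real \<Rightarrow> real"
  assumes "Limsup (at_right 0) (\<lambda>r. elog (f r) / ereal (ln r)) = D" "D < ereal D2" "\<And>r. f r \<ge> 0"
  shows "\<forall>\<^sub>F r in at_right 0. r powr D2 \<le> f r"
proof -
  have "\<forall>\<^sub>F r in at_right 0. elog (f r) / ereal (ln r) < ereal D2"
    by (rule Limsup_lessD) (use assms in simp)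
  moreover have "\<forall>\<^sub>F r in at_right 0. 0 < r \<and> r < (1::real)"
    unfolding eventually_at_right_field by (intro exI[of _ 1]) auto
  ultimately show ?thesis
  proof eventually_elim
    case (elim r)
    have l: "ln r < 0" using elim by simp
    show ?case
    proof (cases "f r = 0")
      case False
      then have f: "f r > 0" using assms(3)[of r] by simp
      have "ln (f r) / ln r < D2" using elim(1) False l by (simp add: elog_def)
      then have "D2 * ln r < ln (f r)" using l by (simp add: neg_divide_less_eq)
      then have "exp (D2 * ln r) \<le> exp (ln (f r))" by simp
      then show ?thesis using f elim by (simp add: powr_def)
    next
      case True
      then have "elog (f r) / ereal (ln r) = \<infinity>" using l by (simp add: elog_def divide_ereal_def)
      then show ?thesis using elim(1) by simp
    qed
  qed
qed

lemma Limsup_dimension_nonneg: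
  fixes f :: "real \<Rightarrow> real"
  assumes "Limsup (at_right 0) (\<lambda>r. elog (f r) / ereal (ln r)) = D" "\<And>r. f r \<in> {0..1}"
  shows "0 \<le> D"
proof (rule ccontr)
  assume "\<not> 0 \<le> D"
  then have "D < 0" by simp
  from ereal_dense2[OF this] obtain d where d: "D < ereal d" "ereal d < 0" by blast
  have f0: "f r \<ge> 0" for r using assms(2)[of r] by simp
  have "\<forall>\<^sub>F r in at_right 0. r powr d \<le> f r" by (rule Limsup_dimension[OF assms(1) d(1) f0])
  moreover have "\<forall>\<^sub>F r in at_right 0. 0 < r \<and> r < (1::real)"
    unfolding eventually_at_right_field by (intro exI[of _ 1]) auto
  ultimately have "\<forall>\<^sub>F r in at_right (0::real). False"
  proof eventually_elim
    case (elim r)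
    have "1 < r powr d" using elim d(2) powr_less_mono'[of r d 0] by simp
    then show False using elim(1) assms(2)[of r] by simp
  qed
  then show False by simp
qed

text \<open>For \<open>D = 0\<close> the quotient is infinite, so the hypothesis excludes this case.\<close>
lemma rate_above:
  assumes "0 \<le> D" "ereal k / D < ereal s" "k > 0" "s > 0"
  obtains d where "ereal d < D" "k < s * d"
proof (cases D)
  case (real d)
  have "d \<noteq> 0" using assms(2,3) real by (auto simp: zero_ereal_def[symmetric] divide_ereal_def)
  then have "d > 0" using assms(1) real by simp
  then have "k / s < d" using assms real by (simp add: field_simps)
  then show ?thesis
    using that[of "(k / s + d) / 2"] real assms(4) by (simp add: field_simps)
next
  case PInf
  then show ?thesis using that[of "k / s + 1"] assms(4) by (simp add: field_simps)
qed (use assms(1) in auto)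

text \<open>For \<open>D = \<infinity>\<close> the quotient is 0, so the hypothesis excludes this case.\<close>
lemma rate_below:
  assumes "0 \<le> D" "ereal s < ereal k / D" "k > 0" "s > 0"
  obtains d where "D < ereal d" "s * d < k"
proof (cases D)
  case (real d)
  have "d < k / s"
  proof (cases "d = 0")
    case True
    then show ?thesis using assms by simp
  next
    case False
    then have "d > 0" using assms(1) real by simp
    then show ?thesis using assms real by (simp add: field_simps)
  qed
  then show ?thesis
    using that[of "(k / s + d) / 2"] real assms(4) by (simp add: field_simps)
next
  case PInf
  then show ?thesis using assms by simp
qed (use assms(1) in auto)

lemma power_of_two_below:
  assumes "n \<ge> (1::nat)" obtains l where "2 ^ l \<le> n" "n < 2 ^ Suc l"
  using ex_power_ivl1[of 2 n] assms by auto

lemma eventually_power_of_two: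
  assumes "\<forall>\<^sub>F l in sequentially. Pr l"
    "\<And>n l. 2 ^ l \<le> n \<Longrightarrow> n < 2 ^ Suc l \<Longrightarrow> Pr l \<Longrightarrow> Pr (Suc l) \<Longrightarrow> R n"
  shows "\<forall>\<^sub>F n::nat in sequentially. R n"
proof -
  obtain N where N: "\<And>l. N \<le> l \<Longrightarrow> Pr l" using assms(1) by (auto simp: eventually_sequentially)
  show ?thesis unfolding eventually_sequentially
  proof (intro exI allI impI)
    fix n :: nat assume n: "2 ^ N \<le> n"
    then have "n \<ge> 1" using one_le_power[of "2::nat" N] by linarith
    then obtain l where l: "2 ^ l \<le> n" "n < 2 ^ Suc l" by (rule power_of_two_below)
    have "(2::nat) ^ N < 2 ^ Suc l" using n l by linarith
    then have "N \<le> l" by (simp only: power_strict_increasing_iff one_less_numeral_iff semiring_norm less_Suc_eq_le)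
    then show "R n" using N[of l] N[of "Suc l"] l by (intro assms(2)) auto
  qed
qed

lemma powr_gap:
  assumes "s < (s' :: real)" shows "\<forall>\<^sub>F n in sequentially. C * real n powr (- s') \<le> real n powr (- s)"
proof -
  have "\<forall>\<^sub>F x :: real in at_top. C * x powr (- s') \<le> x powr (- s)" using assms by real_asymp
  then show ?thesis by (rule eventually_compose_filterlim[OF _ filterlim_real_sequentially])
qed

lemma elog_quotient_ge:
  assumes "n \<ge> 2" "0 \<le> d" "d \<le> real n powr (- s)"
  shows "ereal s \<le> - elog d / ereal (ln (real n))"
proof (cases "d = 0")
  case True
  then show ?thesis using assms(1) by (simp add: elog_def divide_ereal_def)
next
  case False
  have l: "ln (real n) > 0" using assms(1) by simp
  have "ln d \<le> ln (real n powr (- s))" using assms False by (intro ln_mono) auto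
  then have "s * ln (real n) \<le> - ln d" using assms(1) by (simp add: ln_powr)
  then have "s \<le> - ln d / ln (real n)" using l by (simp only: pos_le_divide_eq)
  then show ?thesis using False l by (simp add: elog_def)
qed

lemma elog_quotient_le:
  assumes "n \<ge> 2" "real n powr (- s) \<le> d"
  shows "- elog d / ereal (ln (real n)) \<le> ereal s"
proof -
  have d: "d > 0" using assms by (intro less_le_trans[OF _ assms(2)]) auto
  have l: "ln (real n) > 0" using assms(1) by simp
  have "ln (real n powr (- s)) \<le> ln d" using assms d by (intro ln_mono) auto
  then have "- ln d \<le> s * ln (real n)" using assms(1) by (simp add: ln_powr)
  then have "- ln d / ln (real n) \<le> s" using l by (simp only: pos_divide_le_eq)
  then show ?thesis using d l by (simp add: elog_def)
qed

lemma ereal_rational_between: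
  assumes "a < (b :: ereal)" obtains q where "q \<in> \<rat>" "a < ereal q" "ereal q < b"
proof -
  obtain u where u: "a < ereal u" "ereal u < b" using ereal_dense2[OF assms] by blast
  obtain v where v: "ereal u < ereal v" "ereal v < b" using ereal_dense2[OF u(2)] by blast
  obtain q where "q \<in> \<rat>" "u < q" "q < v" using Rats_dense_in_real[of u v] v(1) by auto
  then show ?thesis
    using u(1) v(2) less_trans[of a "ereal u" "ereal q"] less_trans[of "ereal q" "ereal v" b]
    by (intro that[of q]) simp_all
qed

text \<open>Monotonicity fills in the times between consecutive powers of two.\<close>
lemma log_rate_limit:
  fixes d :: "nat \<Rightarrow> real" and m :: ereal
  assumes nn: "\<And>n. n \<ge> 1 \<Longrightarrow> 0 \<le> d n" and anti: "\<And>n n'. 1 \<le> n \<Longrightarrow> n \<le> n' \<Longrightarrow> d n' \<le> d n"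
    and m: "0 \<le> m"
    and up: "\<And>s. s \<in> \<rat> \<Longrightarrow> 0 < s \<Longrightarrow> m < ereal s \<Longrightarrow> \<forall>\<^sub>F l in sequentially. \<not> d (2 ^ l) < real (2 ^ l) powr (- s)"
    and lo: "\<And>s. s \<in> \<rat> \<Longrightarrow> 0 < s \<Longrightarrow> ereal s < m \<Longrightarrow> \<forall>\<^sub>F l in sequentially. d (2 ^ l) < real (2 ^ l) powr (- s)"
  shows "(\<lambda>n. - elog (d n) / ereal (ln (real n))) \<longlonglongrightarrow> m"
proof (rule order_tendstoI)
  fix a assume a: "a < m"
  have "\<exists>s. a < ereal s \<and> (\<forall>\<^sub>F n in sequentially. d n \<le> real n powr (- s))"
  proof (cases "a < 0")
    case True
    then obtain s where s: "a < ereal s" "ereal s < 0" using ereal_dense2 by blast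
    have "\<forall>\<^sub>F n in sequentially. d 1 * real n powr (- 0) \<le> real n powr (- s)" using s by (intro powr_gap) simp
    then have "\<forall>\<^sub>F n in sequentially. d n \<le> real n powr (- s)" using eventually_ge_at_top[of 1]
    proof eventually_elim
      case (elim n)
      then show ?case using anti[of 1 n] by simp
    qed
    with s show ?thesis by blast
  next
    case False
    obtain s where s: "a < ereal s" "ereal s < m" using ereal_dense2[OF a] by blast
    obtain s' where s': "s' \<in> \<rat>" "ereal s < ereal s'" "ereal s' < m" using ereal_rational_between[OF s(2)] by blast
    have "0 < s" using False s(1) by (metis ereal_less(2) le_less_trans not_less)
    then have s'0: "0 < s'" using s' by simp
    have "\<forall>\<^sub>F n in sequentially. d n \<le> 2 powr s' * real n powr (- s')"
    proof (rule eventually_power_of_two[OF lo[OF s'(1) s'0 s'(3)]])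
      fix n l :: nat assume l: "2 ^ l \<le> n" "n < 2 ^ Suc l" and dl: "d (2 ^ l) < real (2 ^ l) powr (- s')"
      have n: "real n > 0" using l(1) by (metis less_le_trans of_nat_0_less_iff zero_less_numeral zero_less_power)
      have "d n \<le> d (2 ^ l)" using l by (intro anti) auto
      also have "\<dots> \<le> real (2 ^ l) powr (- s')" using dl by simp
      also have "\<dots> \<le> (real n / 2) powr (- s')"
      proof (rule powr_mono2')
        have "real n \<le> real (2 ^ Suc l)" using l(2) by (intro of_nat_mono) simp
        then show "real n / 2 \<le> real (2 ^ l)" by simp
      qed (use n s'0 in auto)
      also have "\<dots> = 2 powr s' * real n powr (- s')" using n by (simp add: powr_divide powr_minus divide_simps)
      finally show "d n \<le> 2 powr s' * real n powr (- s')" .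
    qed
    moreover have "\<forall>\<^sub>F n in sequentially. 2 powr s' * real n powr (- s') \<le> real n powr (- s)"
      using s' by (intro powr_gap) simp
    ultimately have "\<forall>\<^sub>F n in sequentially. d n \<le> real n powr (- s)" by eventually_elim linarith
    with s show ?thesis by blast
  qed
  then obtain s where s: "a < ereal s" "\<forall>\<^sub>F n in sequentially. d n \<le> real n powr (- s)" by blast
  show "\<forall>\<^sub>F n in sequentially. a < - elog (d n) / ereal (ln (real n))"
    using s(2) eventually_ge_at_top[of 2]
    by eventually_elim (rule less_le_trans[OF s(1)], rule elog_quotient_ge, auto intro: nn)
next
  fix a assume a: "m < a"
  obtain s where s: "m < ereal s" "ereal s < a" using ereal_dense2[OF a] by blast
  obtain s' where s': "s' \<in> \<rat>" "m < ereal s'" "ereal s' < ereal s" using ereal_rational_between[OF s(1)] by blast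
  have s'0: "0 < s'" using m s'(2) by (metis ereal_less(2) le_less_trans)
  have "\<forall>\<^sub>F n in sequentially. 2 powr (- s') * real n powr (- s') \<le> d n"
  proof (rule eventually_power_of_two[OF up[OF s'(1) s'0 s'(2)]])
    fix n l :: nat assume l: "2 ^ l \<le> n" "n < 2 ^ Suc l"
      and dl: "\<not> d (2 ^ Suc l) < real (2 ^ Suc l) powr (- s')"
    have n: "n \<ge> 1" using l(1) by (metis le_trans one_le_numeral one_le_power)
    have "2 powr (- s') * real n powr (- s') = (2 * real n) powr (- s')" by (simp add: powr_mult)
    also have "\<dots> \<le> real (2 ^ Suc l) powr (- s')"
    proof (rule powr_mono2')
      have "real (2 ^ l) \<le> real n" using l(1) by (rule of_nat_mono)
      then show "real (2 ^ Suc l) \<le> 2 * real n" by simp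
    qed (use s'0 in auto)
    also have "\<dots> \<le> d (2 ^ Suc l)" using dl by simp
    also have "\<dots> \<le> d n" using l n by (intro anti) auto
    finally show "2 powr (- s') * real n powr (- s') \<le> d n" .
  qed
  moreover have "\<forall>\<^sub>F n in sequentially. 2 powr s' * real n powr (- s) \<le> real n powr (- s')"
    using s' by (intro powr_gap) simp
  ultimately have "\<forall>\<^sub>F n in sequentially. real n powr (- s) \<le> d n"
  proof eventually_elim
    case (elim n)
    have "real n powr (- s) = 2 powr (- s') * (2 powr s' * real n powr (- s))"
      by (simp add: mult.assoc[symmetric] powr_add[symmetric])
    also have "\<dots> \<le> 2 powr (- s') * real n powr (- s')" using elim(2) by (intro mult_left_mono) auto
    finally show ?case using elim(1) by linarith
  qed
  then show "\<forall>\<^sub>F n in sequentially. - elog (d n) / ereal (ln (real n)) < a"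
    using eventually_ge_at_top[of 2]
    by eventually_elim (rule le_less_trans[OF _ s(2)], rule elog_quotient_le, auto)
qed


section \<open>The minimal distance between two orbits\<close>

lemma min_orbit_dist_eq:
  "min_orbit_dist \<theta> T \<omega> n x y =
    Min ((\<lambda>(i, j). dist (fiber_iter \<theta> T i \<omega> x) (fiber_iter \<theta> T j \<omega> y)) ` ({..<n} \<times> {..<n}))"
  unfolding min_orbit_dist_def by (rule arg_cong[of _ _ Min]) auto

lemma min_orbit_dist_less_iff:
  assumes "n \<ge> 1"
  shows "min_orbit_dist \<theta> T \<omega> n x y < \<rho> \<longleftrightarrow>
    (\<exists>i<n. \<exists>j<n. dist (fiber_iter \<theta> T i \<omega> x) (fiber_iter \<theta> T j \<omega> y) < \<rho>)"
  unfolding min_orbit_dist_eq by (subst Min_less_iff) (use assms in \<open>auto simp: lessThan_empty_iff\<close>)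

lemma min_orbit_dist_nonneg:
  assumes "n \<ge> 1" shows "0 \<le> min_orbit_dist \<theta> T \<omega> n x y"
  using min_orbit_dist_less_iff[OF assms, of \<theta> T \<omega> x y 0] by (auto simp: not_less[symmetric])

lemma min_orbit_dist_antimono:
  assumes "1 \<le> n" "n \<le> n'" shows "min_orbit_dist \<theta> T \<omega> n' x y \<le> min_orbit_dist \<theta> T \<omega> n x y"
  unfolding min_orbit_dist_eq
  by (rule Min_antimono) (use assms in \<open>auto simp: lessThan_empty_iff\<close>)

text \<open>The base map is a factor of the skew product, so it inherits its Lipschitz constant.\<close>
lemma continuous_base_of_skew_product:
  fixes \<theta> :: "'w::metric_space \<Rightarrow> 'w" and T :: "'w \<Rightarrow> 'x::metric_space \<Rightarrow> 'x"
  assumes "is_lipschitz (skew_product \<theta> T)"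
  shows "continuous_on UNIV \<theta>"
proof -
  obtain L where L: "L-lipschitz_on UNIV (skew_product \<theta> T)"
    using assms unfolding is_lipschitz_def by blast
  have "L-lipschitz_on UNIV \<theta>"
  proof (rule lipschitz_onI)
    fix \<omega> \<omega>' :: 'w
    have "dist (\<theta> \<omega>) (\<theta> \<omega>') \<le> dist (skew_product \<theta> T (\<omega>, undefined)) (skew_product \<theta> T (\<omega>', undefined))"
      using dist_fst_le[of "skew_product \<theta> T (\<omega>, undefined)" "skew_product \<theta> T (\<omega>', undefined)"]
      by (simp add: skew_product_def)
    also have "\<dots> \<le> L * dist (\<omega>, undefined :: 'x) (\<omega>', undefined)" by (rule lipschitz_onD[OF L]) auto
    finally show "dist (\<theta> \<omega>) (\<theta> \<omega>') \<le> L * dist \<omega> \<omega>'" by (simp add: dist_Pair_Pair)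
  qed (use L in \<open>simp add: lipschitz_on_def\<close>)
  then show ?thesis by (rule lipschitz_on_continuous_on)
qed

lemma (in fibered_rds) quenched_correlation_unit: "quenched_correlation P \<mu> s \<in> {0..1}"
  unfolding quenched_correlation_def
  by (intro integral_unit(1) correlation_fiber_measurable correlation_unit compact_fiber prob_fiber sets_fiber)

lemma (in fibered_rds) annealed_correlation_unit: "correlation (fiber_marginal \<nu>) s \<in> {0..1}"
  by (rule correlation_unit[OF compact_fiber prob_fiber_marginal]) (simp add: fiber_marginal_def)

lemma (in fibered_rds) eventually_not_bad_fiber:
  assumes A: "\<And>n. A n \<in> sets BBB" and p: "poly_decay (\<lambda>n. measure pairs (A n))"
  shows "AE \<omega> in P. AE z in \<mu> \<omega> \<Otimes>\<^sub>M \<mu> \<omega>. \<forall>\<^sub>F l in sequentially. (\<omega>, z) \<notin> A (2 ^ l)"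
proof (rule AE_pairs)
  note [measurable] = A
  show "Measurable.pred BBB (\<lambda>z. \<forall>\<^sub>F l in sequentially. z \<notin> A (2 ^ l))"
    unfolding eventually_sequentially by measurable
  obtain C \<delta> where "\<delta> > 0" "\<forall>\<^sub>F n in sequentially. measure pairs (A n) \<le> C * real n powr (- \<delta>)"
    using p unfolding poly_decay_def by blast
  from eventually_not_bad[OF A this] show "AE z in pairs. \<forall>\<^sub>F l in sequentially. z \<notin> A (2 ^ l)" .
qed

theorem theorem1p1:
  fixes P :: "'w::metric_space measure"
    and \<nu> :: "('w \<times> 'x::metric_space) measure"
    and \<theta> :: "'w \<Rightarrow> 'w"
    and T :: "'w \<Rightarrow> 'x \<Rightarrow> 'x"
    and \<mu> :: "'w \<Rightarrow> 'x measure"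
    and D2_an D2_qu :: ereal
  assumes "compact (UNIV :: 'x set)"
    and "bounded_local_complexity (UNIV :: 'x set)"
    and "random_dynamical_system P \<nu> \<theta> T"
    and "disintegration P \<nu> \<mu>"
    and "lower_D2_an \<nu> = D2_an" and "upper_D2_an \<nu> = D2_an"
    and "lower_D2_qu P \<mu> = D2_qu" and "upper_D2_qu P \<mu> = D2_qu"
    and "lipschitz_measures \<mu>"
    and "is_lipschitz (skew_product \<theta> T)"
    and "stretched_exp_fiber_mixing \<theta> T \<mu>"
    and "stretched_exp_4_mixing P \<theta>"
  shows "AE \<omega> in P. AE (x, y) in \<mu> \<omega> \<Otimes>\<^sub>M \<mu> \<omega>.
           (\<lambda>n. - elog (min_orbit_dist \<theta> T \<omega> n x y) / ereal (ln (real n)))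
             \<longlonglongrightarrow> max (2 / D2_an) (1 / D2_qu)"
proof -
  interpret random_dynamical_system P \<nu> \<theta> T by fact
  interpret fibered_rds P \<nu> \<theta> T \<mu>
    by unfold_locales (fact assms(1) assms(4) continuous_base_of_skew_product[OF assms(10)])+
  let ?A = "correlation (fiber_marginal \<nu>)" and ?Q = "quenched_correlation P \<mu>"
  let ?m = "max (2 / D2_an) (1 / D2_qu)"
  have A0: "0 \<le> ?A r" and Q0: "0 \<le> ?Q r" for r
    using annealed_correlation_unit[of r] quenched_correlation_unit[of r] by auto
  note an = assms(5)[unfolded lower_D2_an_def] assms(6)[unfolded upper_D2_an_def]
  note qu = assms(7)[unfolded lower_D2_qu_def] assms(8)[unfolded upper_D2_qu_def]
  have Dan: "0 \<le> D2_an" by (rule Limsup_dimension_nonneg[OF an(2) annealed_correlation_unit])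
  have Dqu: "0 \<le> D2_qu" by (rule Limsup_dimension_nonneg[OF qu(2) quenched_correlation_unit])
  have m0: "0 \<le> ?m"
    using Dan by (cases D2_an) (auto simp: le_max_iff_disj divide_ereal_def)
  show ?thesis
  proof (rule close_pairs_probability[OF assms(9,11,12,2)])
    fix c K D r0 :: real and C0 :: nat
    assume c: "c > 0" and K: "K > 0" and r0: "r0 > 0"
    assume first: "\<And>r g n. 0 < r \<Longrightarrow> r < r0 \<Longrightarrow> g \<ge> 1 \<Longrightarrow> measure pairs (close_pairs n r) \<le>
        2 * real n * real g * (C0 * ?Q (8 * r)) + (real n)\<^sup>2 *
          (C0 * ?A (8 * r) + K * r powr (- D) * exp (- (real g powr c)))"
    assume second_qu: "\<And>r g n m. 0 < r \<Longrightarrow> r < r0 \<Longrightarrow> g \<ge> 1 \<Longrightarrow> m \<ge> 1 \<Longrightarrow> 2 * m * g \<le> n \<Longrightarrow>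
        ?Q r > 0 \<Longrightarrow> measure pairs (- close_pairs n (8 * r)) \<le>
        C0 / (real m * ?Q r) + 3 * (K * r powr (- D) * exp (- (real g powr c))) / (?Q r)\<^sup>2"
    assume second_an: "\<And>r g n m. 0 < r \<Longrightarrow> r < r0 \<Longrightarrow> g \<ge> 1 \<Longrightarrow> m \<ge> 1 \<Longrightarrow> 2 * m * g \<le> n \<Longrightarrow>
        ?A r > 0 \<Longrightarrow> measure pairs (- close_pairs n (8 * r)) \<le>
        2 * C0 / (real m * sqrt (?A r)) + C0 / ((real m)\<^sup>2 * ?A r)
          + 7 * (K * r powr (- D) * exp (- (real g powr c))) / (?A r)\<^sup>2"
    have up: "AE \<omega> in P. AE z in \<mu> \<omega> \<Otimes>\<^sub>M \<mu> \<omega>. \<forall>\<^sub>F l in sequentially.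
        (\<omega>, z) \<notin> close_pairs (2 ^ l) (real (2 ^ l) powr (- s))" if s: "s > 0" "?m < ereal s" for s
    proof (rule eventually_not_bad_fiber[where A = "\<lambda>n. close_pairs n (real n powr (- s))"])
      have "ereal 2 / D2_an < ereal s" "ereal 1 / D2_qu < ereal s" using s(2) by (simp_all add: one_ereal_def)
      then obtain D1 D2 where D: "ereal D1 < D2_an" "2 < s * D1" "ereal D2 < D2_qu" "1 < s * D2"
        using rate_above[OF Dan, of 2 s] rate_above[OF Dqu, of 1 s] s(1) by (metis zero_less_numeral zero_less_one)
      show "poly_decay (\<lambda>n. measure pairs (close_pairs n (real n powr (- s))))"
      proof (rule first_moment_decay[OF s(1) D(2,4) c K _ r0 Liminf_dimension[OF an(1) D(1) A0]
              Liminf_dimension[OF qu(1) D(3) Q0]])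
        fix r :: real and g n :: nat
        assume "0 < r" "r < r0" "g \<ge> 1" "r = real n powr (- s)"
        then show "measure pairs (close_pairs n (real n powr (- s))) \<le> 2 * real n * real g * (real C0 * ?Q (8 * r)) +
          (real n)\<^sup>2 * (real C0 * ?A (8 * r) + K * r powr (- D) * exp (- (real g powr c)))"
          using first[of r g n] by simp
      qed simp
    qed simp
    have lo: "AE \<omega> in P. AE z in \<mu> \<omega> \<Otimes>\<^sub>M \<mu> \<omega>. \<forall>\<^sub>F l in sequentially.
        (\<omega>, z) \<in> close_pairs (2 ^ l) (real (2 ^ l) powr (- s))" if s: "s > 0" "ereal s < ?m" for s
    proof -
      have "AE \<omega> in P. AE z in \<mu> \<omega> \<Otimes>\<^sub>M \<mu> \<omega>. \<forall>\<^sub>F l in sequentially.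
        (\<omega>, z) \<notin> - close_pairs (2 ^ l) (real (2 ^ l) powr (- s))"
      proof (rule eventually_not_bad_fiber[where A = "\<lambda>n. - close_pairs n (real n powr (- s))"])
        show "- close_pairs n (real n powr (- s)) \<in> sets BBB" for n
          using sets.compl_sets[OF close_pairs_measurable] by (simp add: Compl_eq_Diff_UNIV space_pair_measure)
        have "ereal s < ereal 2 / D2_an \<or> ereal s < ereal 1 / D2_qu"
          using s(2) by (simp add: less_max_iff_disj one_ereal_def)
        then show "poly_decay (\<lambda>n. measure pairs (- close_pairs n (real n powr (- s))))"
        proof
          assume "ereal s < ereal 2 / D2_an"
          then obtain d where d: "D2_an < ereal d" "s * d < 2"
            using rate_below[OF Dan, of s 2] s(1) by auto
          show ?thesis
          proof (rule annealed_second_moment_decay[OF s(1) d(2) c K _ r0 Limsup_dimension[OF an(2) d(1) A0]])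
            fix r :: real and g n m :: nat
            assume h: "0 < r" "r < r0" "g \<ge> 1" "m \<ge> 1" "2 * m * g \<le> n" "?A r > 0" "r = real n powr (- s) / 8"
            have "real n powr (- s) = 8 * r" using h(7) by simp
            then show "measure pairs (- close_pairs n (real n powr (- s))) \<le>
              2 * real C0 / (real m * sqrt (?A r)) + real C0 / ((real m)\<^sup>2 * ?A r)
              + 7 * (K * r powr (- D) * exp (- (real g powr c))) / (?A r)\<^sup>2"
              using second_an[OF h(1-6)] by (simp only:)
          qed simp
        next
          assume "ereal s < ereal 1 / D2_qu"
          then obtain d where d: "D2_qu < ereal d" "s * d < 1"
            using rate_below[OF Dqu, of s 1] s(1) by auto
          show ?thesis
          proof (rule quenched_second_moment_decay[OF s(1) d(2) c K _ r0 Limsup_dimension[OF qu(2) d(1) Q0]])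
            fix r :: real and g n m :: nat
            assume h: "0 < r" "r < r0" "g \<ge> 1" "m \<ge> 1" "2 * m * g \<le> n" "?Q r > 0" "r = real n powr (- s) / 8"
            have "real n powr (- s) = 8 * r" using h(7) by simp
            then show "measure pairs (- close_pairs n (real n powr (- s))) \<le>
              real C0 / (real m * ?Q r) + 3 * (K * r powr (- D) * exp (- (real g powr c))) / (?Q r)\<^sup>2"
              using second_qu[OF h(1-6)] by (simp only:)
          qed simp
        qed
      qed
      then show ?thesis by simp
    qed
    \<comment> \<open>Rational exponents suffice, and their exceptional null sets can be united.\<close>
    define U where "U = {s\<in>\<rat>. 0 < s \<and> ?m < ereal s}"
    define V where "V = {s\<in>\<rat>. 0 < s \<and> ereal s < ?m}"
    have cUV: "countable U" "countable V"
      unfolding U_def V_def by (rule countable_subset[OF _ countable_rat]; auto)+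
    have "AE \<omega> in P. \<forall>s\<in>U. AE z in \<mu> \<omega> \<Otimes>\<^sub>M \<mu> \<omega>. \<forall>\<^sub>F l in sequentially.
        (\<omega>, z) \<notin> close_pairs (2 ^ l) (real (2 ^ l) powr (- s))"
      using up by (subst AE_ball_countable[OF cUV(1)]) (simp add: U_def)
    moreover have "AE \<omega> in P. \<forall>s\<in>V. AE z in \<mu> \<omega> \<Otimes>\<^sub>M \<mu> \<omega>. \<forall>\<^sub>F l in sequentially.
        (\<omega>, z) \<in> close_pairs (2 ^ l) (real (2 ^ l) powr (- s))"
      using lo by (subst AE_ball_countable[OF cUV(2)]) (simp add: V_def)
    ultimately show ?thesis
    proof eventually_elim
      case (elim \<omega>)
      have mem: "(\<omega>, x, y) \<in> close_pairs n \<rho> \<longleftrightarrow> min_orbit_dist \<theta> T \<omega> n x y < \<rho>" if "n \<ge> 1" for x y n \<rho>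
        unfolding close_pairs_def min_orbit_dist_less_iff[OF that]
        by (simp add: first_orbit_def second_orbit_def orbit_def)
      note elim[unfolded AE_ball_countable[OF cUV(1), symmetric] AE_ball_countable[OF cUV(2), symmetric]]
      then show ?case
      proof eventually_elim
        case (elim z)
        obtain x y where z: "z = (x, y)" by (cases z)
        have "(\<lambda>n. - elog (min_orbit_dist \<theta> T \<omega> n x y) / ereal (ln (real n))) \<longlonglongrightarrow> ?m"
        proof (rule log_rate_limit[OF min_orbit_dist_nonneg min_orbit_dist_antimono m0])
          fix s :: real assume "s \<in> \<rat>" "0 < s" "?m < ereal s"
          then have "s \<in> U" by (simp add: U_def)
          then show "\<forall>\<^sub>F l in sequentially. \<not> min_orbit_dist \<theta> T \<omega> (2 ^ l) x y < real (2 ^ l) powr (- s)"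
            using elim(1) by (simp add: z mem)
        next
          fix s :: real assume "s \<in> \<rat>" "0 < s" "ereal s < ?m"
          then have "s \<in> V" by (simp add: V_def)
          then show "\<forall>\<^sub>F l in sequentially. min_orbit_dist \<theta> T \<omega> (2 ^ l) x y < real (2 ^ l) powr (- s)"
            using elim(2) by (simp add: z mem)
        qed
        then show ?case by (simp add: z)
      qed
    qed
  qed
qed

end
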